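(* Let $d\ge1$, let $\varphi$ satisfy (i) and (ii) of the context, fix $\lambda>0$ and $\ell\in S^{d-1}$, and define $a(\cdot,\omega)=\mathrm{Id}$ and $b(\cdot,\omega)=\nabla\varphi(\cdot,\omega)+\lambda\ell$ for all $\omega$. Then condition $(T)|\ell$ holds.
   Context: $(\Omega,\mathcal A,\mathbb P)$ is a probability space with a group $\{t_x:x\in\mathbb R^d\}$ of transformations, jointly measurable in $(x,\omega)$, with $t_x\mathbb P=\mathbb P$. $\varphi$ is a real random variable, $\varphi(x,\omega)=\varphi(t_x\omega)$. Conditions: (i) $|\varphi(\cdot,\omega)|\le\eta$ for all $\omega$; (ii) $|\nabla\varphi(\cdot,\omega)|\le\tilde\beta$ and $|\nabla\varphi(y,\omega)-\nabla\varphi(z,\omega)|\le K|y-z|$ for all $y,z,\omega$. $P_{x,\omega}$ is the law on $C(\mathbb R_+,\mathbb R^d)$ (canonical process $X$) of the diffusion with generator $\frac12\Delta+b(x,\omega)\cdot\nabla$ started at $x$; the annealed law is $P_0[\cdot]=\mathbb E[P_{0,\omega}[\cdot]]$. Condition $(T)|\ell$: for all $\ell'\in S^{d-1}$ in a neighborhood of $\ell$ and all $b>0$, $\limsup_{L\to\infty}L^{-1}\log P_0[X_{T_{U_{\ell',b,L}}}\cdot\ell'<0]<0$, where $U_{\ell',b,L}=\{x:-bL<x\cdot\ell'<L\}$ and $T_U=\inf\{t\ge0:X_t\notin U\}$. *)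

theory Defs
  imports "HOL-Analysis.Analysis" "HOL-Probability.Probability"
begin

definition pd :: "'n::finite \<Rightarrow> (real^'n \<Rightarrow> real) \<Rightarrow> real^'n \<Rightarrow> real" where
  "pd i g x = frechet_derivative g (at x) (axis i 1)"

definition grad :: "(real^'n::finite \<Rightarrow> real) \<Rightarrow> real^'n \<Rightarrow> real^'n" where
  "grad g x = (\<chi> i. pd i g x)"

definition laplacian :: "(real^'n::finite \<Rightarrow> real) \<Rightarrow> real^'n \<Rightarrow> real" where
  "laplacian g x = (\<Sum>i\<in>UNIV. pd i (pd i g) x)"

definition testfun :: "(real^'n::finite \<Rightarrow> real) \<Rightarrow> bool" where
  "testfun f \<longleftrightarrow> (\<forall>x. f differentiable (at x))
     \<and> (\<forall>i x. pd i f differentiable (at x))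
     \<and> (\<forall>i j. continuous_on UNIV (pd j (pd i f)))
     \<and> bounded {x. f x \<noteq> 0}"

definition gen :: "(real^'n::finite \<Rightarrow> real^'n) \<Rightarrow> (real^'n \<Rightarrow> real) \<Rightarrow> real^'n \<Rightarrow> real" where
  "gen b f x = (1/2) * laplacian f x + b x \<bullet> grad f x"

text \<open>Paths are continuous functions on R, frozen at their initial value for negative times,
  i.e. canonically identified with C(R_+, R^d).\<close>
definition paths :: "(real \<Rightarrow> real^'n::finite) set" where
  "paths = {w. continuous_on UNIV w \<and> (\<forall>t\<le>0. w t = w 0)}"

definition path_space :: "(real \<Rightarrow> real^'n::finite) measure" where
  "path_space = sigma paths {{w\<in>paths. w t \<in> B} | t B. 0 \<le> t \<and> B \<in> sets borel}"

definition filt :: "real \<Rightarrow> (real \<Rightarrow> real^'n::finite) measure" where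
  "filt s = sigma paths {{w\<in>paths. w t \<in> B} | t B. 0 \<le> t \<and> t \<le> s \<and> B \<in> sets borel}"

definition mart_proc ::
  "(real^'n::finite \<Rightarrow> real^'n) \<Rightarrow> (real^'n \<Rightarrow> real) \<Rightarrow> real \<Rightarrow> (real \<Rightarrow> real^'n) \<Rightarrow> real" where
  "mart_proc b f t w = f (w t) - f (w 0) - integral {0..t} (\<lambda>r. gen b f (w r))"

text \<open>P solves the martingale problem for generator (1/2)Delta + b.grad started at x,
  i.e. P is the law of the diffusion with this generator started at x.\<close>
definition solves_MP :: "(real^'n::finite \<Rightarrow> real^'n) \<Rightarrow> real^'n \<Rightarrow> (real \<Rightarrow> real^'n) measure \<Rightarrow> bool" where
  "solves_MP b x P \<longleftrightarrow> prob_space P \<and> sets P = sets path_space \<and> space P = paths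
     \<and> emeasure P {w\<in>paths. w 0 = x} = 1
     \<and> (\<forall>f. testfun f \<longrightarrow> (\<forall>s t. 0 \<le> s \<and> s \<le> t \<longrightarrow>
           integrable P (mart_proc b f t) \<and> integrable P (mart_proc b f s) \<and>
           (\<forall>A\<in>sets (filt s).
              (LINT w:A|P. mart_proc b f t w) = (LINT w:A|P. mart_proc b f s w))))"

definition slab :: "real^'n::finite \<Rightarrow> real \<Rightarrow> real \<Rightarrow> (real^'n) set" where
  "slab l b L = {x. - b * L < x \<bullet> l \<and> x \<bullet> l < L}"

definition exit_time :: "(real^'n::finite) set \<Rightarrow> (real \<Rightarrow> real^'n) \<Rightarrow> real" where
  "exit_time U w = Inf {t. 0 \<le> t \<and> w t \<notin> U}"

definition exit_back_event :: "real^'n::finite \<Rightarrow> real \<Rightarrow> real \<Rightarrow> (real \<Rightarrow> real^'n) set" where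
  "exit_back_event l b L = {w\<in>paths. (\<exists>t\<ge>0. w t \<notin> slab l b L)
       \<and> w (exit_time (slab l b L) w) \<bullet> l < 0}"

definition eln :: "real \<Rightarrow> ereal" where
  "eln p = (if p = 0 then -\<infinity> else ereal (ln p))"

definition annealed :: "'w measure \<Rightarrow> ('w \<Rightarrow> (real \<Rightarrow> real^'n::finite) measure) \<Rightarrow> (real \<Rightarrow> real^'n) set \<Rightarrow> real" where
  "annealed M P E = enn2real (\<integral>\<^sup>+ \<omega>. emeasure (P \<omega>) E \<partial>M)"

definition condT :: "'w measure \<Rightarrow> ('w \<Rightarrow> (real \<Rightarrow> real^'n::finite) measure) \<Rightarrow> real^'n \<Rightarrow> bool" where
  "condT M P l \<longleftrightarrow> (\<exists>e>0. \<forall>l'. norm l' = 1 \<and> dist l' l < e \<longrightarrow> (\<forall>b>0.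
      (\<forall>L. exit_back_event l' b L \<in> sets path_space) \<and>
      Limsup at_top (\<lambda>L::real. eln (annealed M P (exit_back_event l' b L)) / ereal L) < 0))"

end

theory Submission
  imports Defs
begin

text \<open>
  The estimate is quenched: it holds for every environment, with constants depending only on
  \<open>\<eta>\<close>, \<open>\<beta>\<close>, \<open>K\<close>, \<open>lam\<close> and the dimension. Write \<open>b = \<nabla>V\<close> with
  \<open>V x = \<phi> x + lam * (l \<bullet> x)\<close>. Fix a small radius \<open>\<epsilon>\<close>, a bump \<open>\<rho>\<close> supported in the ball of radius
  \<open>\<epsilon>\<close>, and let \<open>v t x = E (\<rho> (x - X t))\<close>. Since the generator is reversible with respect to
  \<open>exp (2 V)\<close>, the weighted energy of \<open>v t\<close>, with weight \<open>exp (- 2 V + 2 \<chi>)\<close> and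
  \<open>\<chi> x = \<delta> sqrt (1 + |x|^2)\<close>, is dissipated up to an error that is small with \<open>\<delta>\<close> and
  \<open>K \<epsilon>\<close>. The measure \<open>exp (2 V)\<close> is comparable to \<open>exp (2 lam (l \<bullet> x))\<close>, which has a spectral
  gap; so for fixed small \<open>\<epsilon>\<close> and \<open>\<delta>\<close> the energy decays exponentially in time.
  By Cauchy-Schwarz \<open>E (exp (- lam (l' \<bullet> X t)))\<close> decays exponentially as well, for all \<open>l'\<close> close
  to \<open>l\<close>, and a maximal inequality on unit time intervals bounds the probability of ever reaching
  \<open>{x. x \<bullet> l' \<le> - b L}\<close> by a multiple of \<open>exp (- lam b L)\<close>.
\<close>

subsection \<open>Twice differentiable test functions\<close>

text \<open>The martingale problem hands over neither a density nor any regularity, and the initial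
  law is a point mass, of infinite energy. Mollifying at one fixed radius answers both:
  \<open>v\<close> is smooth by construction, starts as a bump, and solves a forward equation whose
  drift flux is close to \<open>v b\<close> because \<open>b\<close> is Lipschitz. Put v = f exp (2
  V). The energy is then the integral of f^2 exp (2 V + 2 \<chi>), and the dissipation is governed
  by |grad f|^2. The gap comes from integrating the divergence of f^2 exp (2 lam (l . x) + 2 \<chi>)
  l, a field in which \<phi> enters only through f. Passing between the two weights costs the bound
  \<eta> on \<phi> alone, as a factor exp (-4 \<eta>). The weight \<chi> serves the Cauchy-Schwarz
  step: exp (-2 lam (l' . x)) divided by exp (-2 V) is bounded but not integrable for l' = l, and
  unbounded in some directions otherwise. The extra factor exp (-2 \<chi>) makes the quotient
  integrable and tolerates a tilt |l - l'| of order \<delta> / lam. In return \<chi> perturbs the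
  dissipation by its slope, at most \<delta>.\<close>

definition C2_data ::
  "(real^'n::finite \<Rightarrow> real) \<Rightarrow> (real^'n \<Rightarrow> real^'n) \<Rightarrow> (real^'n \<Rightarrow> real^'n^'n) \<Rightarrow> bool" where
  "C2_data q D H \<longleftrightarrow> (\<forall>x. (q has_derivative (\<lambda>h. D x \<bullet> h)) (at x)) \<and>
     (\<forall>x i. ((\<lambda>y. D y $ i) has_derivative (\<lambda>h. H x $ i \<bullet> h)) (at x)) \<and>
     (\<forall>i j. continuous_on UNIV (\<lambda>x. H x $ i $ j))"

lemma pd_eq:
  assumes "(g has_derivative (\<lambda>h. D \<bullet> h)) (at x)"
  shows "pd i g x = D $ i"
  unfolding pd_def frechet_derivative_at[OF assms, symmetric] by (simp add: inner_axis)

lemma grad_eq: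
  assumes "(g has_derivative (\<lambda>h. D \<bullet> h)) (at x)"
  shows "grad g x = D"
  by (simp add: grad_def vec_eq_iff pd_eq[OF assms])

lemma has_derivative_grad:
  fixes g :: "real^'n::finite \<Rightarrow> real"
  assumes "g differentiable (at x)"
  shows "(g has_derivative (\<lambda>h. grad g x \<bullet> h)) (at x)"
proof -
  define f' where "f' = frechet_derivative g (at x)"
  have d: "(g has_derivative f') (at x)"
    using assms by (simp add: f'_def frechet_derivative_works)
  have lin: "linear f'" using d by (rule has_derivative_linear)
  have "f' h = grad g x \<bullet> h" for h
  proof -
    have "h = (\<Sum>i\<in>UNIV. h $ i *\<^sub>R axis i 1)"
      by (metis basis_expansion scalar_mult_eq_scaleR)
    then have "f' h = (\<Sum>i\<in>UNIV. h $ i * f' (axis i 1))"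
      using lin by (metis (mono_tags, lifting) linear_sum linear_cmul real_scaleR_def sum.cong)
    then show ?thesis
      by (simp add: grad_def pd_def inner_vec_def f'_def mult.commute)
  qed
  then show ?thesis using d by (metis ext)
qed

text \<open>Carrying the gradient and the Hessian as explicit data lets every operation on functions
  produce its own derivative formulas; uniqueness of derivatives then identifies \<open>pd\<close>
  and \<open>gen\<close> without differentiating again.\<close>

lemma C2_data_testfun:
  assumes C: "C2_data q D H" and bd: "bounded {x. q x \<noteq> 0}"
  shows "testfun q" and "gen b q x = (1/2) * (\<Sum>i\<in>UNIV. H x $ i $ i) + b x \<bullet> D x"
proof -
  have 1: "(q has_derivative (\<lambda>h. D x \<bullet> h)) (at x)"
    and 2: "((\<lambda>y. D y $ i) has_derivative (\<lambda>h. H x $ i \<bullet> h)) (at x)"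
    and 3: "continuous_on UNIV (\<lambda>x. H x $ i $ j)" for x i j
    using C unfolding C2_data_def by blast+
  have p1: "pd i q = (\<lambda>x. D x $ i)" for i using pd_eq[OF 1] by auto
  have p2: "pd j (pd i q) = (\<lambda>x. H x $ i $ j)" for i j using pd_eq[OF 2] by (auto simp: p1)
  show "testfun q"
    unfolding testfun_def p2 using 1 2 3 bd by (auto simp: p1 differentiable_def intro: exI)
  show "gen b q x = (1/2) * (\<Sum>i\<in>UNIV. H x $ i $ i) + b x \<bullet> D x"
    by (simp add: gen_def laplacian_def p2 grad_eq[OF 1])
qed

text \<open>Away from 0 this is a power or zero; at the kink the difference quotient is at most
  |h|^n, which tends to 0. Applied for n = 2 and then n = 1 it makes the cube of the positive part
  twice differentiable, the lowest integer power that is C^2.\<close>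

lemma DERIV_max0_power:
  fixes s :: real
  assumes "n \<ge> 1"
  shows "((\<lambda>s. (max 0 s) ^ Suc n) has_real_derivative (real (Suc n) * (max 0 s) ^ n)) (at s)"
proof (cases s "0::real" rule: linorder_cases)
  case less
  have "((\<lambda>s. 0) has_real_derivative 0) (at s)" by simp
  then have "((\<lambda>s. (max 0 s) ^ Suc n) has_real_derivative 0) (at s)"
    by (rule DERIV_cong_ev[THEN iffD1, rotated -1])
       (use less in \<open>auto simp: eventually_nhds_metric dist_real_def intro!: exI[of _ "-s"]\<close>)
  then show ?thesis using less assms by (simp add: max_def zero_power)
next
  case greater
  have "((\<lambda>s. s ^ Suc n) has_real_derivative (real (Suc n) * s ^ n)) (at s)"
    using DERIV_pow[of "Suc n" s UNIV] by simp
  then have "((\<lambda>s. (max 0 s) ^ Suc n) has_real_derivative (real (Suc n) * s ^ n)) (at s)"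
    by (rule DERIV_cong_ev[THEN iffD1, rotated -1])
       (use greater in \<open>auto simp: eventually_nhds_metric dist_real_def intro!: exI[of _ "s"]\<close>)
  then show ?thesis using greater by simp
next
  case equal
  have "(\<lambda>h. ((max 0 (0+h)) ^ Suc n - (max 0 (0::real)) ^ Suc n) / h) \<midarrow>0\<rightarrow> 0"
  proof (rule Lim_null_comparison)
    show "\<forall>\<^sub>F h in at (0::real). norm ((max 0 (0+h) ^ Suc n - (max 0 (0::real)) ^ Suc n) / h) \<le> \<bar>h\<bar> ^ n"
      by (rule always_eventually) (auto simp: max_def abs_mult power_abs)
    show "((\<lambda>h::real. \<bar>h\<bar> ^ n) \<longlongrightarrow> 0) (at 0)"
      using assms by (auto intro!: tendsto_eq_intros)
  qed
  then show ?thesis using assms equal by (simp add: DERIV_def zero_power)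
qed

text \<open>The truncation behind every test function below: compose a function that is positive
  only on a bounded set with the cubed positive part. In the Hessian the term with
  \<open>D x $ i * D x $ j\<close> vanishes only to first order at the edge of the support, all
  others to second order; the submartingale estimate rests on this difference.\<close>

lemma C2_data_cube:
  assumes C: "C2_data q D H"
  shows "C2_data (\<lambda>x. (max 0 (q x)) ^ 3) (\<lambda>x. (3 * (max 0 (q x))\<^sup>2) *\<^sub>R D x)
     (\<lambda>x. \<chi> i j. 6 * max 0 (q x) * D x $ i * D x $ j + 3 * (max 0 (q x))\<^sup>2 * H x $ i $ j)"
proof -
  have 1: "(q has_derivative (\<lambda>h. D x \<bullet> h)) (at x)"
    and 2: "((\<lambda>y. D y $ i) has_derivative (\<lambda>h. H x $ i \<bullet> h)) (at x)"
    and 3: "continuous_on UNIV (\<lambda>x. H x $ i $ j)" for x i j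
    using C unfolding C2_data_def by blast+
  have q_cont: "continuous_on UNIV q"
    using 1 by (meson continuous_at_imp_continuous_on has_derivative_continuous)
  have D_cont: "continuous_on UNIV (\<lambda>y. D y $ i)" for i
    using 2 by (meson continuous_at_imp_continuous_on has_derivative_continuous)
  have d3: "((\<lambda>x. (max 0 (q x)) ^ 3) has_derivative (\<lambda>h. ((3 * (max 0 (q x))\<^sup>2) *\<^sub>R D x) \<bullet> h)) (at x)" for x
  proof -
    have "((\<lambda>s. (max 0 s) ^ 3) has_real_derivative 3 * (max 0 (q x))\<^sup>2) (at (q x))"
      using DERIV_max0_power[of 2 "q x"] by (simp add: numeral_3_eq_3 power2_eq_square)
    from has_derivative_compose[OF 1 this[unfolded has_field_derivative_def]] show ?thesis by simp
  qed
  have d2: "((\<lambda>x. (max 0 (q x)) ^ 2) has_derivative (\<lambda>h. (2 * (max 0 (q x))) * (D x \<bullet> h))) (at x)" for x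
  proof -
    have "((\<lambda>s. (max 0 s) ^ 2) has_real_derivative 2 * max 0 (q x)) (at (q x))"
      using DERIV_max0_power[of 1 "q x"] by (simp add: numeral_2_eq_2)
    from has_derivative_compose[OF 1 this[unfolded has_field_derivative_def]] show ?thesis by simp
  qed
  have "((\<lambda>y. ((3 * (max 0 (q y))\<^sup>2) *\<^sub>R D y) $ i) has_derivative
     (\<lambda>h. (\<chi> j. 6 * max 0 (q x) * D x $ i * D x $ j + 3 * (max 0 (q x))\<^sup>2 * H x $ i $ j) \<bullet> h)) (at x)" for x i
  proof -
    have "((\<lambda>y. 3 * ((max 0 (q y))\<^sup>2 * D y $ i)) has_derivative
       (\<lambda>h. 3 * ((max 0 (q x))\<^sup>2 * (H x $ i \<bullet> h) + ((2 * (max 0 (q x))) * (D x \<bullet> h)) * D x $ i))) (at x)"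
      by (intro has_derivative_mult_right has_derivative_mult d2 2)
    moreover have "(\<chi> j. 6 * max 0 (q x) * D x $ i * D x $ j + 3 * (max 0 (q x))\<^sup>2 * H x $ i $ j)
       = (6 * max 0 (q x) * D x $ i) *\<^sub>R D x + (3 * (max 0 (q x))\<^sup>2) *\<^sub>R H x $ i"
      by (simp add: vec_eq_iff)
    ultimately show ?thesis
      by (simp add: algebra_simps inner_add_left)
  qed
  moreover have "continuous_on UNIV (\<lambda>x. (\<chi> i j. 6 * max 0 (q x) * D x $ i * D x $ j
      + 3 * (max 0 (q x))\<^sup>2 * H x $ i $ j) $ i $ j)" for i j
    by (simp, intro continuous_intros q_cont D_cont 3)
  ultimately show ?thesis
    unfolding C2_data_def using d3 by (intro conjI allI) (simp_all only: vec_lambda_beta)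
qed

subsection \<open>Paths and Dynkin's formula\<close>

text \<open>The product exp (- C t) y t has a nonpositive derivative. Both signs of \<open>C\<close>
  and of \<open>y\<close> occur later: with \<open>y\<close> nonpositive and \<open>C\<close>
  negative the lemma yields a lower bound.\<close>

lemma gronwall_within:
  fixes y y' :: "real \<Rightarrow> real"
  assumes "s \<le> T"
    and d: "\<And>t. t \<in> {s..T} \<Longrightarrow> (y has_real_derivative y' t) (at t within {s..T})"
    and le: "\<And>t. t \<in> {s..T} \<Longrightarrow> y' t \<le> C * y t"
  shows "y T \<le> exp (C * (T - s)) * y s"
proof -
  have "exp (- C * T) * y T \<le> exp (- C * s) * y s"
  proof (rule DERIV_nonpos_imp_decreasing_open[OF \<open>s \<le> T\<close>])
    have "continuous_on {s..T} y"
      using d DERIV_continuous_on by blast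
    then show "continuous_on {s..T} (\<lambda>t. exp (- C * t) * y t)"
      by (intro continuous_intros)
    fix t assume t: "s < t" "t < T"
    then have "(y has_real_derivative y' t) (at t)"
      using d[of t] at_within_Icc_at[of s t T] by simp
    then have "((\<lambda>t. exp (- C * t) * y t) has_real_derivative
       exp (- C * t) * (y' t - C * y t)) (at t)"
      by (auto intro!: derivative_eq_intros simp: algebra_simps)
    then show "\<exists>z. ((\<lambda>t. exp (- C * t) * y t) has_real_derivative z) (at t) \<and> z \<le> 0"
      using le[of t] t by (intro exI conjI) (auto intro: mult_nonneg_nonpos)
  qed
  then have "exp (C * T) * (exp (- C * T) * y T) \<le> exp (C * T) * (exp (- C * s) * y s)"
    by (rule mult_left_mono) simp
  moreover have "exp (C * T) * exp (- C * T) = 1" "exp (C * T) * exp (- C * s) = exp (C * (T - s))"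
    by (simp_all flip: exp_add add: right_diff_distrib)
  ultimately show ?thesis
    by (simp only: mult.assoc[symmetric] mult_1)
qed

text \<open>The partial derivatives vanish wherever \<open>f\<close> vanishes on an open set, here
  outside a closed ball. So \<open>gen b f\<close> has compact support too, and continuity gives the
  bounds.\<close>

lemma testfun_gen_continuous_bounded:
  assumes f: "testfun f" and b: "continuous_on UNIV b"
  shows "continuous_on UNIV (gen b f)" and "\<exists>C. \<forall>x. \<bar>gen b f x\<bar> \<le> C"
    and "continuous_on UNIV f" and "\<exists>C. \<forall>x. \<bar>f x\<bar> \<le> C"
proof -
  have d1: "f differentiable (at x)" and d2: "pd i f differentiable (at x)"
    and c: "continuous_on UNIV (pd j (pd i f))" and bd: "bounded {x. f x \<noteq> 0}" for x i j
    using f unfolding testfun_def by blast+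
  show cf: "continuous_on UNIV f"
    by (intro continuous_at_imp_continuous_on ballI differentiable_imp_continuous_within d1)
  have cp: "continuous_on UNIV (pd i f)" for i
    by (intro continuous_at_imp_continuous_on ballI differentiable_imp_continuous_within d2)
  show cg: "continuous_on UNIV (gen b f)"
    unfolding gen_def laplacian_def grad_def inner_vec_def
    by (simp only: vec_lambda_beta inner_real_def, intro continuous_intros c cp b) auto
  obtain R where R: "\<And>x. f x \<noteq> 0 \<Longrightarrow> norm x \<le> R" using bd unfolding bounded_iff by blast
  have zero: "pd i g x = 0" if "\<And>y. norm y > R \<Longrightarrow> g y = 0" "norm x > R"
    for g :: "real^'a \<Rightarrow> real" and i x
  proof -
    have "(g has_derivative (\<lambda>h. 0)) (at x)"
      by (rule has_derivative_transform_within_open[OF has_derivative_const[of 0], of "- cball 0 R"])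
         (use that in auto)
    from frechet_derivative_at[OF this, symmetric] show ?thesis unfolding pd_def by simp
  qed
  have f0: "f x = 0" if "norm x > R" for x using R[of x] that by force
  have p0: "pd i f x = 0" if "norm x > R" for x i using zero[of f] f0 that by blast
  have p1: "pd j (pd i f) x = 0" if "norm x > R" for x i j using zero[of "pd i f"] p0 that by blast
  have g0: "gen b f x = 0" if "norm x > R" for x
    using that by (simp add: gen_def laplacian_def grad_def inner_vec_def p0 p1)
  have *: "\<exists>C. \<forall>x. \<bar>g x\<bar> \<le> C" if "continuous_on UNIV g" "\<And>x. norm x > R \<Longrightarrow> g x = 0"
    for g :: "real^'a \<Rightarrow> real"
  proof -
    have "compact (g ` cball 0 R)"
      by (intro compact_continuous_image compact_cball continuous_on_subset[OF that(1)]) simp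
    then have "bounded (g ` cball 0 R)" by (rule compact_imp_bounded)
    then obtain C where C: "\<And>x. x \<in> cball 0 R \<Longrightarrow> \<bar>g x\<bar> \<le> C"
      unfolding bounded_iff by (metis imageI real_norm_def)
    have "\<bar>g x\<bar> \<le> max C 0" for x
    proof (cases "norm x > R")
      case False
      then have "\<bar>g x\<bar> \<le> C" by (intro C) auto
      then show ?thesis by simp
    qed (simp add: that(2))
    then show ?thesis by blast
  qed
  show "\<exists>C. \<forall>x. \<bar>gen b f x\<bar> \<le> C" using *[OF cg g0] by blast
  show "\<exists>C. \<forall>x. \<bar>f x\<bar> \<le> C" using *[OF cf f0] by blast
qed

lemma filt_generator_subset: "{{w\<in>paths. w t \<in> B} | t B. 0 \<le> t \<and> t \<le> s \<and> B \<in> sets borel} \<subseteq> Pow paths"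
  and path_space_generator_subset: "{{w\<in>paths. w t \<in> B} | t B. 0 \<le> t \<and> B \<in> sets borel} \<subseteq> Pow paths"
  by auto

lemma space_path_space [simp]: "space path_space = paths"
  by (simp add: path_space_def space_measure_of[OF path_space_generator_subset])

lemma space_filt [simp]: "space (filt s) = paths"
  by (simp add: filt_def space_measure_of[OF filt_generator_subset])

lemma sets_filt_subset: "sets (filt s) \<subseteq> sets path_space"
  unfolding filt_def path_space_def sets_measure_of[OF filt_generator_subset]
    sets_measure_of[OF path_space_generator_subset]
  by (rule sigma_sets_mono') auto

lemma coordinate_measurable_filt:
  assumes "0 \<le> t" "t \<le> s"
  shows "(\<lambda>w. w t) \<in> borel_measurable (filt s)"
proof (rule measurableI)
  fix B :: "(real^'n) set" assume "B \<in> sets borel"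
  then have "{w\<in>paths. w t \<in> B} \<in> sets (filt s)"
    unfolding filt_def sets_measure_of[OF filt_generator_subset]
    using assms by (intro sigma_sets.Basic) auto
  then show "(\<lambda>w. w t) -` B \<inter> space (filt s) \<in> sets (filt s)"
    by (simp add: vimage_def Int_def conj_commute)
qed auto

text \<open>Paths are frozen at negative times, so the coordinate at t is the coordinate at max 0 t.
  Later statements can therefore let t range over all reals.\<close>

lemma coordinate_measurable: "(\<lambda>w :: real \<Rightarrow> real^'n::finite. w t) \<in> borel_measurable path_space"
proof -
  have "(\<lambda>w :: real \<Rightarrow> real^'n::finite. w (max 0 t)) \<in> borel_measurable (filt (max 0 t))"
    by (rule coordinate_measurable_filt) auto
  then have "(\<lambda>w :: real \<Rightarrow> real^'n::finite. w (max 0 t)) \<in> borel_measurable path_space"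
    by (rule subsetD[OF measurable_mono[OF order_refl refl sets_filt_subset], rotated]) simp
  moreover have "w (max 0 t) = w t" if "w \<in> paths" for w :: "real \<Rightarrow> real^'n"
  proof (cases "t \<le> 0")
    case True
    then have "w t = w 0" using that unfolding paths_def by blast
    then show ?thesis using True by (simp add: max_absorb1)
  qed auto
  then have "(\<lambda>w :: real \<Rightarrow> real^'n. w (max 0 t)) \<in> borel_measurable path_space \<longleftrightarrow>
      (\<lambda>w :: real \<Rightarrow> real^'n. w t) \<in> borel_measurable path_space"
    by (intro measurable_cong) simp
  ultimately show ?thesis by blast
qed

text \<open>All information about the process enters through the martingale problem, tested on
  events of the past; neither a stochastic differential equation nor the Markov property is
  invoked.\<close>

locale diffusion_law =
  fixes b :: "real^'n::finite \<Rightarrow> real^'n" and P :: "(real \<Rightarrow> real^'n) measure" and B :: real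
  assumes MP: "solves_MP b 0 P"
    and b_continuous: "continuous_on UNIV b"
    and b_bounded: "norm (b x) \<le> B"
begin

sublocale prob_space P
  using MP by (simp add: solves_MP_def)

lemma sets_P [measurable_cong]: "sets P = sets path_space"
  and space_P: "space P = paths"
  and start_P: "AE w in P. w 0 = 0"
proof -
  show s: "sets P = sets path_space" and sp: "space P = paths" using MP by (simp_all add: solves_MP_def)
  have "prob {w\<in>paths. w 0 = 0} = 1" using MP by (simp add: solves_MP_def measure_def)
  moreover have "{w\<in>space path_space. w 0 = (0::real^'n)} \<in> sets path_space"
    using coordinate_measurable by measurable
  ultimately show "AE w in P. w 0 = 0"
    using AE_in_set_eq_1[of "{w\<in>paths. w 0 = (0::real^'n)}"] by (auto simp: s elim: eventually_mono)
qed

lemma coordinate_measurable_P [measurable]: "(\<lambda>w. w t) \<in> borel_measurable P"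
  using coordinate_measurable by (simp add: measurable_cong_sets[OF sets_P refl])

lemma path_continuous: "w \<in> space P \<Longrightarrow> continuous_on UNIV w"
  by (simp add: space_P paths_def)

lemma path_tendsto: "w \<in> space P \<Longrightarrow> f \<longlonglongrightarrow> t \<Longrightarrow> (\<lambda>n. w (f n)) \<longlonglongrightarrow> w t"
  using path_continuous continuous_on_tendsto_compose[of UNIV w f t sequentially] by auto

text \<open>Rounding the time down to a multiple of 1 / (k + 1) leaves countably many coordinate
  maps, and by path continuity these approximations converge pointwise.\<close>

lemma coordinate_measurable_pair [measurable]:
  "(\<lambda>p. snd p (fst p)) \<in> borel_measurable ((borel :: real measure) \<Otimes>\<^sub>M P)"
proof (rule borel_measurable_LIMSEQ_metric)
  fix k :: nat
  show "(\<lambda>p. snd p (of_int \<lfloor>real (Suc k) * fst p\<rfloor> / real (Suc k))) \<in> borel_measurable ((borel :: real measure) \<Otimes>\<^sub>M P)"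
    by (rule measurable_compose_countable[where f="\<lambda>i p. snd p (of_int i / real (Suc k))"]) measurable
next
  fix p assume p: "p \<in> space ((borel :: real measure) \<Otimes>\<^sub>M P)"
  have "(\<lambda>k. of_int \<lfloor>real (Suc k) * fst p\<rfloor> / real (Suc k)) \<longlonglongrightarrow> fst p"
  proof (rule LIMSEQ_I)
    fix r :: real assume "r > 0"
    then obtain N where N: "inverse (real (Suc N)) < r" using reals_Archimedean by blast
    have "norm (of_int \<lfloor>real (Suc k) * fst p\<rfloor> / real (Suc k) - fst p) < r" if "k \<ge> N" for k
    proof -
      have "of_int \<lfloor>real (Suc k) * fst p\<rfloor> / real (Suc k) - fst p
          = (of_int \<lfloor>real (Suc k) * fst p\<rfloor> - real (Suc k) * fst p) / real (Suc k)"
        by (simp add: diff_divide_distrib del: of_nat_Suc)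
      moreover have "\<bar>of_int \<lfloor>real (Suc k) * fst p\<rfloor> - real (Suc k) * fst p\<bar> \<le> 1" by linarith
      ultimately have "\<bar>of_int \<lfloor>real (Suc k) * fst p\<rfloor> / real (Suc k) - fst p\<bar> \<le> inverse (real (Suc k))"
        by (simp only: abs_divide abs_of_nat inverse_eq_divide) (rule divide_right_mono, auto)
      also have "\<dots> \<le> inverse (real (Suc N))" using that by simp
      finally show ?thesis using N by simp
    qed
    then show "\<exists>N. \<forall>k\<ge>N. norm (of_int \<lfloor>real (Suc k) * fst p\<rfloor> / real (Suc k) - fst p) < r" by blast
  qed
  then show "(\<lambda>k. snd p (of_int \<lfloor>real (Suc k) * fst p\<rfloor> / real (Suc k))) \<longlonglongrightarrow> snd p (fst p)"
    using p by (intro path_tendsto) (auto simp: space_pair_measure)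
qed

text \<open>Sequential continuity by dominated convergence. The indicator is carried along so that
  one lemma serves plain expectations, with \<open>A\<close> the whole space, and expectations
  restricted to an event of the past.\<close>

lemma expectation_continuous:
  fixes k :: "'a::{metric_space,second_countable_topology} \<Rightarrow> real^'n \<Rightarrow> real"
  assumes k: "continuous_on UNIV (\<lambda>(x, y). k x y)" and bd: "\<And>x y. \<bar>k x y\<bar> \<le> C"
    and A[measurable]: "A \<in> sets P"
  shows "continuous_on UNIV (\<lambda>(t, x). \<integral>w. indicator A w * k x (w t) \<partial>P)"
proof -
  have km: "k x \<in> borel_measurable borel" for x
  proof (rule borel_measurable_continuous_onI)
    show "continuous_on UNIV (k x)"
      using continuous_on_compose2[OF k continuous_on_Pair[OF continuous_on_const[of UNIV x] continuous_on_id]] by simp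
  qed
  note [measurable] = measurable_compose[OF coordinate_measurable_P km]
  show ?thesis
  unfolding continuous_on_sequentially
  proof safe
    fix t x and f :: "nat \<Rightarrow> real \<times> 'a" assume f: "f \<longlonglongrightarrow> (t, x)"
    have f1: "(\<lambda>n. fst (f n)) \<longlonglongrightarrow> t" and f2: "(\<lambda>n. snd (f n)) \<longlonglongrightarrow> x"
      using tendsto_fst[OF f] tendsto_snd[OF f] by auto
    have "(\<lambda>n. \<integral>w. indicator A w * k (snd (f n)) (w (fst (f n))) \<partial>P) \<longlonglongrightarrow> (\<integral>w. indicator A w * k x (w t) \<partial>P)"
    proof (rule integral_dominated_convergence[where w="\<lambda>_. C"])
      show "AE w in P. (\<lambda>n. indicator A w * k (snd (f n)) (w (fst (f n)))) \<longlonglongrightarrow> indicator A w * k x (w t)"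
      proof (rule AE_I2)
        fix w assume w: "w \<in> space P"
        have "(\<lambda>n. (snd (f n), w (fst (f n)))) \<longlonglongrightarrow> (x, w t)"
          by (intro tendsto_Pair f2 path_tendsto w f1)
        then have "(\<lambda>n. k (snd (f n)) (w (fst (f n)))) \<longlonglongrightarrow> k x (w t)"
          using continuous_on_tendsto_compose[OF k, of "\<lambda>n. (snd (f n), w (fst (f n)))" "(x, w t)" sequentially] by auto
        then show "(\<lambda>n. indicator A w * k (snd (f n)) (w (fst (f n)))) \<longlonglongrightarrow> indicator A w * k x (w t)"
          by (rule tendsto_mult_left)
      qed
      show "AE w in P. norm (indicator A w * k (snd (f n)) (w (fst (f n)))) \<le> C" for n
        using bd abs_ge_zero[THEN order_trans, OF bd] by (auto simp: indicator_def)
    qed auto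
    then show "((\<lambda>(t, x). \<integral>w. indicator A w * k x (w t) \<partial>P) \<circ> f) \<longlonglongrightarrow> (\<integral>w. indicator A w * k x (w t) \<partial>P)"
      by (simp add: comp_def case_prod_beta)
  qed
qed

lemma expectation_continuous_time:
  fixes g :: "real^'n \<Rightarrow> real"
  assumes gc: "continuous_on UNIV g" and bd: "\<And>y. \<bar>g y\<bar> \<le> C" and A: "A \<in> sets P"
  shows "continuous_on UNIV (\<lambda>r. \<integral>w. indicator A w * g (w r) \<partial>P)"
proof -
  have "continuous_on UNIV (\<lambda>(x::real, y). g y)"
    unfolding case_prod_beta by (intro continuous_on_compose2[OF gc] continuous_intros) auto
  from expectation_continuous[OF this bd A] show ?thesis
    using continuous_on_compose2[of UNIV "\<lambda>(r, x::real). \<integral>w. indicator A w * g (w r) \<partial>P" UNIV,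
        OF _ continuous_on_Pair[OF continuous_on_id continuous_on_const[of _ 0]]] by auto
qed

text \<open>Fubini turns the martingale identity on \<open>A\<close> into an identity between
  deterministic functions of time. From here on, stochastic arguments reduce to calculus in
  t.\<close>

lemma dynkin:
  assumes f: "testfun f" and st: "0 \<le> s" "s \<le> t" and A: "A \<in> sets (filt s)"
  shows "((\<lambda>r. \<integral>w. indicator A w * gen b f (w r) \<partial>P) has_integral
     ((\<integral>w. indicator A w * f (w t) \<partial>P) - (\<integral>w. indicator A w * f (w s) \<partial>P))) {s..t}"
proof -
  let ?g = "gen b f"
  have AP[measurable]: "A \<in> sets P" using A sets_filt_subset sets_P by blast
  obtain Cg where Cg: "\<And>x. \<bar>?g x\<bar> \<le> Cg" using testfun_gen_continuous_bounded(2)[OF f b_continuous] by blast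
  obtain Cf where Cf: "\<And>x. \<bar>f x\<bar> \<le> Cf" using testfun_gen_continuous_bounded(4)[OF f b_continuous] by blast
  have gc: "continuous_on UNIV ?g" and fc: "continuous_on UNIV f"
    using testfun_gen_continuous_bounded[OF f b_continuous] by auto
  have [measurable]: "?g \<in> borel_measurable borel" "f \<in> borel_measurable borel"
    using gc fc by (auto intro: borel_measurable_continuous_onI)
  have c: "continuous_on UNIV (\<lambda>r. \<integral>w. indicator A w * ?g (w r) \<partial>P)"
    by (rule expectation_continuous_time[OF gc Cg AP])
  have fint: "integrable P (\<lambda>w. indicator A w * f (w r))" for r
    by (rule integrable_const_bound[where B=Cf])
       (use Cf abs_ge_zero[THEN order_trans, OF Cf] in \<open>auto simp: indicator_def\<close>)
  have mt: "integrable P (mart_proc b f t)" and ms: "integrable P (mart_proc b f s)"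
    and eq: "(LINT w:A|P. mart_proc b f t w) = (LINT w:A|P. mart_proc b f s w)"
    using MP f st A unfolding solves_MP_def by blast+
  interpret pair_sigma_finite P lborel ..
  let ?F = "\<lambda>(w, r). indicator A w * (indicator {s..t} r * ?g (w r))"
  have Fm[measurable]: "?F \<in> borel_measurable (P \<Otimes>\<^sub>M lborel)"
  proof -
    have "(\<lambda>p. snd (snd p, fst p) (fst (snd p, fst p))) \<in> borel_measurable (P \<Otimes>\<^sub>M lborel)"
      by (rule measurable_compose[OF _ coordinate_measurable_pair]) measurable
    then have [measurable]: "(\<lambda>p. (fst p) (snd p)) \<in> borel_measurable (P \<Otimes>\<^sub>M (lborel :: real measure))" by simp
    show ?thesis unfolding case_prod_beta by measurable
  qed
  have Fi: "integrable (P \<Otimes>\<^sub>M lborel) ?F"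
  proof (rule Bochner_Integration.integrable_bound)
    show "integrable (P \<Otimes>\<^sub>M lborel) (\<lambda>p. indicator {s..t} (snd p) * Cg)"
    proof (rule Fubini_integrable)
      show "integrable P (\<lambda>x. \<integral>y. norm (indicator {s..t} (snd (x, y)) * Cg) \<partial>lborel)" by simp
      show "AE x in P. integrable lborel (\<lambda>y. indicator {s..t} (snd (x, y)) * Cg)"
        using st by simp
    qed measurable
    show "AE p in P \<Otimes>\<^sub>M lborel. norm (?F p) \<le> norm (indicator {s..t} (snd p) * Cg)"
      using Cg abs_ge_zero[THEN order_trans, OF Cg] by (auto simp: indicator_def)
  qed measurable
  have cw: "continuous_on S (\<lambda>r. ?g (w r))" if "w \<in> space P" for w S
    by (rule continuous_on_subset[OF continuous_on_compose2[OF gc path_continuous[OF that]]]) auto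
  have io: "(\<lambda>r. ?g (w r)) integrable_on {a..c}" if "w \<in> space P" for w a c
    by (rule integrable_continuous_real[OF cw[OF that]])
  have inner: "(\<integral>r. indicator {s..t} r * ?g (w r) \<partial>lborel) = integral {s..t} (\<lambda>r. ?g (w r))" if "w \<in> space P" for w
  proof -
    have "set_integrable lborel {s..t} (\<lambda>r. ?g (w r))"
      unfolding set_integrable_def
      by (rule borel_integrable_compact[OF compact_Icc cw[OF that]])
    from set_borel_integral_eq_integral(2)[OF this] show ?thesis by (simp add: set_lebesgue_integral_def)
  qed
  let ?m = "\<lambda>w. mart_proc b f t w - mart_proc b f s w"
  have split: "?m w = f (w t) - f (w s) - integral {s..t} (\<lambda>r. ?g (w r))"
    if "w \<in> space P" for w
    using Henstock_Kurzweil_Integration.integral_combine[OF st io[OF that]]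
    by (simp add: mart_proc_def)
  have "(\<integral>w. indicator A w * f (w t) \<partial>P) - (\<integral>w. indicator A w * f (w s) \<partial>P)
      = (\<integral>w. indicator A w * (f (w t) - f (w s)) \<partial>P)"
    unfolding right_diff_distrib by (rule Bochner_Integration.integral_diff[OF fint fint, symmetric])
  also have "\<dots> = (\<integral>w. indicator A w * (?m w)
        + (\<integral>r. ?F (w, r) \<partial>lborel) \<partial>P)"
    by (intro Bochner_Integration.integral_cong) (auto simp: split inner right_diff_distrib)
  also have "\<dots> = (\<integral>w. indicator A w * (?m w) \<partial>P) + (\<integral>w. (\<integral>r. ?F (w, r) \<partial>lborel) \<partial>P)"
  proof (rule Bochner_Integration.integral_add)
    show "integrable P (\<lambda>w. \<integral>r. ?F (w, r) \<partial>lborel)" using integrable_fst'[OF Fi] by simp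
    show "integrable P (\<lambda>w. indicator A w * (?m w))"
      using integrable_mult_indicator[OF AP Bochner_Integration.integrable_diff[OF mt ms]] by simp
  qed
  also have "(\<integral>w. indicator A w * (?m w) \<partial>P) = 0"
    using eq Bochner_Integration.integral_diff[OF integrable_mult_indicator[OF AP mt] integrable_mult_indicator[OF AP ms]]
    by (simp add: set_lebesgue_integral_def right_diff_distrib)
  also have "(\<integral>w. (\<integral>r. ?F (w, r) \<partial>lborel) \<partial>P) = (\<integral>r. (\<integral>w. ?F (w, r) \<partial>P) \<partial>lborel)"
    using Fubini_integral[OF Fi] by simp
  also have "\<dots> = (LINT r:{s..t}|lborel. \<integral>w. indicator A w * ?g (w r) \<partial>P)"
    unfolding set_lebesgue_integral_def
    by (intro Bochner_Integration.integral_cong refl) (simp add: indicator_def)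
  also have "0 + \<dots> = integral {s..t} (\<lambda>r. \<integral>w. indicator A w * ?g (w r) \<partial>P)"
  proof -
    have "set_integrable lborel {s..t} (\<lambda>r. \<integral>w. indicator A w * ?g (w r) \<partial>P)"
      unfolding set_integrable_def
      by (rule borel_integrable_compact[OF compact_Icc continuous_on_subset[OF c subset_UNIV]])
    from set_borel_integral_eq_integral[OF this] show ?thesis by simp
  qed
  finally have *: "(\<integral>w. indicator A w * f (w t) \<partial>P) - (\<integral>w. indicator A w * f (w s) \<partial>P) =
     integral {s..t} (\<lambda>r. \<integral>w. indicator A w * ?g (w r) \<partial>P)" .
  show ?thesis unfolding *
    by (intro integrable_integral integrable_continuous_real continuous_on_subset[OF c]) auto
qed

end

subsection \<open>Exponential moments\<close>

text \<open>A smooth stand-in for exp (\<theta> |x|): its Laplacian is \<theta>^2 times itself, its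
  gradient is at most \<theta> times itself, and for \<theta> > 0 its sublevel sets are bounded,
  which makes it a convenient cutoff variable.\<close>

definition cosh_sum :: "real \<Rightarrow> real^'n::finite \<Rightarrow> real" where
  "cosh_sum \<theta> x = (\<Sum>i\<in>UNIV. 2 * cosh (\<theta> * x $ i))"

definition cosh_grad :: "real \<Rightarrow> real^'n::finite \<Rightarrow> real^'n" where
  "cosh_grad \<theta> x = (\<chi> i. 2 * \<theta> * sinh (\<theta> * x $ i))"

text \<open>A compactly supported truncation of exp (3 (a . x)), recovered pointwise as
  \<open>N\<close> grows. The exponential sits inside the cube, hence the factor 3. It is used with
  \<open>a = 0\<close> for moments, and with \<open>a\<close> equal to - (lam / 3) times a unit
  vector for the maximal inequality.\<close>

definition exp_cutoff :: "real^'n::finite \<Rightarrow> real \<Rightarrow> real \<Rightarrow> real^'n \<Rightarrow> real" where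
  "exp_cutoff a \<theta> N x = (max 0 (exp (a \<bullet> x) * (1 - cosh_sum \<theta> x / N))) ^ 3"

lemma two_cosh_ge_exp: "exp \<bar>x\<bar> \<le> 2 * cosh (x::real)"
  by (cases "x \<ge> 0") (simp_all add: cosh_def)

lemma cosh_sum_nonneg: "0 \<le> cosh_sum \<theta> x"
  by (simp add: cosh_sum_def sum_nonneg)

lemma cosh_sum_component: "exp \<bar>\<theta> * x $ i\<bar> \<le> cosh_sum \<theta> x"
proof -
  have "2 * cosh (\<theta> * x $ i) \<le> cosh_sum \<theta> x"
    unfolding cosh_sum_def by (rule member_le_sum) auto
  then show ?thesis using two_cosh_ge_exp[of "\<theta> * x $ i"] by linarith
qed

lemma cosh_sum_ge_exp_norm:
  fixes x :: "real^'n::finite"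
  assumes "\<theta> \<ge> 0"
  shows "exp (\<theta> * norm x) \<le> cosh_sum (\<theta> * real CARD('n)) x"
proof -
  have "\<exists>i. norm x \<le> real CARD('n) * \<bar>x $ i\<bar>"
  proof (rule ccontr)
    assume "\<nexists>i. norm x \<le> real CARD('n) * \<bar>x $ i\<bar>"
    then have "\<bar>x $ i\<bar> < norm x / real CARD('n)" for i
      by (simp add: field_simps not_le)
    then have "(\<Sum>i\<in>UNIV. \<bar>x $ i\<bar>) < (\<Sum>i\<in>(UNIV::'n set). norm x / real CARD('n))"
      by (intro sum_strict_mono) auto
    then show False using norm_le_l1_cart[of x] by simp
  qed
  then obtain i where "norm x \<le> real CARD('n) * \<bar>x $ i\<bar>" by blast
  then have "\<theta> * norm x \<le> \<bar>\<theta> * real CARD('n) * x $ i\<bar>"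
    using assms mult_left_mono[of "norm x" "real CARD('n) * \<bar>x $ i\<bar>" \<theta>] by (simp add: abs_mult mult.assoc)
  then have "exp (\<theta> * norm x) \<le> exp \<bar>\<theta> * real CARD('n) * x $ i\<bar>" by simp
  also have "\<dots> \<le> cosh_sum (\<theta> * real CARD('n)) x" by (rule cosh_sum_component)
  finally show ?thesis .
qed

lemma norm_cosh_grad_le:
  assumes "\<theta> \<ge> 0"
  shows "norm (cosh_grad \<theta> x) \<le> \<theta> * cosh_sum \<theta> x"
proof -
  have s: "\<bar>sinh y\<bar> \<le> cosh y" for y :: real
    by (simp add: abs_le_iff sinh_le_cosh_real) (use sinh_le_cosh_real[of "-y"] in simp)
  have "norm (cosh_grad \<theta> x) \<le> (\<Sum>i\<in>UNIV. \<bar>cosh_grad \<theta> x $ i\<bar>)" by (rule norm_le_l1_cart)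
  also have "\<dots> \<le> (\<Sum>i\<in>UNIV. \<theta> * (2 * cosh (\<theta> * x $ i)))"
    using assms s by (intro sum_mono) (auto simp: cosh_grad_def abs_mult mult_left_mono)
  finally show ?thesis by (simp add: cosh_sum_def sum_distrib_left)
qed

text \<open>Cauchy-Schwarz for the sum of the cosh terms, with sinh^2 = cosh^2 - 1. It says that the
  gradient does not degenerate where \<open>cosh_sum\<close> is large, in particular near the edge
  of the cutoff.\<close>

lemma norm_cosh_grad_ge:
  fixes x :: "real^'n::finite"
  shows "(norm (cosh_grad 1 x))\<^sup>2 \<ge> (cosh_sum 1 x)\<^sup>2 / real CARD('n) - 4 * real CARD('n)"
proof -
  have "(cosh_sum 1 x)\<^sup>2 \<le> (\<Sum>i\<in>(UNIV::'n set). (2 * cosh (1 * x $ i))\<^sup>2) * (\<Sum>i\<in>(UNIV::'n set). 1\<^sup>2)"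
    unfolding cosh_sum_def using Cauchy_Schwarz_ineq_sum[of "\<lambda>i. 2 * cosh (1 * x $ i)" "\<lambda>_. 1" UNIV] by simp
  moreover have "(norm (cosh_grad 1 x))\<^sup>2 = (\<Sum>i\<in>(UNIV::'n set). (2 * sinh (x $ i))\<^sup>2)"
    unfolding power2_norm_eq_inner by (simp add: inner_vec_def cosh_grad_def power2_eq_square)
  moreover have "(\<Sum>i\<in>(UNIV::'n set). (2 * sinh (x $ i))\<^sup>2) = (\<Sum>i\<in>(UNIV::'n set). (2 * cosh (1 * x $ i))\<^sup>2) - 4 * real CARD('n)"
    by (simp add: power_mult_distrib cosh_square_eq sum.distrib algebra_simps)
  ultimately have "(norm (cosh_grad 1 x))\<^sup>2 = (\<Sum>i\<in>(UNIV::'n set). (2 * cosh (1 * x $ i))\<^sup>2) - 4 * real CARD('n)"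
    and "(cosh_sum 1 x)\<^sup>2 / real CARD('n) \<le> (\<Sum>i\<in>(UNIV::'n set). (2 * cosh (1 * x $ i))\<^sup>2)"
    by (simp_all add: divide_le_eq)
  then show ?thesis by linarith
qed

lemma C2_data_cosh:
  "C2_data (\<lambda>x::real^'n::finite. 1 - cosh_sum \<theta> x / N) (\<lambda>x. - (1 / N) *\<^sub>R cosh_grad \<theta> x)
     (\<lambda>x. \<chi> i. axis i (- (2 * \<theta>\<^sup>2 * cosh (\<theta> * x $ i) / N)))"
proof -
  have lin: "((\<lambda>x::real^'n. \<theta> * x $ i) has_derivative (\<lambda>h. \<theta> * h $ i)) (at x)" for x i
    by (intro has_derivative_mult_right bounded_linear_imp_has_derivative bounded_linear_vec_nth)
  have dc: "((\<lambda>x::real^'n. cosh (\<theta> * x $ i)) has_derivative (\<lambda>h. \<theta> * h $ i * sinh (\<theta> * x $ i))) (at x)" for x i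
    by (rule DERIV_compose_FDERIV[OF _ lin]) (auto intro!: derivative_eq_intros)
  have ds: "((\<lambda>x::real^'n. sinh (\<theta> * x $ i)) has_derivative (\<lambda>h. \<theta> * h $ i * cosh (\<theta> * x $ i))) (at x)" for x i
    by (rule DERIV_compose_FDERIV[OF _ lin]) (auto intro!: derivative_eq_intros)
  have "((\<lambda>x::real^'n. 1 - cosh_sum \<theta> x / N) has_derivative (\<lambda>h. (- (1 / N) *\<^sub>R cosh_grad \<theta> x) \<bullet> h)) (at x)" for x
  proof -
    have "((\<lambda>x::real^'n. 1 - (\<Sum>i\<in>UNIV. (2 / N) * cosh (\<theta> * x $ i))) has_derivative
        (\<lambda>h. 0 - (\<Sum>i\<in>UNIV. (2 / N) * (\<theta> * h $ i * sinh (\<theta> * x $ i))))) (at x)"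
      by (intro has_derivative_diff has_derivative_const has_derivative_sum has_derivative_mult_right dc)
    moreover have "cosh_sum \<theta> x / N = (\<Sum>i\<in>UNIV. (2 / N) * cosh (\<theta> * x $ i))" for x :: "real^'n"
      by (simp add: cosh_sum_def sum_divide_distrib)
    moreover have "0 - (\<Sum>i\<in>UNIV. (2 / N) * (\<theta> * h $ i * sinh (\<theta> * x $ i))) = (- (1 / N) *\<^sub>R cosh_grad \<theta> x) \<bullet> h" for h
      by (simp add: inner_vec_def cosh_grad_def sum_negf mult_ac)
    ultimately show ?thesis by simp
  qed
  moreover have "((\<lambda>y::real^'n. (- (1 / N) *\<^sub>R cosh_grad \<theta> y) $ i) has_derivative
      (\<lambda>h. axis i (- (2 * \<theta>\<^sup>2 * cosh (\<theta> * x $ i) / N)) \<bullet> h)) (at x)" for x i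
  proof -
    have "((\<lambda>y::real^'n. (- (2 * \<theta> / N)) * sinh (\<theta> * y $ i)) has_derivative
       (\<lambda>h. (- (2 * \<theta> / N)) * (\<theta> * h $ i * cosh (\<theta> * x $ i)))) (at x)"
      by (intro has_derivative_mult_right ds)
    then show ?thesis
      by (simp add: cosh_grad_def inner_axis' power2_eq_square mult_ac)
  qed
  moreover have "continuous_on UNIV (\<lambda>x::real^'n. (\<chi> i. axis i (- (2 * \<theta>\<^sup>2 * cosh (\<theta> * x $ i) / N))) $ i $ j)" for i j
    by (cases "i = j") (auto simp: axis_def divide_inverse intro!: continuous_intros)
  ultimately show ?thesis
    unfolding C2_data_def by (intro conjI allI) (simp_all only: vec_lambda_beta)
qed

lemma C2_data_exp_mult:
  assumes C: "C2_data q D H"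
  shows "C2_data (\<lambda>x. exp (a \<bullet> x) * q x) (\<lambda>x. exp (a \<bullet> x) *\<^sub>R (D x + q x *\<^sub>R a))
     (\<lambda>x. \<chi> i j. exp (a \<bullet> x) * (H x $ i $ j + a $ i * D x $ j + a $ j * D x $ i + a $ i * a $ j * q x))"
proof -
  have 1: "(q has_derivative (\<lambda>h. D x \<bullet> h)) (at x)"
    and 2: "((\<lambda>y. D y $ i) has_derivative (\<lambda>h. H x $ i \<bullet> h)) (at x)"
    and 3: "continuous_on UNIV (\<lambda>x. H x $ i $ j)" for x i j
    using C unfolding C2_data_def by blast+
  have q_cont: "continuous_on UNIV q"
    using 1 by (meson continuous_at_imp_continuous_on has_derivative_continuous)
  have D_cont: "continuous_on UNIV (\<lambda>y. D y $ i)" for i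
    using 2 by (meson continuous_at_imp_continuous_on has_derivative_continuous)
  have e: "((\<lambda>x. exp (a \<bullet> x)) has_derivative (\<lambda>h. exp (a \<bullet> x) * (a \<bullet> h))) (at x)" for x
    by (auto intro!: derivative_eq_intros)
  have "((\<lambda>x. exp (a \<bullet> x) * q x) has_derivative (\<lambda>h. (exp (a \<bullet> x) *\<^sub>R (D x + q x *\<^sub>R a)) \<bullet> h)) (at x)" for x
    by (rule has_derivative_eq_rhs[OF has_derivative_mult[OF e 1]])
       (simp add: inner_add_left algebra_simps fun_eq_iff)
  moreover have "((\<lambda>y. (exp (a \<bullet> y) *\<^sub>R (D y + q y *\<^sub>R a)) $ i) has_derivative
      (\<lambda>h. (\<chi> j. exp (a \<bullet> x) * (H x $ i $ j + a $ i * D x $ j + a $ j * D x $ i + a $ i * a $ j * q x)) \<bullet> h)) (at x)" for x i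
  proof -
    have *: "(\<chi> j. exp (a \<bullet> x) * (H x $ i $ j + a $ i * D x $ j + a $ j * D x $ i + a $ i * a $ j * q x))
       = exp (a \<bullet> x) *\<^sub>R (H x $ i + a $ i *\<^sub>R D x + (D x $ i + a $ i * q x) *\<^sub>R a)"
      by (simp add: vec_eq_iff algebra_simps)
    have "((\<lambda>y. exp (a \<bullet> y) * (D y $ i + q y * a $ i)) has_derivative
       (\<lambda>h. exp (a \<bullet> x) * (H x $ i \<bullet> h + (D x \<bullet> h) * a $ i) + (exp (a \<bullet> x) * (a \<bullet> h)) * (D x $ i + q x * a $ i))) (at x)"
      by (intro has_derivative_mult e has_derivative_add 2 has_derivative_mult_left 1)
    then show ?thesis unfolding *
      by (simp add: inner_add_left algebra_simps)
  qed
  moreover have "continuous_on UNIV (\<lambda>x. (\<chi> i j. exp (a \<bullet> x) * (H x $ i $ j + a $ i * D x $ j + a $ j * D x $ i + a $ i * a $ j * q x)) $ i $ j)" for i j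
    by (simp only: vec_lambda_beta, intro continuous_intros q_cont D_cont 3)
  ultimately show ?thesis
    unfolding C2_data_def by (intro conjI allI) (simp_all only: vec_lambda_beta)
qed

lemma exp_cutoff_eq: "exp_cutoff a \<theta> N x = exp (a \<bullet> x) ^ 3 * (max 0 (1 - cosh_sum \<theta> x / N)) ^ 3"
proof -
  have "max 0 (exp (a \<bullet> x) * (1 - cosh_sum \<theta> x / N)) = exp (a \<bullet> x) * max 0 (1 - cosh_sum \<theta> x / N)"
    by (simp add: max_mult_distrib_left)
  then show ?thesis by (simp add: exp_cutoff_def power_mult_distrib)
qed

lemma exp_cutoff_testfun:
  fixes a :: "real^'n::finite"
  assumes N: "N > 0" and th: "\<theta> > 0"
  shows "testfun (exp_cutoff a \<theta> N)"
    and "gen b (exp_cutoff a \<theta> N) x = exp (a \<bullet> x) ^ 3 *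
      (let p = max 0 (1 - cosh_sum \<theta> x / N); v = cosh_sum \<theta> x / N; D = (1 / N) *\<^sub>R cosh_grad \<theta> x in
        3 * p * (norm D)\<^sup>2 - 9 * p\<^sup>2 * (a \<bullet> D) + (9/2) * p ^ 3 * (norm a)\<^sup>2
        - (3/2) * p\<^sup>2 * \<theta>\<^sup>2 * v - 3 * p\<^sup>2 * (b x \<bullet> D) + 3 * p ^ 3 * (b x \<bullet> a))"
proof -
  note C = C2_data_cube[OF C2_data_exp_mult[OF C2_data_cosh[of \<theta> N], of a]]
  have bd: "bounded {x. exp_cutoff a \<theta> N x \<noteq> 0}"
    unfolding bounded_iff
  proof (intro exI ballI)
    fix x assume "x \<in> {x. exp_cutoff a \<theta> N x \<noteq> 0}"
    then have "max 0 (1 - cosh_sum \<theta> x / N) \<noteq> 0" by (auto simp: exp_cutoff_eq)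
    then have u: "cosh_sum \<theta> x < N" using N by (auto simp: max_def field_simps split: if_splits)
    \<comment> \<open>On the support \<open>cosh_sum\<close> stays below \<open>N\<close>, and it
      dominates an exponential of the norm; 1 + y \<le> exp y makes the radius explicit.\<close>
    have "exp (\<theta> / real CARD('n) * norm x) \<le> cosh_sum (\<theta> / real CARD('n) * real CARD('n)) x"
      using th by (intro cosh_sum_ge_exp_norm) auto
    then have "1 + \<theta> / real CARD('n) * norm x \<le> N"
      using u exp_ge_add_one_self[of "\<theta> / real CARD('n) * norm x"] by (simp del: exp_ge_add_one_self)
    then have "\<theta> / real CARD('n) * norm x \<le> N" by simp
    then show "norm x \<le> N * real CARD('n) / \<theta>" using th by (simp add: field_simps)
  qed
  have eq: "exp_cutoff a \<theta> N = (\<lambda>x. (max 0 (exp (a \<bullet> x) * (1 - cosh_sum \<theta> x / N))) ^ 3)"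
    by (simp add: exp_cutoff_def fun_eq_iff)
  show "testfun (exp_cutoff a \<theta> N)"
    unfolding eq by (rule C2_data_testfun(1)[OF C]) (use bd in \<open>simp add: eq\<close>)
  define q where "q = 1 - cosh_sum \<theta> x / N"
  define p where "p = max 0 q"
  define v where "v = cosh_sum \<theta> x / N"
  define D where "D = (1 / N) *\<^sub>R cosh_grad \<theta> x"
  define e where "e = exp (a \<bullet> x)"
  have e: "e > 0" by (simp add: e_def)
  have me: "max 0 (e * q) = e * p" using e by (simp add: p_def max_mult_distrib_left)
  let ?a = "\<lambda>i. axis i (- (2 * \<theta>\<^sup>2 * cosh (\<theta> * x $ i) / N)) $ i"
  have tr: "(\<Sum>i\<in>(UNIV::'n set). ?a i) = - \<theta>\<^sup>2 * v"
    by (simp add: v_def cosh_sum_def sum_divide_distrib sum_distrib_left sum_negf[symmetric] mult_ac axis_def)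
  have "gen b (exp_cutoff a \<theta> N) x = (1/2) * (\<Sum>i\<in>UNIV. 6 * (e * p) * (e * (- D $ i + q * a $ i)) * (e * (- D $ i + q * a $ i))
     + 3 * (e * p)\<^sup>2 * (e * (?a i - a $ i * D $ i - a $ i * D $ i + a $ i * a $ i * q)))
     + b x \<bullet> ((3 * (e * p)\<^sup>2) *\<^sub>R (e *\<^sub>R (- D + q *\<^sub>R a)))"
    unfolding eq C2_data_testfun(2)[OF C bd[unfolded eq]]
    by (simp add: q_def[symmetric] e_def[symmetric] me D_def[symmetric])
  also have "(\<Sum>i\<in>UNIV. 6 * (e * p) * (e * (- D $ i + q * a $ i)) * (e * (- D $ i + q * a $ i))
     + 3 * (e * p)\<^sup>2 * (e * (?a i - a $ i * D $ i - a $ i * D $ i + a $ i * a $ i * q)))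
     = 6 * e ^ 3 * p * ((- D + q *\<^sub>R a) \<bullet> (- D + q *\<^sub>R a)) + 3 * e ^ 3 * p\<^sup>2 *
        ((\<Sum>i\<in>(UNIV::'n set). ?a i) - 2 * (a \<bullet> D) + q * (a \<bullet> a))"
    by (simp add: inner_vec_def sum.distrib sum_subtractf sum_distrib_left sum_negf power2_eq_square power3_eq_cube algebra_simps)
  also have "(- D + q *\<^sub>R a) \<bullet> (- D + q *\<^sub>R a) = (norm D)\<^sup>2 - 2 * q * (a \<bullet> D) + q * q * (norm a)\<^sup>2"
    by (simp add: inner_diff_left inner_diff_right power2_norm_eq_inner inner_commute algebra_simps)
  also note tr
  finally have g: "gen b (exp_cutoff a \<theta> N) x = e ^ 3 * (3 * p * ((norm D)\<^sup>2 - 2 * q * (a \<bullet> D) + q * q * (norm a)\<^sup>2)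
      + (3/2) * p\<^sup>2 * (- \<theta>\<^sup>2 * v - 2 * (a \<bullet> D) + q * (norm a)\<^sup>2) + 3 * p\<^sup>2 * (q * (b x \<bullet> a) - b x \<bullet> D))"
    by (simp add: inner_diff_right dot_square_norm power2_eq_square power3_eq_cube algebra_simps)
  \<comment> \<open>Every term carries a factor \<open>p\<close>, so the signed \<open>q\<close> may
    be replaced by its positive part.\<close>
  have "q = p \<or> p = 0" by (auto simp: p_def max_def)
  then have "gen b (exp_cutoff a \<theta> N) x = e ^ 3 *
     (3 * p * (norm D)\<^sup>2 - 9 * p\<^sup>2 * (a \<bullet> D) + (9/2) * p ^ 3 * (norm a)\<^sup>2
        - (3/2) * p\<^sup>2 * \<theta>\<^sup>2 * v - 3 * p\<^sup>2 * (b x \<bullet> D) + 3 * p ^ 3 * (b x \<bullet> a))" (is ?goal)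
  proof
    assume q: "q = p"
    show ?goal
      unfolding g q by (simp add: power2_eq_square power3_eq_cube algebra_simps)
  qed (simp add: g)
  then show "gen b (exp_cutoff a \<theta> N) x = exp (a \<bullet> x) ^ 3 *
      (let p = max 0 (1 - cosh_sum \<theta> x / N); v = cosh_sum \<theta> x / N; D = (1 / N) *\<^sub>R cosh_grad \<theta> x in
        3 * p * (norm D)\<^sup>2 - 9 * p\<^sup>2 * (a \<bullet> D) + (9/2) * p ^ 3 * (norm a)\<^sup>2
        - (3/2) * p\<^sup>2 * \<theta>\<^sup>2 * v - 3 * p\<^sup>2 * (b x \<bullet> D) + 3 * p ^ 3 * (b x \<bullet> a))"
    unfolding Let_def p_def q_def v_def D_def e_def .
qed

text \<open>The gradient-squared term has the favourable sign and is dropped. The rest is governed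
  by 3 p^2 v, and with v = 1 - p one has 3 p^2 v \<le> v (1 + p + p^2) = 1 - p^3. So truncation does
  not worsen the growth rate \<theta>^2 / 2 + B \<theta> of \<open>cosh_sum\<close> itself.\<close>

lemma exp_cutoff_gen_moment:
  fixes b :: "real^'n::finite \<Rightarrow> real^'n"
  assumes N: "N > 0" and th: "\<theta> > 0" and B: "norm (b x) \<le> B"
  shows "- gen b (exp_cutoff 0 \<theta> N) x \<le> (\<theta>\<^sup>2 / 2 + B * \<theta>) * (1 - exp_cutoff 0 \<theta> N x)"
proof -
  define p where "p = max 0 (1 - cosh_sum \<theta> x / N)"
  define v where "v = cosh_sum \<theta> x / N"
  define D where "D = (1 / N) *\<^sub>R cosh_grad \<theta> x"
  have v: "0 \<le> v" using N by (simp add: v_def cosh_sum_nonneg)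
  have p: "0 \<le> p" "p \<le> 1" "p = 0 \<or> v = 1 - p" using v by (auto simp: p_def v_def max_def)
  have B0: "0 \<le> B" using B norm_ge_zero order_trans by blast
  have "norm D \<le> \<theta> * v"
    using norm_cosh_grad_le[of \<theta> x] N th by (simp add: D_def v_def field_simps)
  then have "\<bar>b x \<bullet> D\<bar> \<le> B * (\<theta> * v)"
    using Cauchy_Schwarz_ineq2[of "b x" D] B mult_mono[of "norm (b x)" B "norm D" "\<theta> * v"] B0 by simp
  then have bD: "b x \<bullet> D \<le> B * \<theta> * v" by simp
  have g: "gen b (exp_cutoff 0 \<theta> N) x = 3 * p * (norm D)\<^sup>2 - (3/2) * p\<^sup>2 * \<theta>\<^sup>2 * v - 3 * p\<^sup>2 * (b x \<bullet> D)"
    unfolding exp_cutoff_testfun(2)[OF N th] Let_def p_def v_def D_def by simp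
  have "3 * p * (norm D)\<^sup>2 \<ge> 0" using p by simp
  moreover have "3 * p\<^sup>2 * (b x \<bullet> D) \<le> 3 * p\<^sup>2 * (B * \<theta> * v)" using bD by (intro mult_left_mono) auto
  ultimately have "- gen b (exp_cutoff 0 \<theta> N) x \<le> (\<theta>\<^sup>2 / 2 + B * \<theta>) * (3 * p\<^sup>2 * v)"
    unfolding g by (simp add: algebra_simps)
  also have "3 * p\<^sup>2 * v \<le> 1 - p ^ 3"
  proof (cases "p = 0")
    case False
    then have vp: "v = 1 - p" using p by simp
    have "p\<^sup>2 \<le> 1" "p\<^sup>2 \<le> p" using p by (auto simp: power2_eq_square mult_le_one mult_left_le)
    then have "v * (3 * p\<^sup>2) \<le> v * (1 + p + p\<^sup>2)" using v by (intro mult_left_mono) auto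
    also have "\<dots> = 1 - p ^ 3" by (simp add: vp power2_eq_square power3_eq_cube algebra_simps)
    finally show ?thesis by (simp add: mult_ac)
  qed simp
  also have "p ^ 3 = exp_cutoff 0 \<theta> N x" by (simp add: exp_cutoff_eq p_def)
  finally show ?thesis using th B0 by (simp add: mult_left_mono)
qed

text \<open>Terms of order p^2 v are the difficulty, since near the edge they are not controlled by
  p^3; \<open>c\<close> collects their coefficients. The term 3 p |D|^2, of first order in p,
  compensates them. Nothing depends on \<open>N\<close> once it is at least 6 times the
  dimension.\<close>

lemma exp_cutoff_gen_submartingale:
  fixes b :: "real^'n::finite \<Rightarrow> real^'n"
  assumes B: "norm (b x) \<le> B" and N: "N \<ge> 6 * real CARD('n)" and a: "norm a \<le> \<alpha>"
  defines "c \<equiv> 9 * \<alpha> + 3/2 + 3 * B"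
  shows "- gen b (exp_cutoff a 1 N) x \<le> (c + c\<^sup>2 * real CARD('n) + 3 * B * \<alpha>) * exp_cutoff a 1 N x"
proof -
  define n where "n = real CARD('n)"
  have n: "n > 0" by (simp add: n_def)
  have N0: "N > 0" using N n by (simp add: n_def[symmetric])
  define p where "p = max 0 (1 - cosh_sum 1 x / N)"
  define v where "v = cosh_sum 1 x / N"
  define D where "D = (1 / N) *\<^sub>R cosh_grad 1 x"
  have v: "0 \<le> v" using N0 by (simp add: v_def cosh_sum_nonneg)
  have p: "0 \<le> p" "p \<le> 1" "p = 0 \<or> v = 1 - p" using v by (auto simp: p_def v_def max_def)
  have B0: "0 \<le> B" and a0: "0 \<le> \<alpha>" using B a norm_ge_zero order_trans by blast+
  have c0: "0 \<le> c" using B0 a0 by (simp add: c_def)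
  have Dv: "norm D \<le> v"
    using norm_cosh_grad_le[of 1 x] N0 by (simp add: D_def v_def field_simps)
  have CS: "\<bar>y \<bullet> D\<bar> \<le> C * v" if "norm y \<le> C" for y :: "real^'n" and C
    using Cauchy_Schwarz_ineq2[of y D] Dv that mult_mono[of "norm y" C "norm D" v]
    by (smt (verit) norm_ge_zero)
  have aD: "a \<bullet> D \<le> \<alpha> * v" and bD: "b x \<bullet> D \<le> B * v" using CS[OF a] CS[OF B] by auto
  have "\<bar>b x \<bullet> a\<bar> \<le> B * \<alpha>"
    using Cauchy_Schwarz_ineq2[of "b x" a] mult_mono[OF B a B0 norm_ge_zero] by simp
  then have ba: "- (b x \<bullet> a) \<le> B * \<alpha>" by simp
  \<comment> \<open>For v > 1/2 the main term v^2 / n exceeds 1 / (4 n); the lower bound on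
    \<open>N\<close> keeps the correction 4 n / N^2 below half of that, which requires only 32 n^2
    \<le> N^2.\<close>
  have Dlow: "(norm D)\<^sup>2 \<ge> 1 / (8 * n)" if "v > 1/2"
  proof -
    have "(norm D)\<^sup>2 = (norm (cosh_grad 1 x))\<^sup>2 / N\<^sup>2"
      using N0 by (simp add: D_def power_divide)
    moreover have "((cosh_sum 1 x)\<^sup>2 / n - 4 * n) / N\<^sup>2 = v\<^sup>2 / n - 4 * n / N\<^sup>2"
      using N0 by (simp add: v_def power_divide diff_divide_distrib)
    ultimately have "(norm D)\<^sup>2 \<ge> v\<^sup>2 / n - 4 * n / N\<^sup>2"
      using divide_right_mono[OF norm_cosh_grad_ge[of x], of "N\<^sup>2"] by (simp add: n_def)
    moreover have "1 / 4 \<le> v\<^sup>2" using power_mono[of "1/2" v 2] that by (simp add: power2_eq_square)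
    then have "1 / (4 * n) \<le> v\<^sup>2 / n" using n by (simp add: field_simps)
    moreover have "(6 * n)\<^sup>2 \<le> N\<^sup>2" using N n by (intro power_mono) (auto simp: n_def)
    then have "36 * n\<^sup>2 \<le> N\<^sup>2" by (simp add: power_mult_distrib)
    then have "32 * n\<^sup>2 \<le> N\<^sup>2" using zero_le_power2[of n] by linarith
    then have "4 * n / N\<^sup>2 \<le> 1 / (8 * n)" using n N0 by (simp add: field_simps power2_eq_square)
    moreover have "1 / (4 * n) = 1 / (8 * n) + 1 / (8 * n)" using n by (simp add: field_simps)
    ultimately show ?thesis by linarith
  qed
  define e where "e = exp (a \<bullet> x) ^ 3"
  have e: "e > 0" by (simp add: e_def)
  let ?g = "3 * p * (norm D)\<^sup>2 - 9 * p\<^sup>2 * (a \<bullet> D) + (9/2) * p ^ 3 * (norm a)\<^sup>2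
        - (3/2) * p\<^sup>2 * v - 3 * p\<^sup>2 * (b x \<bullet> D) + 3 * p ^ 3 * (b x \<bullet> a)"
  have g: "gen b (exp_cutoff a 1 N) x = e * (?g)"
    unfolding exp_cutoff_testfun(2)[OF N0 zero_less_one] Let_def p_def v_def D_def e_def by simp
  have i1: "9 * p\<^sup>2 * (a \<bullet> D) \<le> 9 * p\<^sup>2 * (\<alpha> * v)" using aD by (intro mult_left_mono) auto
  have i2: "3 * p\<^sup>2 * (b x \<bullet> D) \<le> 3 * p\<^sup>2 * (B * v)" using bD by (intro mult_left_mono) auto
  have i3: "3 * p ^ 3 * (- (b x \<bullet> a)) \<le> 3 * p ^ 3 * (B * \<alpha>)" using ba p by (intro mult_left_mono) auto
  have i4: "(9/2) * p ^ 3 * (norm a)\<^sup>2 \<ge> 0" using p by simp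
  \<comment> \<open>Two regimes. For v \<le> 1/2 one has v \<le> p (or p = 0), so p^2 v is already
    at most p^3. For v > 1/2 the gradient is bounded below and the first-order term takes
    over.\<close>
  have i5: "p\<^sup>2 * v * c - 3 * p * (norm D)\<^sup>2 \<le> (c + c\<^sup>2 * n) * p ^ 3"
  proof (cases "v > 1/2")
    case False
    consider "p = 0" | "v = 1 - p" using p by blast
    then have "p\<^sup>2 * v * c \<le> p\<^sup>2 * p * c"
    proof cases
      case 2
      then show ?thesis using False c0 p by (intro mult_right_mono mult_left_mono) auto
    qed simp
    moreover have "3 * p * (norm D)\<^sup>2 \<ge> 0" "c\<^sup>2 * n * p ^ 3 \<ge> 0" using p n by auto
    ultimately show ?thesis by (simp add: power2_eq_square power3_eq_cube algebra_simps)
  next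
    case True
    have "v \<le> 1 \<or> p = 0" using p by auto
    then have "p\<^sup>2 * v * c \<le> p\<^sup>2 * 1 * c"
    proof
      assume "v \<le> 1"
      then show ?thesis using c0 by (intro mult_right_mono mult_left_mono) auto
    qed simp
    moreover have "3 * p * (norm D)\<^sup>2 \<ge> 3 * p * (1 / (8 * n))" using Dlow[OF True] p by (intro mult_left_mono) auto
    moreover have "p\<^sup>2 * c \<le> 3 * p * (1 / (8 * n)) + c\<^sup>2 * n * p ^ 3"
    proof -
      \<comment> \<open>The square splits c p^2 into c^2 n p^3, which is admissible, and p / (4 n),
        which the gradient term covers.\<close>
      have "0 \<le> p * (c * n * p - 1 / 2)\<^sup>2 / n" using p n by simp
      also have "p * (c * n * p - 1 / 2)\<^sup>2 / n = c\<^sup>2 * n * p ^ 3 - p\<^sup>2 * c + p / (4 * n)"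
        using n by (simp add: power2_eq_square power3_eq_cube field_simps)
      finally have "p\<^sup>2 * c \<le> p / (4 * n) + c\<^sup>2 * n * p ^ 3" by simp
      moreover have "p / (4 * n) \<le> 3 * p * (1 / (8 * n))" using p n by (simp add: field_simps)
      ultimately show ?thesis by linarith
    qed
    moreover have "c * p ^ 3 \<ge> 0" using c0 p by simp
    ultimately show ?thesis by (simp add: algebra_simps)
  qed
  have "- gen b (exp_cutoff a 1 N) x = e * (- (?g))"
    unfolding g by (simp only: mult_minus_right)
  also have "\<dots> \<le> e * ((c + c\<^sup>2 * n + 3 * B * \<alpha>) * p ^ 3)"
  proof (rule mult_left_mono)
    have "p\<^sup>2 * v * c = 9 * p\<^sup>2 * (\<alpha> * v) + (3/2) * p\<^sup>2 * v + 3 * p\<^sup>2 * (B * v)"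
      by (simp add: c_def algebra_simps)
    moreover have "(c + c\<^sup>2 * n + 3 * B * \<alpha>) * p ^ 3 = (c + c\<^sup>2 * n) * p ^ 3 + 3 * p ^ 3 * (B * \<alpha>)"
      by (simp add: algebra_simps)
    ultimately show "- (?g) \<le> (c + c\<^sup>2 * n + 3 * B * \<alpha>) * p ^ 3"
      using i1 i2 i3 i4 i5 by linarith
  qed (use e in simp)
  also have "\<dots> = (c + c\<^sup>2 * n + 3 * B * \<alpha>) * exp_cutoff a 1 N x"
    by (simp add: exp_cutoff_eq p_def e_def)
  finally show ?thesis by (simp add: n_def)
qed

section \<open>Dynkin's formula as a differential inequality, and exponential moments of the
  process\<close>

context diffusion_law
begin

lemma B_nonneg: "0 \<le> B"
  using b_bounded norm_ge_zero order_trans by blast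

lemma filt_sets_P: "A \<in> sets (filt s) \<Longrightarrow> A \<in> sets P"
  using sets_filt_subset sets_P by blast

lemma testfun_integrable:
  assumes f: "testfun f" and A[measurable]: "A \<in> sets P"
  shows "integrable P (\<lambda>w. indicator A w * f (w r))" and "integrable P (\<lambda>w. indicator A w * gen b f (w r))"
proof -
  have *: "integrable P (\<lambda>w. indicator A w * g (w r))"
    if c: "continuous_on UNIV g" and bd: "\<exists>C. \<forall>x. \<bar>g x\<bar> \<le> C" for g :: "real^'n \<Rightarrow> real"
  proof -
    obtain C where C: "\<And>x. \<bar>g x\<bar> \<le> C" using bd by blast
    have [measurable]: "g \<in> borel_measurable borel" using c by (rule borel_measurable_continuous_onI)
    show ?thesis
      by (rule integrable_const_bound[where B=C])
         (use C abs_ge_zero[THEN order_trans, OF C] in \<open>auto simp: indicator_def\<close>)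
  qed
  show "integrable P (\<lambda>w. indicator A w * f (w r))" "integrable P (\<lambda>w. indicator A w * gen b f (w r))"
    using testfun_gen_continuous_bounded[OF f b_continuous] by (auto intro!: *)
qed

lemma dynkin_deriv:
  assumes f: "testfun f" and s: "0 \<le> s" and A: "A \<in> sets (filt s)" and t: "t \<in> {s..T}"
  shows "((\<lambda>t. \<integral>w. indicator A w * f (w t) \<partial>P) has_real_derivative
     (\<integral>w. indicator A w * gen b f (w t) \<partial>P)) (at t within {s..T})"
proof -
  obtain C where C: "\<And>x. \<bar>gen b f x\<bar> \<le> C" using testfun_gen_continuous_bounded(2)[OF f b_continuous] by blast
  let ?y = "\<lambda>t. \<integral>w. indicator A w * f (w t) \<partial>P" and ?y' = "\<lambda>t. \<integral>w. indicator A w * gen b f (w t) \<partial>P"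
  have c: "continuous_on {s..T} ?y'"
    using expectation_continuous_time[OF testfun_gen_continuous_bounded(1)[OF f b_continuous] C filt_sets_P[OF A]]
    by (rule continuous_on_subset) simp
  have "((\<lambda>r. ?y s + integral {s..r} ?y') has_real_derivative ?y' t) (at t within {s..T})"
    using integral_has_real_derivative[OF c t] by (auto intro!: derivative_eq_intros)
  moreover have "?y s + integral {s..r} ?y' = ?y r" if "r \<in> {s..T}" for r
    using integral_unique[OF dynkin[OF f s _ A, of r]] that by simp
  ultimately show ?thesis
    by (rule has_field_derivative_transform_within[OF _ zero_less_one t])
qed

text \<open>Gronwall for the expectation of \<alpha> - f on an event of the past. With \<alpha> = 1
  it controls the mass lost by a cutoff; with \<alpha> = 0 and a negative constant it bounds the
  expectation of f from below at the later time.\<close>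

lemma dynkin_compare:
  assumes f: "testfun f" and st: "0 \<le> s" "s \<le> t" and A: "A \<in> sets (filt s)"
    and le: "\<And>x. - gen b f x \<le> C * (\<alpha> - f x)"
  shows "(\<integral>w. indicator A w * (\<alpha> - f (w t)) \<partial>P) \<le> exp (C * (t - s)) * (\<integral>w. indicator A w * (\<alpha> - f (w s)) \<partial>P)"
proof -
  have AP: "A \<in> sets P" using A by (rule filt_sets_P)
  have ia: "integrable P (\<lambda>w. indicator A w * \<alpha>)"
    using integrable_mult_indicator[OF AP, of "\<lambda>_. \<alpha>"] by simp
  have eq: "(\<integral>w. indicator A w * (\<alpha> - f (w r)) \<partial>P) = (\<integral>w. indicator A w * \<alpha> \<partial>P) - (\<integral>w. indicator A w * f (w r) \<partial>P)" for r
    unfolding right_diff_distrib by (rule Bochner_Integration.integral_diff[OF ia testfun_integrable(1)[OF f AP]])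
  show ?thesis
  proof (rule gronwall_within[OF st(2)])
    fix r assume r: "r \<in> {s..t}"
    show "((\<lambda>r. \<integral>w. indicator A w * (\<alpha> - f (w r)) \<partial>P) has_real_derivative
       - (\<integral>w. indicator A w * gen b f (w r) \<partial>P)) (at r within {s..t})"
      unfolding eq using dynkin_deriv[OF f st(1) A r] by (auto intro!: derivative_eq_intros)
    have "- (\<integral>w. indicator A w * gen b f (w r) \<partial>P) = (\<integral>w. - (indicator A w * gen b f (w r)) \<partial>P)" by simp
    also have "\<dots> \<le> (\<integral>w. C * (indicator A w * (\<alpha> - f (w r))) \<partial>P)"
    proof (rule integral_mono)
      show "integrable P (\<lambda>w. - (indicator A w * gen b f (w r)))" using testfun_integrable(2)[OF f AP] by simp
      show "integrable P (\<lambda>w. C * (indicator A w * (\<alpha> - f (w r))))"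
        unfolding right_diff_distrib using ia testfun_integrable(1)[OF f AP]
        by (intro Bochner_Integration.integrable_diff integrable_mult_right) auto
      show "- (indicator A w * gen b f (w r)) \<le> C * (indicator A w * (\<alpha> - f (w r)))" for w
        using le[of "w r"] by (auto simp: indicator_def)
    qed
    finally show "- (\<integral>w. indicator A w * gen b f (w r) \<partial>P) \<le> C * (\<integral>w. indicator A w * (\<alpha> - f (w r)) \<partial>P)" by simp
  qed
qed

lemma cosh_sum_measurable [measurable]: "cosh_sum \<theta> \<in> borel_measurable (borel :: (real^'n) measure)"
  unfolding cosh_sum_def by (intro borel_measurable_continuous_onI continuous_intros)

text \<open>For the cutoff \<open>h\<close> at level N, the quantity N (1 - h) dominates
  \<open>cosh_sum\<close> where that is at most N, and is everywhere at most 3 times it. It obeys a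
  Gronwall bound uniform in N, and Fatou removes the truncation.\<close>

lemma cosh_moment:
  assumes th: "\<theta> > 0" and t: "t \<ge> 0"
  shows "(\<integral>\<^sup>+w. ennreal (cosh_sum \<theta> (w t)) \<partial>P) \<le> ennreal (6 * real CARD('n) * exp ((\<theta>\<^sup>2 / 2 + B * \<theta>) * t))"
proof -
  define M where "M = 6 * real CARD('n) * exp ((\<theta>\<^sup>2 / 2 + B * \<theta>) * t)"
  let ?u = "cosh_sum \<theta>"
  let ?e = "exp ((\<theta>\<^sup>2 / 2 + B * \<theta>) * t)"
  let ?c = "\<lambda>N w. ennreal (cosh_sum \<theta> (w t)) * indicator {w. cosh_sum \<theta> (w t) \<le> real N} w"
  have N: "(\<integral>\<^sup>+w. ?c N w \<partial>P) \<le> ennreal M" if "N > 0" for N :: nat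
  proof -
    define h where "h = exp_cutoff (0::real^'n) \<theta> (real N)"
    have N0: "real N > 0" using that by simp
    have h: "testfun h" unfolding h_def using N0 th by (rule exp_cutoff_testfun)
    have A: "space P \<in> sets (filt 0)" unfolding space_P using sets.top[of "filt 0"] by simp
    have cmp: "(\<integral>w. indicator (space P) w * (1 - h (w t)) \<partial>P) \<le> exp ((\<theta>\<^sup>2 / 2 + B * \<theta>) * (t - 0)) * (\<integral>w. indicator (space P) w * (1 - h (w 0)) \<partial>P)"
      by (rule dynkin_compare[OF h order_refl t A]) (use exp_cutoff_gen_moment[of "real N" \<theta> b _ B, OF N0 th b_bounded] in \<open>simp add: h_def\<close>)
    define p where "p x = max 0 (1 - ?u x / N)" for x :: "real^'n"
    have hp: "h x = p x ^ 3" for x by (simp add: h_def p_def exp_cutoff_eq)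
    have p01: "0 \<le> p x" "p x \<le> 1" for x using cosh_sum_nonneg[of \<theta> x] N0 by (auto simp: p_def)
    have h1: "h x \<le> 1" for x unfolding hp using p01 by (simp add: power_le_one)
    have fac: "N * (1 - h x) = ?u x * (1 + p x + (p x)\<^sup>2)" if "?u x \<le> N" for x
    proof -
      have "p x = 1 - ?u x / N" using that N0 by (simp add: p_def field_simps)
      then have "?u x = N * (1 - p x)" using N0 by simp
      then have "?u x * (1 + p x + (p x)\<^sup>2) = N * (1 - p x) * (1 + p x + (p x)\<^sup>2)" by simp
      also have "\<dots> = N * (1 - p x ^ 3)" by (simp add: power2_eq_square power3_eq_cube algebra_simps)
      finally show ?thesis unfolding hp by simp
    qed
    have lowb: "?u x \<le> N * (1 - h x)" if "?u x \<le> N" for x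
      unfolding fac[OF that] using cosh_sum_nonneg[of \<theta> x] p01[of x] by (simp add: mult_left_le_one_le[of "?u x"] algebra_simps)
    have upb: "N * (1 - h x) \<le> 3 * ?u x" for x
    proof (cases "?u x \<le> N")
      case True
      have "1 + p x + (p x)\<^sup>2 \<le> 3" using p01[of x] power_le_one[of "p x" 2] by simp
      from mult_left_mono[OF this cosh_sum_nonneg[of \<theta> x]] show ?thesis unfolding fac[OF True] by simp
    next
      case False
      have "0 \<le> h x" using p01 by (simp add: hp)
      then have "N * (1 - h x) \<le> N" using N0 by (simp add: mult_le_cancel_left1)
      then show ?thesis using False cosh_sum_nonneg[of \<theta> x] by linarith
    qed
    have int: "integrable P (\<lambda>w. indicator (space P) w * (1 - h (w r)))" for r
      unfolding right_diff_distrib using testfun_integrable(1)[OF h sets.top]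
      by (intro Bochner_Integration.integrable_diff) (auto intro!: integrable_real_indicator simp: emeasure_space_1)
    have start: "(\<integral>w. indicator (space P) w * (1 - h (w 0)) \<partial>P) = 1 - h 0"
    proof -
      have "(\<integral>w. indicator (space P) w * (1 - h (w 0)) \<partial>P) = (\<integral>w. 1 - h 0 \<partial>P)"
      proof (rule integral_cong_AE)
        show "AE w in P. indicator (space P) w * (1 - h (w 0)) = 1 - h 0"
          using start_P AE_space by eventually_elim simp
      qed (use int[of 0] in auto)
      then show ?thesis by (simp add: prob_space)
    qed
    have "(\<integral>\<^sup>+w. ?c N w \<partial>P)
       \<le> (\<integral>\<^sup>+w. ennreal (N * (indicator (space P) w * (1 - h (w t)))) \<partial>P)"
      by (rule nn_integral_mono) (use lowb h1 in \<open>auto simp: indicator_def intro!: ennreal_leI\<close>)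
    also have "\<dots> = ennreal (\<integral>w. N * (indicator (space P) w * (1 - h (w t))) \<partial>P)"
      using int h1 by (intro nn_integral_eq_integral) (auto simp: indicator_def)
    also have "\<dots> \<le> ennreal M"
    proof (rule ennreal_leI)
      have "(\<integral>w. N * (indicator (space P) w * (1 - h (w t))) \<partial>P) = N * (\<integral>w. (indicator (space P) w * (1 - h (w t))) \<partial>P)" by simp
      also have "\<dots> \<le> N * (?e * (1 - h 0))"
        using cmp N0 unfolding start by simp
      also have "\<dots> = ?e * (N * (1 - h 0))" by simp
      \<comment> \<open>At the starting point \<open>cosh_sum\<close> is twice the dimension, hence
        the 6 in the constant.\<close>
      also have "\<dots> \<le> ?e * (3 * ?u (0::real^'n))"
        using upb by (intro mult_left_mono) auto
      also have "\<dots> = M" by (simp add: M_def cosh_sum_def)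
      finally show "(\<integral>w. N * (indicator (space P) w * (1 - h (w t))) \<partial>P) \<le> M" .
    qed
    finally show ?thesis .
  qed
  have "(\<integral>\<^sup>+w. ennreal (?u (w t)) \<partial>P) = (\<integral>\<^sup>+w. liminf (\<lambda>N. ?c N w) \<partial>P)"
  proof (rule nn_integral_cong)
    fix w
    have "(\<lambda>N. ?c N w) \<longlonglongrightarrow> ennreal (?u (w t))"
    proof (rule tendsto_eventually)
      obtain N0 where "?u (w t) \<le> real N0" using real_arch_simple by blast
      then show "\<forall>\<^sub>F N in sequentially. ?c N w = ennreal (?u (w t))"
        by (intro eventually_sequentiallyI[of N0]) (auto simp: indicator_def)
    qed
    from lim_imp_Liminf[OF _ this] show "ennreal (?u (w t)) = liminf (\<lambda>N. ?c N w)"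
      by simp
  qed
  also have "\<dots> \<le> liminf (\<lambda>N. \<integral>\<^sup>+w. ?c N w \<partial>P)"
    by (rule nn_integral_liminf) measurable
  also have "\<dots> \<le> limsup (\<lambda>N. \<integral>\<^sup>+w. ?c N w \<partial>P)"
    by (rule Liminf_le_Limsup) simp
  also have "\<dots> \<le> ennreal M"
    by (rule Limsup_bounded) (auto intro!: eventually_sequentiallyI[of 1] N)
  finally show ?thesis by (simp add: M_def)
qed

lemma exp_moment:
  assumes th: "\<theta> > 0"
  shows "\<exists>M\<ge>0. \<forall>t\<in>{0..T}. (\<integral>\<^sup>+w. ennreal (exp (\<theta> * norm (w t))) \<partial>P) \<le> ennreal M"
proof (intro exI conjI ballI)
  let ?\<theta> = "\<theta> * real CARD('n)"
  let ?M = "6 * real CARD('n) * exp ((?\<theta>\<^sup>2 / 2 + B * ?\<theta>) * T)"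
  show "0 \<le> ?M" by simp
  fix t assume t: "t \<in> {0..T}"
  have "(\<integral>\<^sup>+w. ennreal (exp (\<theta> * norm (w t))) \<partial>P) \<le> (\<integral>\<^sup>+w. ennreal (cosh_sum ?\<theta> (w t)) \<partial>P)"
    using th by (intro nn_integral_mono ennreal_leI cosh_sum_ge_exp_norm) auto
  also have "\<dots> \<le> ennreal (6 * real CARD('n) * exp ((?\<theta>\<^sup>2 / 2 + B * ?\<theta>) * t))"
    using t th by (intro cosh_moment) auto
  also have "\<dots> \<le> ennreal ?M"
    using t th B_nonneg by (intro ennreal_leI) (auto intro!: mult_left_mono add_nonneg_nonneg)
  finally show "(\<integral>\<^sup>+w. ennreal (exp (\<theta> * norm (w t))) \<partial>P) \<le> ennreal ?M" .
qed

end

subsection \<open>Integration over Euclidean space\<close>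

lemma lborel_translate:
  fixes f :: "'a::euclidean_space \<Rightarrow> real"
  assumes "integrable lborel f"
  shows "integrable lborel (\<lambda>x. f (x + c))" and "(\<integral>x. f (x + c) \<partial>lborel) = (\<integral>x. f x \<partial>lborel)"
proof -
  have [measurable]: "f \<in> borel_measurable borel" using assms by auto
  have "integrable (distr lborel borel ((+) c)) f" using assms by (simp add: lborel_distr_plus)
  then show "integrable lborel (\<lambda>x. f (x + c))" by (subst (asm) integrable_distr_eq) (auto simp: add.commute)
  have "(\<integral>x. f x \<partial>lborel) = (\<integral>x. f x \<partial>distr lborel borel ((+) c))" by (simp add: lborel_distr_plus)
  also have "\<dots> = (\<integral>x. f (c + x) \<partial>lborel)" by (rule integral_distr) auto
  finally show "(\<integral>x. f (x + c) \<partial>lborel) = (\<integral>x. f x \<partial>lborel)" by (simp add: add.commute)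
qed

lemma nn_integral_lborel_translate:
  fixes f :: "'a::euclidean_space \<Rightarrow> ennreal"
  assumes [measurable]: "f \<in> borel_measurable borel"
  shows "(\<integral>\<^sup>+x. f (x + c) \<partial>lborel) = (\<integral>\<^sup>+x. f x \<partial>lborel)"
proof -
  have "(\<integral>\<^sup>+x. f x \<partial>lborel) = (\<integral>\<^sup>+x. f x \<partial>distr lborel borel ((+) c))" by (simp add: lborel_distr_plus)
  also have "\<dots> = (\<integral>\<^sup>+x. f (c + x) \<partial>lborel)" by (rule nn_integral_distr) auto
  finally show ?thesis by (simp add: add.commute)
qed

text \<open>Translation invariance makes F (x + e) - F x integrate to 0. This increment is the
  integral of G along a unit segment, and by Fubini and translation invariance its total integral is
  that of G. It serves as the divergence theorem on the whole space, one coordinate at a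
  time.\<close>

lemma integral_directional_derivative_eq_0:
  fixes F G :: "'a::euclidean_space \<Rightarrow> real"
  assumes F: "integrable lborel F" and G: "integrable lborel G" and Gc: "continuous_on UNIV G"
    and d: "\<And>x. ((\<lambda>s. F (x + s *\<^sub>R e)) has_real_derivative G x) (at 0)"
  shows "(\<integral>x. G x \<partial>lborel) = 0"
proof -
  have [measurable]: "G \<in> borel_measurable borel" using G by auto
  have dd: "((\<lambda>s. F (x + s *\<^sub>R e)) has_real_derivative G (x + s *\<^sub>R e)) (at s)" for x s
    using d[of "x + s *\<^sub>R e"] DERIV_at_within_shift[of "\<lambda>s. F (x + s *\<^sub>R e)" _ s 0 UNIV]
    by (simp add: algebra_simps)
  have ftc: "(\<integral>s. G (x + s *\<^sub>R e) * indicator {0..1} s \<partial>lborel) = F (x + e) - F x" for x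
  proof -
    have "isCont (\<lambda>s. G (x + s *\<^sub>R e)) s" for s
      using continuous_on_compose2[OF Gc, of UNIV "\<lambda>s. x + s *\<^sub>R e"]
      by (auto intro!: continuous_intros simp: continuous_on_eq_continuous_at)
    from integral_FTC_Icc_real[of 0 1 "\<lambda>s. F (x + s *\<^sub>R e)", OF _ dd this] show ?thesis by simp
  qed
  let ?H = "\<lambda>(s::real, x). G (x + s *\<^sub>R e) * indicator {0..1} s"
  have Hi: "integrable (lborel \<Otimes>\<^sub>M lborel) ?H"
  proof (rule lborel_pair.Fubini_integrable)
    have "(\<integral>y. norm (?H (s, y)) \<partial>lborel) = indicator {0..1} s * (\<integral>y. \<bar>G y\<bar> \<partial>lborel)" for s
      using lborel_translate(2)[OF integrable_norm[OF G], of "s *\<^sub>R e"] by (simp add: abs_mult mult.commute)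
    then show "integrable lborel (\<lambda>s. \<integral>y. norm (?H (s, y)) \<partial>lborel)" by simp
    show "AE s in lborel. integrable lborel (\<lambda>y. ?H (s, y))"
      using lborel_translate(1)[OF G] by simp
  qed measurable
  have "(\<integral>x. G x \<partial>lborel) = (\<integral>s. (\<integral>x. G x \<partial>lborel) * indicator {0..1::real} s \<partial>lborel)" by simp
  also have "\<dots> = (\<integral>s. (\<integral>x. ?H (s, x) \<partial>lborel) \<partial>lborel)"
    using lborel_translate(2)[OF G] by simp
  also have "\<dots> = (\<integral>x. (\<integral>s. ?H (s, x) \<partial>lborel) \<partial>lborel)"
    using lborel_pair.Fubini_integral[OF Hi] by simp
  also have "\<dots> = (\<integral>x. F (x + e) - F x \<partial>lborel)" by (simp add: ftc)
  also have "\<dots> = 0" using lborel_translate[OF F, of e] F by simp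
  finally show ?thesis .
qed

lemma nn_integral_exp_abs:
  assumes "a > 0"
  shows "(\<integral>\<^sup>+x. ennreal (exp (- a * \<bar>x\<bar>)) \<partial>(lborel :: real measure)) < \<infinity>"
proof -
  let ?I = "(\<integral>\<^sup>+x. ennreal (exp (- a * x)) * indicator {0..} x \<partial>lborel)"
  have h: "(\<integral>\<^sup>+x. ennreal (exp (- a * x)) * indicator {0..} x \<partial>(lborel :: real measure)) < \<infinity>"
  proof -
    have "?I = ennreal (0 - (- exp (- a * 0) / a))"
    proof (rule nn_integral_FTC_atLeast)
      show "((\<lambda>x. - exp (- a * x) / a) has_real_derivative exp (- a * x)) (at x)" for x
        using assms by (auto intro!: derivative_eq_intros)
      have "((\<lambda>x. exp (- (a * x))) \<longlongrightarrow> 0) at_top"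
        using assms by (intro filterlim_compose[OF exp_at_bot] filterlim_compose[OF filterlim_uminus_at_bot_at_top]
             filterlim_tendsto_pos_mult_at_top[OF tendsto_const] filterlim_ident) 
      from tendsto_divide[OF tendsto_minus[OF this] tendsto_const[of a]]
      show "((\<lambda>x. - exp (- a * x) / a) \<longlongrightarrow> 0) at_top" using assms by simp
    qed auto
    then show ?thesis by simp
  qed
  have "(\<integral>\<^sup>+x. ennreal (exp (- a * \<bar>x\<bar>)) \<partial>(lborel :: real measure))
     \<le> (\<integral>\<^sup>+x. (ennreal (exp (- a * x)) * indicator {0..} x + ennreal (exp (- a * (- x))) * indicator {0..} (- x)) \<partial>lborel)"
    by (rule nn_integral_mono) (auto simp: indicator_def)
  also have "\<dots> = ?I + (\<integral>\<^sup>+x. ennreal (exp (- a * (- x))) * indicator {0..} (- x) \<partial>lborel)"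
    by (rule nn_integral_add) auto
  also have "(\<integral>\<^sup>+x. ennreal (exp (- a * (- x))) * indicator {0..} (- x) \<partial>lborel) = ?I"
    using nn_integral_real_affine[of "\<lambda>x. ennreal (exp (- a * x)) * indicator {0..} x" "-1" 0] by simp
  finally show ?thesis using h by (simp add: order_le_less_trans)
qed

text \<open>The norm dominates the average of the coordinate moduli, so the integrand is at most a
  product of one-dimensional exponentials.\<close>

lemma integrable_exp_norm:
  assumes d: "d > 0"
  shows "integrable lborel (\<lambda>x::'a::euclidean_space. exp (- d * norm x))"
proof (rule integrableI_bounded)
  let ?n = "real DIM('a)"
  have "(\<integral>\<^sup>+x. ennreal (norm (exp (- d * norm x))) \<partial>(lborel :: 'a measure))
     \<le> (\<integral>\<^sup>+x. (\<Prod>b\<in>Basis. ennreal (exp (- (d / ?n) * \<bar>x \<bullet> b\<bar>))) \<partial>(lborel :: 'a measure))"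
  proof (rule nn_integral_mono)
    fix x :: 'a
    have "(\<Sum>b\<in>Basis. \<bar>x \<bullet> b\<bar>) \<le> (\<Sum>b\<in>(Basis::'a set). norm x)"
      by (intro sum_mono) (auto simp: Basis_le_norm)
    then have "(\<Sum>b\<in>Basis. (d / ?n) * \<bar>x \<bullet> b\<bar>) \<le> (d / ?n) * (?n * norm x)"
      unfolding sum_distrib_left[symmetric] using d by (intro mult_left_mono) auto
    then have "exp (- d * norm x) \<le> exp (\<Sum>b\<in>Basis. - (d / ?n) * \<bar>x \<bullet> b\<bar>)"
      by (simp add: sum_negf)
    also have "\<dots> = (\<Prod>b\<in>Basis. exp (- (d / ?n) * \<bar>x \<bullet> b\<bar>))" by (simp add: exp_sum)
    finally show "ennreal (norm (exp (- d * norm x))) \<le> (\<Prod>b\<in>Basis. ennreal (exp (- (d / ?n) * \<bar>x \<bullet> b\<bar>)))"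
      by (subst prod_ennreal) (auto intro!: ennreal_leI)
  qed
  also have "\<dots> = (\<Prod>b\<in>(Basis::'a set). (\<integral>\<^sup>+x. ennreal (exp (- (d / ?n) * \<bar>x\<bar>)) \<partial>lborel))"
    by (rule nn_integral_lborel_prod) auto
  also have "\<dots> < \<infinity>"
    using nn_integral_exp_abs[of "d / ?n"] d by (simp add: power_less_top_ennreal)
  finally show "(\<integral>\<^sup>+x. ennreal (norm (exp (- d * norm x))) \<partial>(lborel :: 'a measure)) < \<infinity>" .
qed measurable

lemma integrable_exp_norm_bound:
  fixes f :: "'a::euclidean_space \<Rightarrow> real"
  assumes "f \<in> borel_measurable borel" and d: "d > 0" and "\<And>x. \<bar>f x\<bar> \<le> C * exp (- d * norm x)"
  shows "integrable lborel f"
proof (rule Bochner_Integration.integrable_bound)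
  show "integrable lborel (\<lambda>x::'a. C * exp (- d * norm x))" by (intro integrable_mult_right integrable_exp_norm d)
  show "AE x in lborel. norm (f x) \<le> norm (C * exp (- d * norm x))"
    by (rule AE_I2) (use assms(3) in \<open>auto intro: order_trans[OF _ abs_ge_self]\<close>)
qed (use assms in auto)

subsection \<open>The mollifier\<close>

text \<open>With v = f exp (2 V), the vector \<open>Dv - (2 * v) *\<^sub>R b\<close> is exp (2 V)
  grad f. The first summand is the dissipation, perturbed by the flux error
  \<open>c - v *\<^sub>R b\<close> and by the slope \<open>X\<close>. The second is the divergence
  of a multiple of z v^2 l; rewritten through grad f it contains 2 lam v^2 with a positive sign.
  Half of the dissipation pays for the cross term in the second summand, the other half absorbs the
  errors.\<close>

lemma energy_pointwise:
  fixes Dv b c G X l :: "'a::real_inner"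
  assumes v: "0 \<le> v" and w: "0 < w" and z: "exp (- 2 * \<eta>) * w \<le> z" "z \<le> exp (2 * \<eta>) * w"
    and r: "norm (c - v *\<^sub>R b) \<le> k * v" and X: "norm X \<le> \<delta>" and l: "norm l = 1"
    and b: "b = G + lam *\<^sub>R l" and s: "s = lam - \<delta>" "s > 0"
  shows "w * ((Dv - (2 * v) *\<^sub>R b + (2 * v) *\<^sub>R X) \<bullet> ((1/2) *\<^sub>R Dv - c))
      + (s * exp (- 2 * \<eta>) / 4) * z * (2 * v * (l \<bullet> Dv) + v\<^sup>2 * (- 4 * (l \<bullet> G) - 2 * lam + 2 * (l \<bullet> X)))
    \<ge> (s\<^sup>2 * exp (- 4 * \<eta>) / 4 - (k + \<delta>)\<^sup>2 - 2 * \<delta> * k) * v\<^sup>2 * w"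
proof -
  define D where "D = Dv - (2 * v) *\<^sub>R b"
  define R where "R = c - v *\<^sub>R b"
  define d where "d = norm D"
  \<comment> \<open>Tuned to the largest ratio z / w = exp (2 \<eta>): the loss \<tau> z d^2 / s is
    then at most w d^2 / 4, half of the dissipation. The gain at the smallest ratio is s^2 exp (-4
    \<eta>) / 4.\<close>
  define \<tau> where "\<tau> = s * exp (- 2 * \<eta>) / 4"
  have d0: "0 \<le> d" by (simp add: d_def)
  have R: "norm R \<le> k * v" using r by (simp add: R_def)
  have \<delta>0: "0 \<le> \<delta>" using X norm_ge_zero order_trans by blast
  have kv: "0 \<le> k * v" using R norm_ge_zero order_trans by blast
  have ll: "l \<bullet> l = 1" using l by (simp add: dot_square_norm)
  have e1: "(1/2) *\<^sub>R Dv - c = (1/2) *\<^sub>R D - R" by (simp add: D_def R_def algebra_simps)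
  have "(D + (2 * v) *\<^sub>R X) \<bullet> ((1/2) *\<^sub>R D - R) = d\<^sup>2 / 2 + v * (X \<bullet> D) - D \<bullet> R - 2 * v * (X \<bullet> R)"
    by (simp add: d_def power2_norm_eq_inner inner_add_left inner_diff_right algebra_simps)
  moreover have "\<bar>X \<bullet> D\<bar> \<le> \<delta> * d"
    using Cauchy_Schwarz_ineq2[of X D] mult_right_mono[OF X norm_ge_zero[of D]] by (simp add: d_def)
  then have "v * (X \<bullet> D) \<ge> - (v * (\<delta> * d))"
    using v mult_left_mono[of "- (X \<bullet> D)" "\<delta> * d" v] by (simp add: abs_le_iff)
  moreover have "\<bar>D \<bullet> R\<bar> \<le> d * (k * v)"
    using Cauchy_Schwarz_ineq2[of D R] mult_left_mono[OF R norm_ge_zero[of D]] by (simp add: d_def)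
  moreover have "\<bar>X \<bullet> R\<bar> \<le> \<delta> * (k * v)"
    using Cauchy_Schwarz_ineq2[of X R] mult_mono[OF X R \<delta>0 norm_ge_zero] by simp
  then have "v * (X \<bullet> R) \<le> v * (\<delta> * (k * v))" using v by (intro mult_left_mono) auto
  ultimately have p1: "(D + (2 * v) *\<^sub>R X) \<bullet> ((1/2) *\<^sub>R D - R) \<ge> d\<^sup>2 / 2 - v * (\<delta> * d) - d * (k * v) - 2 * (v * (\<delta> * (k * v)))"
    by (simp add: mult.assoc abs_le_iff)
  have lX: "l \<bullet> X \<ge> - \<delta>" using Cauchy_Schwarz_ineq2[of l X] X l by simp
  have lD: "l \<bullet> D \<ge> - d" using Cauchy_Schwarz_ineq2[of l D] l by (simp add: d_def)
  let ?q = "2 * v * (l \<bullet> Dv) + v\<^sup>2 * (- 4 * (l \<bullet> G) - 2 * lam + 2 * (l \<bullet> X))"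
  have "?q = 2 * (v * (l \<bullet> D)) + v\<^sup>2 * (2 * lam + 2 * (l \<bullet> X))"
    by (simp add: D_def b inner_add_right inner_diff_right ll power2_eq_square algebra_simps)
  also have "\<dots> \<ge> 2 * (v * (- d)) + v\<^sup>2 * (2 * s)"
    using lD lX v s by (intro add_mono mult_left_mono) auto
  finally have "?q \<ge> 2 * s * v\<^sup>2 - 2 * v * d" by (simp add: algebra_simps)
  \<comment> \<open>Young's inequality weighted so that the cross term consumes exactly half of the
    gain 2 s v^2.\<close>
  moreover have "2 * v * d \<le> s * v\<^sup>2 + d\<^sup>2 / s"
  proof -
    have "0 \<le> (s * v - d)\<^sup>2 / s" using s by simp
    also have "(s * v - d)\<^sup>2 / s = s * v\<^sup>2 - 2 * v * d + d\<^sup>2 / s"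
      using s by (simp add: power2_eq_square field_simps)
    finally show ?thesis by simp
  qed
  ultimately have p2: "?q \<ge> s * v\<^sup>2 - d\<^sup>2 / s" by linarith
  have \<tau>0: "0 \<le> \<tau>" and z0: "0 \<le> z" using s z w by (auto simp: \<tau>_def intro: order_trans[OF _ z(1)])
  have "\<tau> * z * (s * v\<^sup>2 - d\<^sup>2 / s) = (\<tau> * s * v\<^sup>2) * z - (\<tau> * d\<^sup>2 / s) * z" by (simp add: algebra_simps)
  also have "\<dots> \<ge> (\<tau> * s * v\<^sup>2) * (exp (- 2 * \<eta>) * w) - (\<tau> * d\<^sup>2 / s) * (exp (2 * \<eta>) * w)"
    using z s \<tau>0 by (intro diff_mono mult_left_mono) auto
  also have "(\<tau> * s * v\<^sup>2) * (exp (- 2 * \<eta>) * w) - (\<tau> * d\<^sup>2 / s) * (exp (2 * \<eta>) * w) = w * (s\<^sup>2 * exp (- 4 * \<eta>) / 4 * v\<^sup>2 - d\<^sup>2 / 4)"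
  proof -
    have "exp (- 2 * \<eta>) * exp (- 2 * \<eta>) = exp (- 4 * \<eta>)" "exp (- 2 * \<eta>) * exp (2 * \<eta>) = 1"
      by (simp_all flip: exp_add)
    then have "\<tau> * s * exp (- 2 * \<eta>) = s\<^sup>2 * exp (- 4 * \<eta>) / 4" "\<tau> / s * exp (2 * \<eta>) = 1 / 4"
      using s(2) by (simp_all add: \<tau>_def power2_eq_square mult.assoc)
    moreover have "(\<tau> * s * v\<^sup>2) * (exp (- 2 * \<eta>) * w) - (\<tau> * d\<^sup>2 / s) * (exp (2 * \<eta>) * w)
       = w * ((\<tau> * s * exp (- 2 * \<eta>)) * v\<^sup>2 - (\<tau> / s * exp (2 * \<eta>)) * d\<^sup>2)" by (simp add: algebra_simps)
    ultimately show ?thesis by (simp only:) simp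
  qed
  finally have p3: "\<tau> * z * (s * v\<^sup>2 - d\<^sup>2 / s) \<ge> w * (s\<^sup>2 * exp (- 4 * \<eta>) / 4 * v\<^sup>2 - d\<^sup>2 / 4)" .
  have p4: "\<tau> * z * (?q) \<ge> \<tau> * z * (s * v\<^sup>2 - d\<^sup>2 / s)"
    using p2 \<tau>0 z0 by (intro mult_left_mono) auto
  have p5: "w * ((D + (2 * v) *\<^sub>R X) \<bullet> ((1/2) *\<^sub>R D - R)) \<ge> w * (d\<^sup>2 / 2 - v * (\<delta> * d) - d * (k * v) - 2 * (v * (\<delta> * (k * v))))"
    using p1 w by (intro mult_left_mono) auto
  have "(s\<^sup>2 * exp (- 4 * \<eta>) / 4 - (k + \<delta>)\<^sup>2 - 2 * \<delta> * k) * v\<^sup>2 \<le>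
     d\<^sup>2 / 2 - v * (\<delta> * d) - d * (k * v) - 2 * (v * (\<delta> * (k * v))) + (s\<^sup>2 * exp (- 4 * \<eta>) / 4 * v\<^sup>2 - d\<^sup>2 / 4)"
  proof -
    \<comment> \<open>The remaining d^2 / 4 absorbs the cross terms in d v from the flux error and
      from the slope.\<close>
    have "0 \<le> (d / 2 - (k + \<delta>) * v)\<^sup>2" by simp
    also have "\<dots> = d\<^sup>2 / 4 - v * (\<delta> * d) - d * (k * v) + (k + \<delta>)\<^sup>2 * v\<^sup>2"
      by (simp add: power2_eq_square algebra_simps)
    finally show ?thesis by (simp add: power2_eq_square algebra_simps)
  qed
  then have "w * ((s\<^sup>2 * exp (- 4 * \<eta>) / 4 - (k + \<delta>)\<^sup>2 - 2 * \<delta> * k) * v\<^sup>2) \<le>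
     w * (d\<^sup>2 / 2 - v * (\<delta> * d) - d * (k * v) - 2 * (v * (\<delta> * (k * v)))) + w * (s\<^sup>2 * exp (- 4 * \<eta>) / 4 * v\<^sup>2 - d\<^sup>2 / 4)"
    unfolding distrib_left[symmetric] using w by (intro mult_left_mono) auto
  then show ?thesis
    using p3 p4 p5 unfolding e1 D_def[symmetric] \<tau>_def[symmetric] by (simp add: mult_ac)
qed

text \<open>Left unnormalised; the mass is divided out in \<open>decay_const\<close>. The cubed
  positive part makes the kernel C^2 with support of radius \<epsilon>. \<open>bump1\<close> and
  \<open>bump2\<close> are its first and second derivatives in coordinate i of the first
  argument.\<close>

definition bump :: "real \<Rightarrow> real^'n::finite \<Rightarrow> real^'n \<Rightarrow> real" where
  "bump \<epsilon> x y = (max 0 (\<epsilon>\<^sup>2 - (norm (x - y))\<^sup>2)) ^ 3"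

definition bump1 :: "real \<Rightarrow> 'n \<Rightarrow> real^'n::finite \<Rightarrow> real^'n \<Rightarrow> real" where
  "bump1 \<epsilon> i x y = - 6 * (max 0 (\<epsilon>\<^sup>2 - (norm (x - y))\<^sup>2))\<^sup>2 * (x - y) $ i"

definition bump2 :: "real \<Rightarrow> 'n \<Rightarrow> real^'n::finite \<Rightarrow> real^'n \<Rightarrow> real" where
  "bump2 \<epsilon> i x y = 24 * max 0 (\<epsilon>\<^sup>2 - (norm (x - y))\<^sup>2) * ((x - y) $ i)\<^sup>2 - 6 * (max 0 (\<epsilon>\<^sup>2 - (norm (x - y))\<^sup>2))\<^sup>2"

lemma has_derivative_norm_sq:
  fixes x y :: "'a::real_inner"
  shows "((\<lambda>y. (norm (x - y))\<^sup>2) has_derivative (\<lambda>h. - 2 * ((x - y) \<bullet> h))) (at y)"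
  unfolding power2_norm_eq_inner
  by (rule has_derivative_eq_rhs[OF has_derivative_inner])
     (rule has_derivative_diff[OF has_derivative_const has_derivative_ident] | simp add: inner_commute fun_eq_iff)+

lemma C2_data_norm_sq:
  "C2_data (\<lambda>y::real^'n::finite. \<epsilon>\<^sup>2 - (norm (x - y))\<^sup>2) (\<lambda>y. 2 *\<^sub>R (x - y)) (\<lambda>y. \<chi> i. axis i (- 2))"
proof -
  have "((\<lambda>y. \<epsilon>\<^sup>2 - (norm (x - y))\<^sup>2) has_derivative (\<lambda>h. (2 *\<^sub>R (x - y)) \<bullet> h)) (at y)" for y
    by (rule has_derivative_eq_rhs[OF has_derivative_diff[OF has_derivative_const has_derivative_norm_sq]]) auto
  moreover have "((\<lambda>y::real^'n. (2 *\<^sub>R (x - y)) $ i) has_derivative (\<lambda>h. axis i (- 2) \<bullet> h)) (at y)" for y i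
  proof -
    have "((\<lambda>y::real^'n. 2 * (x $ i - y $ i)) has_derivative (\<lambda>h. 2 * (0 - h $ i))) (at y)"
      by (intro has_derivative_mult_right has_derivative_diff has_derivative_const
          bounded_linear_imp_has_derivative bounded_linear_vec_nth)
    then show ?thesis by (simp add: inner_axis')
  qed
  moreover have "continuous_on UNIV (\<lambda>y::real^'n. (\<chi> i. axis i (- 2::real)) $ i $ j)" for i j by simp
  ultimately show ?thesis
    unfolding C2_data_def by (intro conjI allI) (simp_all only: vec_lambda_beta)
qed

lemma bump_pos_imp: "0 < \<epsilon> \<Longrightarrow> max 0 (\<epsilon>\<^sup>2 - (norm (x - y))\<^sup>2) \<noteq> 0 \<Longrightarrow> norm (x - y) \<le> \<epsilon>"
  using power_mono[of \<epsilon> "norm (x - y)" 2] by (cases "norm (x - y) \<le> \<epsilon>") (auto simp: max_def split: if_splits)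

text \<open>The kernel depends on x - y only, so derivatives in y become derivatives in x, with a
  sign change at first order. The generator in y thus turns into the forward operator in x, with the
  drift still evaluated at y inside the kernel.\<close>

lemma bump_testfun:
  assumes e: "\<epsilon> > 0"
  shows "testfun (bump \<epsilon> x)"
    and "gen b (bump \<epsilon> x) y = (\<Sum>i\<in>UNIV. (1/2) * bump2 \<epsilon> i x y - bump1 \<epsilon> i x y * b y $ i)"
proof -
  note C = C2_data_cube[OF C2_data_norm_sq[of \<epsilon> x]]
  have eq: "bump \<epsilon> x = (\<lambda>y. (max 0 (\<epsilon>\<^sup>2 - (norm (x - y))\<^sup>2)) ^ 3)" by (simp add: bump_def fun_eq_iff)
  have bd: "bounded {y. (max 0 (\<epsilon>\<^sup>2 - (norm (x - y))\<^sup>2)) ^ 3 \<noteq> 0}"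
  proof (rule bounded_subset[OF bounded_cball])
    show "{y. (max 0 (\<epsilon>\<^sup>2 - (norm (x - y))\<^sup>2)) ^ 3 \<noteq> 0} \<subseteq> cball x \<epsilon>"
      using bump_pos_imp[OF e, of x] by (auto simp: dist_norm)
  qed
  show "testfun (bump \<epsilon> x)" unfolding eq by (rule C2_data_testfun(1)[OF C bd])
  show "gen b (bump \<epsilon> x) y = (\<Sum>i\<in>UNIV. (1/2) * bump2 \<epsilon> i x y - bump1 \<epsilon> i x y * b y $ i)"
    unfolding eq C2_data_testfun(2)[OF C bd]
    by (simp add: bump1_def bump2_def inner_vec_def sum_distrib_left sum.distrib[symmetric] power2_eq_square axis_def algebra_simps)
qed

lemma
  fixes x y :: "real^'n::finite"
  shows bump_directional: "((\<lambda>s. bump \<epsilon> (x + s *\<^sub>R axis i 1) y) has_real_derivative bump1 \<epsilon> i x y) (at 0)"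
    and bump1_directional: "((\<lambda>s. bump1 \<epsilon> i (x + s *\<^sub>R axis i 1) y) has_real_derivative bump2 \<epsilon> i x y) (at 0)"
proof -
  let ?p = "\<lambda>s. \<epsilon>\<^sup>2 - (norm (x + s *\<^sub>R axis i 1 - y))\<^sup>2"
  have c: "(x + s *\<^sub>R axis i 1 - y) $ i = (x - y) $ i + s" for s by (simp add: axis_def)
  have "?p s = \<epsilon>\<^sup>2 - (norm (x - y))\<^sup>2 - 2 * s * (x - y) $ i - s\<^sup>2" for s
  proof -
    have "x + s *\<^sub>R axis i 1 - y = (x - y) + s *\<^sub>R axis i 1" by simp
    then show ?thesis
      unfolding power2_norm_eq_inner by (simp add: inner_add_left inner_add_right inner_axis inner_axis'
         power2_eq_square algebra_simps)
  qed
  then have *: "?p = (\<lambda>s. \<epsilon>\<^sup>2 - (norm (x - y))\<^sup>2 - 2 * s * (x - y) $ i - s\<^sup>2)" by blast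
  have p: "(?p has_real_derivative - 2 * (x - y) $ i) (at 0)"
    unfolding * by (auto intro!: derivative_eq_intros)
  have d3: "((\<lambda>s. (max 0 (?p s)) ^ 3) has_real_derivative (3 * (max 0 (?p 0))\<^sup>2) * (- 2 * (x - y) $ i)) (at 0)"
    using DERIV_chain2[OF _ p, of "\<lambda>s. (max 0 s) ^ 3"] DERIV_max0_power[of 2 "?p 0"]
    by (simp add: numeral_3_eq_3 power2_eq_square)
  then show "((\<lambda>s. bump \<epsilon> (x + s *\<^sub>R axis i 1) y) has_real_derivative bump1 \<epsilon> i x y) (at 0)"
    unfolding bump_def bump1_def by (rule DERIV_cong) (simp add: algebra_simps)
  have d2: "((\<lambda>s. (max 0 (?p s))\<^sup>2) has_real_derivative (2 * max 0 (?p 0)) * (- 2 * (x - y) $ i)) (at 0)"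
    using DERIV_chain2[OF _ p, of "\<lambda>s. (max 0 s)\<^sup>2"] DERIV_max0_power[of 1 "?p 0"]
    by (simp add: numeral_2_eq_2)
  show "((\<lambda>s. bump1 \<epsilon> i (x + s *\<^sub>R axis i 1) y) has_real_derivative bump2 \<epsilon> i x y) (at 0)"
    unfolding bump1_def c
    by (rule DERIV_cong, (rule derivative_intros d2)+) (simp add: bump2_def power2_eq_square algebra_simps)
qed

text \<open>Boundedness and joint continuity give domination and continuity of expectations; the
  finite range turns exponential moments of the path into decay in x.\<close>

definition local_kernel :: "real \<Rightarrow> (real^'n::finite \<Rightarrow> real^'n \<Rightarrow> real) \<Rightarrow> bool" where
  "local_kernel \<epsilon> k \<longleftrightarrow> continuous_on UNIV (\<lambda>(x, y). k x y) \<and> (\<exists>C. \<forall>x y. \<bar>k x y\<bar> \<le> C) \<and>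
     (\<forall>x y. norm (x - y) > \<epsilon> \<longrightarrow> k x y = 0)"

lemma local_kernel_bump:
  fixes i :: "'n::finite"
  assumes e: "\<epsilon> > 0"
  shows "local_kernel \<epsilon> (bump \<epsilon> :: real^'n \<Rightarrow> real^'n \<Rightarrow> real)" and "local_kernel \<epsilon> (bump1 \<epsilon> i)" and "local_kernel \<epsilon> (bump2 \<epsilon> i)"
proof -
  let ?p = "\<lambda>x y::real^'n. max 0 (\<epsilon>\<^sup>2 - (norm (x - y))\<^sup>2)"
  have p: "0 \<le> ?p x y" "?p x y \<le> \<epsilon>\<^sup>2" for x y by auto
  have z: "?p x y = 0" if "norm (x - y) > \<epsilon>" for x y using bump_pos_imp[OF e, of x y] that by auto
  have "\<bar>bump \<epsilon> x y\<bar> \<le> (\<epsilon>\<^sup>2) ^ 3" for x y :: "real^'n"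
    unfolding bump_def using p[of x y] power_mono[OF p(2,1), of x y 3] by simp
  then show "local_kernel \<epsilon> (bump \<epsilon> :: real^'n \<Rightarrow> real^'n \<Rightarrow> real)"
    using z unfolding local_kernel_def bump_def case_prod_beta by (auto intro!: continuous_intros)
  have "\<bar>bump1 \<epsilon> i x y\<bar> \<le> 6 * (\<epsilon>\<^sup>2)\<^sup>2 * \<epsilon>" for x y :: "real^'n"
  proof (cases "norm (x - y) > \<epsilon>")
    case True
    then show ?thesis using z[OF True] e by (simp add: bump1_def)
  next
    case False
    then have "\<bar>(x - y) $ i\<bar> \<le> \<epsilon>" using component_le_norm_cart[of "x - y" i] by linarith
    then have "6 * (?p x y)\<^sup>2 * \<bar>(x - y) $ i\<bar> \<le> 6 * (\<epsilon>\<^sup>2)\<^sup>2 * \<epsilon>"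
      using power_mono[OF p(2,1), of x y 2] by (intro mult_mono) auto
    then show ?thesis by (simp add: bump1_def abs_mult)
  qed
  then show "local_kernel \<epsilon> (bump1 \<epsilon> i :: real^'n \<Rightarrow> real^'n \<Rightarrow> real)"
    using z unfolding local_kernel_def bump1_def case_prod_beta by (auto intro!: continuous_intros)
  have "\<bar>bump2 \<epsilon> i x y\<bar> \<le> 24 * \<epsilon>\<^sup>2 * \<epsilon>\<^sup>2 + 6 * (\<epsilon>\<^sup>2)\<^sup>2" for x y :: "real^'n"
  proof (cases "norm (x - y) > \<epsilon>")
    case True
    then show ?thesis using z[OF True] e by (simp add: bump2_def)
  next
    case False
    then have "\<bar>(x - y) $ i\<bar> \<le> \<epsilon>" using component_le_norm_cart[of "x - y" i] by linarith
    then have "((x - y) $ i)\<^sup>2 \<le> \<epsilon>\<^sup>2" using e by (simp add: abs_le_square_iff[symmetric])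
    then have "24 * ?p x y * ((x - y) $ i)\<^sup>2 \<le> 24 * \<epsilon>\<^sup>2 * \<epsilon>\<^sup>2"
      using p[of x y] by (intro mult_mono) auto
    moreover have "6 * (?p x y)\<^sup>2 \<le> 6 * (\<epsilon>\<^sup>2)\<^sup>2" using power_mono[OF p(2,1), of x y 2] by simp
    moreover have "0 \<le> 24 * ?p x y * ((x - y) $ i)\<^sup>2" "0 \<le> 6 * (?p x y)\<^sup>2" by auto
    ultimately show ?thesis unfolding bump2_def abs_le_iff by linarith
  qed
  then show "local_kernel \<epsilon> (bump2 \<epsilon> i :: real^'n \<Rightarrow> real^'n \<Rightarrow> real)"
    using z unfolding local_kernel_def bump2_def case_prod_beta by (auto intro!: continuous_intros)
qed

lemma local_kernel_mult:
  assumes k: "local_kernel \<epsilon> k" and g: "continuous_on UNIV g" and B: "\<And>y. \<bar>g y\<bar> \<le> B"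
  shows "local_kernel \<epsilon> (\<lambda>x y. k x y * g y)"
proof -
  obtain C where C: "\<And>x y. \<bar>k x y\<bar> \<le> C" using k unfolding local_kernel_def by blast
  have "\<bar>k x y * g y\<bar> \<le> C * B" for x y
    unfolding abs_mult using C[of x y] B[of y] abs_ge_zero[of "k x y"] by (intro mult_mono) linarith+
  moreover have "continuous_on UNIV (\<lambda>(x, y). k x y * g y)"
    using k unfolding local_kernel_def case_prod_beta
    by (auto intro!: continuous_on_mult continuous_on_compose2[OF g] continuous_on_snd continuous_on_id)
  ultimately show ?thesis using k unfolding local_kernel_def by auto
qed

subsection \<open>Mollified transition densities\<close>

text \<open>Bookkeeping of exponential rates: rates add under products, a negative rate means decay
  and implies integrability. The integrands of the dissipation estimate are checked by this
  arithmetic.\<close>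

definition exp_bounded :: "real \<Rightarrow> ('a::real_normed_vector \<Rightarrow> real) \<Rightarrow> bool" where
  "exp_bounded \<theta> f \<longleftrightarrow> continuous_on UNIV f \<and> (\<exists>M. \<forall>x. \<bar>f x\<bar> \<le> M * exp (\<theta> * norm x))"

lemma exp_boundedI: "continuous_on UNIV f \<Longrightarrow> (\<And>x. \<bar>f x\<bar> \<le> M * exp (\<theta> * norm x)) \<Longrightarrow> exp_bounded \<theta> f"
  unfolding exp_bounded_def by blast

lemma exp_bounded_const: "exp_bounded 0 (\<lambda>x. c)"
  by (rule exp_boundedI[where M="\<bar>c\<bar>"]) auto

lemma exp_bounded_add:
  assumes "exp_bounded \<theta> f" "exp_bounded \<theta> g"
  shows "exp_bounded \<theta> (\<lambda>x. f x + g x)"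
proof -
  obtain M N where "\<And>x. \<bar>f x\<bar> \<le> M * exp (\<theta> * norm x)" "\<And>x. \<bar>g x\<bar> \<le> N * exp (\<theta> * norm x)"
    using assms unfolding exp_bounded_def by blast
  then have "\<bar>f x + g x\<bar> \<le> (M + N) * exp (\<theta> * norm x)" for x
    unfolding distrib_right by (meson abs_triangle_ineq add_mono order_trans)
  then show ?thesis
    using assms unfolding exp_bounded_def by (auto intro: continuous_on_add)
qed

lemma exp_bounded_minus: "exp_bounded \<theta> f \<Longrightarrow> exp_bounded \<theta> (\<lambda>x. - f x)"
  unfolding exp_bounded_def by (auto intro: continuous_on_minus)

lemma exp_bounded_diff: "exp_bounded \<theta> f \<Longrightarrow> exp_bounded \<theta> g \<Longrightarrow> exp_bounded \<theta> (\<lambda>x. f x - g x)"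
  using exp_bounded_add[OF _ exp_bounded_minus, of \<theta> f g] by simp

lemma exp_bounded_mult:
  assumes "exp_bounded \<theta> f" "exp_bounded \<theta>' g" "\<theta> + \<theta>' = \<kappa>"
  shows "exp_bounded \<kappa> (\<lambda>x. f x * g x)"
proof -
  obtain M N where M: "\<And>x. \<bar>f x\<bar> \<le> M * exp (\<theta> * norm x)" and N: "\<And>x. \<bar>g x\<bar> \<le> N * exp (\<theta>' * norm x)"
    using assms unfolding exp_bounded_def by blast
  have "\<bar>f x * g x\<bar> \<le> (M * N) * exp (\<kappa> * norm x)" for x
  proof -
    have "\<bar>f x\<bar> * \<bar>g x\<bar> \<le> (M * exp (\<theta> * norm x)) * (N * exp (\<theta>' * norm x))"
      by (intro mult_mono M N order_trans[OF abs_ge_zero M]) auto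
    also have "\<dots> = (M * N) * exp (\<kappa> * norm x)"
      unfolding assms(3)[symmetric] by (simp add: distrib_right exp_add)
    finally show ?thesis by (simp add: abs_mult)
  qed
  then show ?thesis
    using assms unfolding exp_bounded_def by (auto intro: continuous_on_mult)
qed

lemma exp_bounded_integrable:
  fixes f :: "'a::euclidean_space \<Rightarrow> real"
  assumes "exp_bounded \<theta> f" "\<theta> < 0"
  shows "integrable lborel f"
proof -
  obtain M where M: "\<And>x. \<bar>f x\<bar> \<le> M * exp (\<theta> * norm x)" using assms unfolding exp_bounded_def by blast
  show ?thesis
    by (rule integrable_exp_norm_bound[where d="-\<theta>" and C=M])
       (use assms M in \<open>auto simp: exp_bounded_def intro: borel_measurable_continuous_onI\<close>)
qed

context diffusion_law
begin

text \<open>Written with the indicator of the whole space so as to match the expectations over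
  events in \<open>expectation_continuous\<close> and \<open>dynkin_deriv\<close>;
  \<open>mean_eq\<close> gives the plain form.\<close>

definition mean :: "(real^'n \<Rightarrow> real^'n \<Rightarrow> real) \<Rightarrow> real \<Rightarrow> real^'n \<Rightarrow> real" where
  "mean k t x = (\<integral>w. indicator (space P) w * k x (w t) \<partial>P)"

lemma local_kernel_measurable:
  assumes "local_kernel \<epsilon> k"
  shows "(\<lambda>w. k x (w t)) \<in> borel_measurable P"
proof -
  have "continuous_on UNIV (k x)"
    using continuous_on_compose2[of UNIV "\<lambda>(x, y). k x y", OF _ continuous_on_Pair[OF continuous_on_const[of UNIV x] continuous_on_id]]
      assms unfolding local_kernel_def by simp
  then have "k x \<in> borel_measurable borel" by (rule borel_measurable_continuous_onI)
  then show ?thesis by measurable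
qed

lemma local_kernel_integrable:
  assumes k: "local_kernel \<epsilon> k"
  shows "integrable P (\<lambda>w. k x (w t))"
proof -
  obtain C where "\<And>x y. \<bar>k x y\<bar> \<le> C" using k unfolding local_kernel_def by blast
  then show ?thesis
    using local_kernel_measurable[OF k] by (intro integrable_const_bound[where B=C]) auto
qed

lemma mean_eq: "mean k t x = (\<integral>w. k x (w t) \<partial>P)"
  unfolding mean_def by (rule Bochner_Integration.integral_cong) auto

lemma mean_continuous:
  assumes "local_kernel \<epsilon> k"
  shows "continuous_on UNIV (\<lambda>(t, x). mean k t x)"
proof -
  obtain C where "\<And>x y. \<bar>k x y\<bar> \<le> C" using assms unfolding local_kernel_def by blast
  then show ?thesis
    using assms expectation_continuous[of k C "space P"] unfolding mean_def local_kernel_def by auto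
qed

lemma mean_continuous_space:
  assumes "local_kernel \<epsilon> k"
  shows "continuous_on UNIV (mean k t)"
  using continuous_on_compose2[OF mean_continuous[OF assms] continuous_on_Pair[OF continuous_on_const[of UNIV t] continuous_on_id]]
  by simp

text \<open>A nonzero kernel value forces |x| \<le> |y| + \<epsilon>, so the exponential moments of
  the process translate into decay at every rate, uniformly on bounded time intervals. This beats
  the growth of the energy weights.\<close>

lemma mean_decay:
  assumes k: "local_kernel \<epsilon> k" and th: "\<theta> > 0"
  shows "\<exists>M. \<forall>t\<in>{0..T}. \<forall>x. \<bar>mean k t x\<bar> \<le> M * exp (- \<theta> * norm x)"
proof -
  obtain C where C: "\<And>x y. \<bar>k x y\<bar> \<le> C" and z: "\<And>x y. norm (x - y) > \<epsilon> \<Longrightarrow> k x y = 0"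
    using k unfolding local_kernel_def by blast
  have C0: "0 \<le> C" using C abs_ge_zero order_trans by blast
  obtain M where M0: "M \<ge> 0" and M: "\<And>t. t \<in> {0..T} \<Longrightarrow> (\<integral>\<^sup>+w. ennreal (exp (\<theta> * norm (w t))) \<partial>P) \<le> ennreal M"
    using exp_moment[OF th, of T] by blast
  have "\<bar>mean k t x\<bar> \<le> C * exp (\<theta> * \<epsilon>) * M * exp (- \<theta> * norm x)" if t: "t \<in> {0..T}" for t x
  proof -
    let ?B = "C * exp (\<theta> * \<epsilon>) * exp (- \<theta> * norm x)"
    have pw: "\<bar>k x y\<bar> \<le> ?B * exp (\<theta> * norm y)" for y
    proof (cases "norm (x - y) > \<epsilon>")
      case True then show ?thesis using z[OF True] C0 by simp
    next
      case False
      then have "norm x \<le> norm y + \<epsilon>" using norm_triangle_ineq2[of x y] by linarith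
      then have "0 \<le> \<theta> * (norm y + \<epsilon> - norm x)" using th by simp
      then have "1 \<le> exp (\<theta> * \<epsilon> + - \<theta> * norm x + \<theta> * norm y)" by (simp add: algebra_simps)
      then have "C * 1 \<le> C * exp (\<theta> * \<epsilon> + - \<theta> * norm x + \<theta> * norm y)" using C0 by (intro mult_left_mono) auto
      then have "C \<le> ?B * exp (\<theta> * norm y)"
        by (simp only: exp_add mult_1_right mult.assoc)
      then show ?thesis using C[of x y] by linarith
    qed
    have "ennreal \<bar>mean k t x\<bar> \<le> ennreal (\<integral>w. \<bar>k x (w t)\<bar> \<partial>P)"
      unfolding mean_eq by (intro ennreal_leI integral_abs_bound)
    also have "\<dots> = (\<integral>\<^sup>+w. ennreal \<bar>k x (w t)\<bar> \<partial>P)"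
      using local_kernel_integrable[OF k] by (intro nn_integral_eq_integral[symmetric]) auto
    also have "\<dots> \<le> (\<integral>\<^sup>+w. ennreal (?B) * ennreal (exp (\<theta> * norm (w t))) \<partial>P)"
      using pw C0 by (intro nn_integral_mono) (simp add: ennreal_mult[symmetric] ennreal_leI)
    also have "\<dots> = ennreal (?B) * (\<integral>\<^sup>+w. ennreal (exp (\<theta> * norm (w t))) \<partial>P)"
      by (rule nn_integral_cmult) measurable
    also have "\<dots> \<le> ennreal (?B) * ennreal M"
      by (intro mult_left_mono M t) auto
    also have "\<dots> = ennreal (C * exp (\<theta> * \<epsilon>) * M * exp (- \<theta> * norm x))"
      using C0 M0 by (simp add: ennreal_mult[symmetric] mult_ac)
    finally show ?thesis using C0 M0 by (subst (asm) ennreal_le_iff) auto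
  qed
  then show ?thesis by blast
qed

lemma mean_exp_bounded:
  assumes k: "local_kernel \<epsilon> k" and th: "\<theta> > 0" and t: "t \<ge> 0"
  shows "exp_bounded (- \<theta>) (mean k t)"
proof -
  obtain M where "\<forall>s\<in>{0..t}. \<forall>x. \<bar>mean k s x\<bar> \<le> M * exp (- \<theta> * norm x)"
    using mean_decay[OF k th] by blast
  then show ?thesis using t by (intro exp_boundedI[where M=M] mean_continuous_space[OF k]) auto
qed

text \<open>Dominated convergence, the difference quotients being bounded by the supremum of
  \<open>k'\<close>. Directional derivatives suffice because only divergences are integrated
  later.\<close>

lemma mean_directional:
  assumes k: "local_kernel \<epsilon> k" and k': "local_kernel \<epsilon> k'"
    and d: "\<And>x y. ((\<lambda>s. k (x + s *\<^sub>R e) y) has_real_derivative k' x y) (at 0)"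
  shows "((\<lambda>s. mean k t (x + s *\<^sub>R e)) has_real_derivative mean k' t x) (at 0)"
proof -
  obtain C where C: "\<And>x y. \<bar>k' x y\<bar> \<le> C" using k' unfolding local_kernel_def by blast
  have dd: "((\<lambda>s. k (x + s *\<^sub>R e) y) has_real_derivative k' (x + s *\<^sub>R e) y) (at s)" for x y s
    using d[of "x + s *\<^sub>R e" y] DERIV_at_within_shift[of "\<lambda>s. k (x + s *\<^sub>R e) y" _ s 0 UNIV]
    by (simp add: algebra_simps)
  have bd: "\<bar>k (x + h *\<^sub>R e) y - k x y\<bar> \<le> C * \<bar>h\<bar>" for h y
    using field_differentiable_bound[of UNIV "\<lambda>s. k (x + s *\<^sub>R e) y" "\<lambda>s. k' (x + s *\<^sub>R e) y" C h 0] dd C by simp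
  note [measurable] = local_kernel_measurable[OF k] local_kernel_measurable[OF k']
  show ?thesis
    unfolding DERIV_def tendsto_at_iff_sequentially
  proof (intro allI impI)
    fix h :: "nat \<Rightarrow> real" assume h: "\<forall>i. h i \<in> UNIV - {0}" and h0: "h \<longlonglongrightarrow> 0"
    let ?D = "\<lambda>n w. (k (x + h n *\<^sub>R e) (w t) - k x (w t)) / h n"
    have "(\<lambda>n. \<integral>w. ?D n w \<partial>P) \<longlonglongrightarrow> (\<integral>w. k' x (w t) \<partial>P)"
    proof (rule integral_dominated_convergence[where w="\<lambda>_. C"])
      show "AE w in P. (\<lambda>n. ?D n w) \<longlonglongrightarrow> k' x (w t)"
      proof (rule AE_I2)
        fix w
        have "((\<lambda>h. (k (x + h *\<^sub>R e) (w t) - k x (w t)) / h) \<longlongrightarrow> k' x (w t)) (at 0)"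
          using d[of x "w t"] unfolding DERIV_def by simp
        then show "(\<lambda>n. ?D n w) \<longlonglongrightarrow> k' x (w t)"
          using h h0 unfolding tendsto_at_iff_sequentially comp_def by blast
      qed
      show "AE w in P. norm (?D n w) \<le> C" for n
        using bd[of "h n"] h by (auto simp: divide_le_eq)
    qed auto
    then show "((\<lambda>h. (mean k t (x + (0 + h) *\<^sub>R e) - mean k t (x + 0 *\<^sub>R e)) / h) \<circ> h) \<longlonglongrightarrow> mean k' t x"
      using local_kernel_integrable[OF k] by (simp add: mean_eq comp_def)
  qed
qed

end

subsection \<open>The weighted energy\<close>

lemma has_derivative_directional:
  fixes f :: "real^'n::finite \<Rightarrow> real"
  assumes "(f has_derivative (\<lambda>h. D \<bullet> h)) (at x)"
  shows "((\<lambda>s. f (x + s *\<^sub>R axis i 1)) has_real_derivative D $ i) (at 0)"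
proof -
  have "((\<lambda>s::real. x + s *\<^sub>R axis i 1) has_derivative (\<lambda>s. s *\<^sub>R axis i 1)) (at 0)"
    by (auto intro!: derivative_eq_intros)
  moreover have "(f has_derivative (\<lambda>h. D \<bullet> h)) (at (x + 0 *\<^sub>R axis i 1))" using assms by simp
  ultimately have "((\<lambda>s. f (x + s *\<^sub>R axis i 1)) has_derivative (\<lambda>s. D \<bullet> (s *\<^sub>R axis i 1))) (at 0)"
    by (rule has_derivative_compose)
  then show ?thesis by (simp add: has_field_derivative_def inner_axis mult_commute_abs)
qed

lemma has_derivative_sqrt_one_norm:
  fixes x :: "'a::real_inner"
  shows "((\<lambda>x. sqrt (1 + (norm x)\<^sup>2)) has_derivative (\<lambda>h. ((1 / sqrt (1 + (norm x)\<^sup>2)) *\<^sub>R x) \<bullet> h)) (at x)"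
proof -
  have pos: "0 < 1 + (norm x)\<^sup>2" by (simp add: add_pos_nonneg)
  have "((\<lambda>x. 1 + (norm x)\<^sup>2) has_derivative (\<lambda>h. 2 * (x \<bullet> h))) (at x)"
    using has_derivative_add[OF has_derivative_const[of 1] has_derivative_norm_sq[of 0 x]] by simp
  from DERIV_compose_FDERIV[OF DERIV_real_sqrt[OF pos] this] show ?thesis
    by (rule has_derivative_eq_rhs) (simp add: fun_eq_iff inverse_eq_divide)
qed

text \<open>The constants obtained here are functions of the real parameters and the dimension
  alone, so the same numbers serve all environments. The values of \<epsilon> and \<delta> are fixed
  only in the final theorem.\<close>

locale gradient_diffusion = diffusion_law b P B for b :: "real^'n::finite \<Rightarrow> real^'n" and P B +
  fixes \<phi> :: "real^'n \<Rightarrow> real" and G :: "real^'n \<Rightarrow> real^'n" and \<eta> K lam :: real and l :: "real^'n"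
    and \<epsilon> \<delta> :: real
  assumes \<phi>_bound: "\<bar>\<phi> x\<bar> \<le> \<eta>"
    and \<phi>_deriv: "(\<phi> has_derivative (\<lambda>h. G x \<bullet> h)) (at x)"
    and b_eq: "b x = G x + lam *\<^sub>R l"
    and b_lipschitz: "norm (b y - b z) \<le> K * norm (y - z)"
    and l_unit: "norm l = 1" and \<epsilon>_pos: "\<epsilon> > 0" and \<delta>_pos: "\<delta> > 0" and K_nonneg: "K \<ge> 0"
    and lam_gt: "lam > \<delta>"
begin

text \<open>The gradient of \<chi> x = \<delta> sqrt (1 + |x|^2).\<close>

definition slope :: "real^'n \<Rightarrow> real^'n" where
  "slope x = (\<delta> / sqrt (1 + (norm x)\<^sup>2)) *\<^sub>R x"

definition wt :: "real^'n \<Rightarrow> real" where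
  "wt x = exp (- 2 * \<phi> x - 2 * lam * (l \<bullet> x) + 2 * \<delta> * sqrt (1 + (norm x)\<^sup>2))"

text \<open>With v = f exp (2 V), the product v^2 \<open>wt'\<close> is f^2 exp (2 lam (l . x) + 2
  \<chi>): the potential \<phi> has cancelled from the weight on f, so differentiating that weight
  along l brings in lam and the slope only.\<close>

definition wt' :: "real^'n \<Rightarrow> real" where
  "wt' x = wt x * exp (- 2 * \<phi> x)"

lemma wt_pos: "0 < wt x"
  by (simp add: wt_def)

lemma norm_slope: "norm (slope x) \<le> \<delta>"
proof -
  have "norm x \<le> sqrt (1 + (norm x)\<^sup>2)" by (rule real_le_rsqrt) simp
  moreover have "0 < sqrt (1 + (norm x)\<^sup>2)" by (simp add: add_pos_nonneg)
  ultimately show ?thesis using \<delta>_pos by (simp add: slope_def field_simps)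
qed

lemma wt_deriv: "(wt has_derivative (\<lambda>h. (wt x *\<^sub>R (2 *\<^sub>R slope x - 2 *\<^sub>R b x)) \<bullet> h)) (at x)"
proof -
  have "((\<lambda>x. - 2 * \<phi> x - 2 * lam * (l \<bullet> x) + 2 * \<delta> * sqrt (1 + (norm x)\<^sup>2)) has_derivative
     (\<lambda>h. - 2 * (G x \<bullet> h) - 2 * lam * (l \<bullet> h) + 2 * \<delta> * (((1 / sqrt (1 + (norm x)\<^sup>2)) *\<^sub>R x) \<bullet> h))) (at x)"
    by (intro has_derivative_add has_derivative_diff has_derivative_mult_right \<phi>_deriv
        has_derivative_sqrt_one_norm bounded_linear_imp_has_derivative bounded_linear_inner_right)
  from DERIV_compose_FDERIV[OF DERIV_exp this, folded wt_def] show ?thesis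
    by (rule has_derivative_eq_rhs)
       (simp add: fun_eq_iff slope_def b_eq inner_add_left inner_diff_left algebra_simps)
qed

lemma wt'_deriv: "(wt' has_derivative (\<lambda>h. (wt' x *\<^sub>R (2 *\<^sub>R slope x - 4 *\<^sub>R G x - (2 * lam) *\<^sub>R l)) \<bullet> h)) (at x)"
proof -
  have "((\<lambda>x. - 2 * \<phi> x) has_derivative (\<lambda>h. - 2 * (G x \<bullet> h))) (at x)"
    by (intro has_derivative_mult_right \<phi>_deriv)
  from has_derivative_mult[OF wt_deriv DERIV_compose_FDERIV[OF DERIV_exp this], folded wt'_def] show ?thesis
    by (rule has_derivative_eq_rhs)
       (simp add: fun_eq_iff wt'_def b_eq inner_add_left inner_diff_left algebra_simps)
qed

lemma wt'_bounds: "exp (- 2 * \<eta>) * wt x \<le> wt' x" "wt' x \<le> exp (2 * \<eta>) * wt x"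
  using \<phi>_bound[of x] wt_pos[of x] by (auto simp: wt'_def abs_le_iff)

lemma wt_le: "wt x \<le> exp (2 * \<eta> + 2 * \<delta>) * exp ((2 * lam + 2 * \<delta>) * norm x)"
proof -
  have "sqrt (1 + (norm x)\<^sup>2) \<le> 1 + norm x"
    by (rule real_le_lsqrt) (auto simp: power2_eq_square algebra_simps)
  then have "2 * \<delta> * sqrt (1 + (norm x)\<^sup>2) \<le> 2 * \<delta> * (1 + norm x)" using \<delta>_pos by simp
  moreover have "\<bar>l \<bullet> x\<bar> \<le> norm x" using Cauchy_Schwarz_ineq2[of l x] l_unit by simp
  then have "- (l \<bullet> x) \<le> norm x" by linarith
  then have "lam * (- (l \<bullet> x)) \<le> lam * norm x" using lam_gt \<delta>_pos by (intro mult_left_mono) auto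
  moreover have "- 2 * \<phi> x \<le> 2 * \<eta>" using \<phi>_bound[of x] by (simp add: abs_le_iff)
  ultimately have "- 2 * \<phi> x - 2 * lam * (l \<bullet> x) + 2 * \<delta> * sqrt (1 + (norm x)\<^sup>2) \<le> (2 * \<eta> + 2 * \<delta>) + (2 * lam + 2 * \<delta>) * norm x"
    by (simp add: algebra_simps)
  then show ?thesis unfolding wt_def exp_add[symmetric] by simp
qed

lemma wt_continuous: "continuous_on UNIV wt" and wt'_continuous: "continuous_on UNIV wt'"
  by (intro continuous_at_imp_continuous_on ballI has_derivative_continuous[OF wt_deriv] has_derivative_continuous[OF wt'_deriv])+

lemma exp_bounded_wt: "exp_bounded (2 * lam + 2 * \<delta>) wt"
  by (rule exp_boundedI[OF wt_continuous]) (use wt_le wt_pos in \<open>auto simp: abs_of_pos\<close>)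

lemma exp_bounded_wt': "exp_bounded (2 * lam + 2 * \<delta>) wt'"
proof (rule exp_boundedI[OF wt'_continuous])
  fix x
  have "\<bar>wt' x\<bar> = wt' x" using wt_pos[of x] by (simp add: wt'_def)
  also have "\<dots> \<le> exp (2 * \<eta>) * (exp (2 * \<eta> + 2 * \<delta>) * exp ((2 * lam + 2 * \<delta>) * norm x))"
    using wt_le[of x] by (intro order_trans[OF wt'_bounds(2)] mult_left_mono) auto
  finally show "\<bar>wt' x\<bar> \<le> (exp (2 * \<eta>) * exp (2 * \<eta> + 2 * \<delta>)) * exp ((2 * lam + 2 * \<delta>) * norm x)"
    by (simp only: mult.assoc)
qed

lemma exp_bounded_drift:
  "exp_bounded 0 (\<lambda>x. b x $ i)" "exp_bounded 0 (\<lambda>x. G x $ i)" "exp_bounded 0 (\<lambda>x. slope x $ i)"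
proof -
  show b: "exp_bounded 0 (\<lambda>x. b x $ i)"
    using b_bounded component_le_norm_cart order_trans
    by (intro exp_boundedI[where M=B] continuous_intros b_continuous) (auto intro: order_trans)
  have "G x $ i = b x $ i - lam * l $ i" for x by (simp add: b_eq)
  then show "exp_bounded 0 (\<lambda>x. G x $ i)"
    using exp_bounded_diff[OF b exp_bounded_const] by simp
  have "0 < 1 + (norm x)\<^sup>2" for x :: "real^'n" by (simp add: add_pos_nonneg)
  then have "continuous_on UNIV slope" unfolding slope_def
    by (intro continuous_intros) (auto simp: less_imp_neq[symmetric])
  then show "exp_bounded 0 (\<lambda>x. slope x $ i)"
    using norm_slope component_le_norm_cart
    by (intro exp_boundedI[where M=\<delta>] continuous_intros) (auto intro: order_trans)
qed

abbreviation dens where "dens \<equiv> mean (bump \<epsilon>)"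

text \<open>The forward equation for the mollified density: half its Laplacian minus the divergence
  of the mollified drift flux, with all derivatives placed on the bump.\<close>

definition ddens :: "real \<Rightarrow> real^'n \<Rightarrow> real" where
  "ddens t x = (\<Sum>i\<in>UNIV. (1/2) * mean (bump2 \<epsilon> i) t x - mean (\<lambda>x y. bump1 \<epsilon> i x y * b y $ i) t x)"

lemma b_component: "continuous_on UNIV (\<lambda>y. b y $ i)" "\<bar>b y $ i\<bar> \<le> B"
  using b_bounded[of y] component_le_norm_cart[of "b y" i] by (auto intro!: continuous_intros b_continuous)

lemma kernels:
  "local_kernel \<epsilon> (bump \<epsilon> :: real^'n \<Rightarrow> real^'n \<Rightarrow> real)" "local_kernel \<epsilon> (bump1 \<epsilon> i)" "local_kernel \<epsilon> (bump2 \<epsilon> i)"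
  "local_kernel \<epsilon> (\<lambda>x y. bump \<epsilon> x y * b y $ i)" "local_kernel \<epsilon> (\<lambda>x y. bump1 \<epsilon> i x y * b y $ i)"
  by (intro local_kernel_bump \<epsilon>_pos local_kernel_mult[where B=B] b_component)+

lemma bump_nonneg: "0 \<le> bump \<epsilon> x y"
  by (simp add: bump_def)

lemma dens_nonneg: "0 \<le> dens t x"
  unfolding mean_eq by (rule Bochner_Integration.integral_nonneg) (rule bump_nonneg)

lemma dens_deriv:
  assumes "t \<in> {0..T}"
  shows "((\<lambda>t. dens t x) has_real_derivative ddens t x) (at t within {0..T})"
proof -
  have A: "space P \<in> sets (filt 0)" unfolding space_P using sets.top[of "filt 0"] by simp
  have "(\<integral>w. indicator (space P) w * gen b (bump \<epsilon> x) (w t) \<partial>P) = ddens t x"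
  proof -
    have "(\<integral>w. indicator (space P) w * gen b (bump \<epsilon> x) (w t) \<partial>P)
        = (\<integral>w. (\<Sum>i\<in>UNIV. (1/2) * bump2 \<epsilon> i x (w t) - bump1 \<epsilon> i x (w t) * b (w t) $ i) \<partial>P)"
      by (rule Bochner_Integration.integral_cong) (auto simp: bump_testfun(2)[OF \<epsilon>_pos])
    also have "\<dots> = ddens t x"
      unfolding ddens_def mean_eq
      using local_kernel_integrable[OF kernels(3)] local_kernel_integrable[OF kernels(5)]
      by (subst Bochner_Integration.integral_sum) (auto intro!: sum.cong)
    finally show ?thesis .
  qed
  then show ?thesis
    using dynkin_deriv[OF bump_testfun(1)[OF \<epsilon>_pos] order_refl A assms, of x] by (simp add: mean_def)
qed

definition flux :: "real \<Rightarrow> real^'n \<Rightarrow> real^'n" where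
  "flux t x = (\<chi> i. mean (\<lambda>x y. bump \<epsilon> x y * b y $ i) t x)"

text \<open>Because the bump has radius \<open>\<epsilon>\<close>, mollifying the flux instead of the density costs only
  a factor \<open>K \<epsilon>\<close> relative to the mollified density itself; no limit \<open>\<epsilon> \<rightarrow> 0\<close> is needed.\<close>

lemma flux_commutator: "norm (flux t x - dens t x *\<^sub>R b x) \<le> K * \<epsilon> * dens t x"
proof -
  define u where "u = flux t x - dens t x *\<^sub>R b x"
  note int = local_kernel_integrable[OF kernels(1)] local_kernel_integrable[OF kernels(4)]
  \<comment> \<open>Pairing the error with itself moves the norm estimate under the expectation,
    where the Lipschitz bound applies on the support of the bump.\<close>
  have "u \<bullet> u = (\<Sum>i\<in>UNIV. u $ i * ((\<integral>w. bump \<epsilon> x (w t) * b (w t) $ i \<partial>P) - (\<integral>w. bump \<epsilon> x (w t) \<partial>P) * b x $ i))"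
    by (simp add: inner_vec_def u_def flux_def mean_eq)
  also have "\<dots> = (\<integral>w. (\<Sum>i\<in>UNIV. u $ i * (bump \<epsilon> x (w t) * b (w t) $ i - bump \<epsilon> x (w t) * b x $ i)) \<partial>P)"
    using int by (subst Bochner_Integration.integral_sum) auto
  also have "\<dots> \<le> (\<integral>w. norm u * (K * \<epsilon>) * bump \<epsilon> x (w t) \<partial>P)"
  proof (rule integral_mono)
    show "integrable P (\<lambda>w. \<Sum>i\<in>UNIV. u $ i * (bump \<epsilon> x (w t) * b (w t) $ i - bump \<epsilon> x (w t) * b x $ i))"
      using int by (intro Bochner_Integration.integrable_sum) auto
    show "integrable P (\<lambda>w. norm u * (K * \<epsilon>) * bump \<epsilon> x (w t))" using int by auto
    fix w :: "real \<Rightarrow> real^'n"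
    let ?y = "w t"
    have eq: "(\<Sum>i\<in>UNIV. u $ i * (bump \<epsilon> x ?y * b ?y $ i - bump \<epsilon> x ?y * b x $ i)) = bump \<epsilon> x ?y * (u \<bullet> (b ?y - b x))"
      by (simp add: inner_vec_def sum_distrib_left algebra_simps)
    show "(\<Sum>i\<in>UNIV. u $ i * (bump \<epsilon> x ?y * b ?y $ i - bump \<epsilon> x ?y * b x $ i)) \<le> norm u * (K * \<epsilon>) * bump \<epsilon> x ?y"
    proof (cases "norm (x - ?y) > \<epsilon>")
      case True
      then have "bump \<epsilon> x ?y = 0" using kernels(1) unfolding local_kernel_def by blast
      then show ?thesis unfolding eq by simp
    next
      case False
      then have "K * norm (?y - x) \<le> K * \<epsilon>"
        using K_nonneg by (intro mult_left_mono) (auto simp: norm_minus_commute)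
      then have "norm (b ?y - b x) \<le> K * \<epsilon>" using b_lipschitz[of ?y x] by linarith
      then have "norm u * norm (b ?y - b x) \<le> norm u * (K * \<epsilon>)" by (intro mult_left_mono) auto
      then have "u \<bullet> (b ?y - b x) \<le> norm u * (K * \<epsilon>)" using norm_cauchy_schwarz[of u "b ?y - b x"] by linarith
      from mult_left_mono[OF this bump_nonneg[of x ?y]] show ?thesis unfolding eq by (simp add: mult.commute)
    qed
  qed
  also have "\<dots> = norm u * (K * \<epsilon> * dens t x)" by (simp add: mean_eq)
  finally have "norm u * norm u \<le> norm u * (K * \<epsilon> * dens t x)" by (simp add: dot_square_norm power2_eq_square)
  then have "norm u \<le> K * \<epsilon> * dens t x \<or> norm u = 0" by (auto simp: mult_le_cancel_left)
  then show ?thesis using K_nonneg \<epsilon>_pos dens_nonneg[of t x] unfolding u_def by auto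
qed

end

section \<open>Dissipation and exponential decay of the weighted energy\<close>

context gradient_diffusion
begin

text \<open>The coefficient in \<open>energy_pointwise\<close> with s = lam - \<delta> and k = K
  \<epsilon>. Formally, \<eta> = \<delta> = \<epsilon> = 0 gives lam^2 / 4, half of the spectral gap
  lam^2 / 2 for constant drift; the other half is spent on absorbing cross terms.\<close>

definition rate :: real where
  "rate = (lam - \<delta>)\<^sup>2 * exp (- 4 * \<eta>) / 4 - (K * \<epsilon> + \<delta>)\<^sup>2 - 2 * \<delta> * (K * \<epsilon>)"

lemma ddens_decay:
  assumes "\<theta> > 0"
  shows "\<exists>M. \<forall>t\<in>{0..T}. \<forall>x. \<bar>ddens t x\<bar> \<le> M * exp (- \<theta> * norm x)"
proof -
  let ?d = "\<lambda>i t x. (1/2) * mean (bump2 \<epsilon> i) t x - mean (\<lambda>x y. bump1 \<epsilon> i x y * b y $ i) t x"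
  have "\<exists>M. \<forall>t\<in>{0..T}. \<forall>x. \<bar>?d i t x\<bar> \<le> M * exp (- \<theta> * norm x)" for i
  proof -
    obtain M N where M: "\<And>t x. t \<in> {0..T} \<Longrightarrow> \<bar>mean (bump2 \<epsilon> i) t x\<bar> \<le> M * exp (- \<theta> * norm x)"
      and N: "\<And>t x. t \<in> {0..T} \<Longrightarrow> \<bar>mean (\<lambda>x y. bump1 \<epsilon> i x y * b y $ i) t x\<bar> \<le> N * exp (- \<theta> * norm x)"
      using mean_decay[OF kernels(3) assms, of T i] mean_decay[OF kernels(5) assms, of T i] by blast
    have "\<bar>?d i t x\<bar> \<le> (M / 2 + N) * exp (- \<theta> * norm x)"
      if "t \<in> {0..T}" for t x
      using M[OF that, of x] N[OF that, of x] unfolding distrib_right by (simp add: abs_le_iff)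
    then show ?thesis by blast
  qed
  then have "\<forall>i. \<exists>M. \<forall>t\<in>{0..T}. \<forall>x. \<bar>?d i t x\<bar> \<le> M * exp (- \<theta> * norm x)" by blast
  from choice[OF this] obtain M where M: "\<And>i t x. t \<in> {0..T} \<Longrightarrow> \<bar>?d i t x\<bar> \<le> M i * exp (- \<theta> * norm x)"
    by blast
  have "\<bar>ddens t x\<bar> \<le> (\<Sum>i\<in>UNIV. M i) * exp (- \<theta> * norm x)" if "t \<in> {0..T}" for t x
    unfolding ddens_def sum_distrib_right by (rule order_trans[OF sum_abs sum_mono]) (rule M[OF that])
  then show ?thesis by blast
qed

lemma ddens_continuous: "continuous_on UNIV (\<lambda>(t, x). ddens t x)"
  using mean_continuous[OF kernels(3)] mean_continuous[OF kernels(5)]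
  unfolding ddens_def case_prod_beta by (intro continuous_intros) auto

text \<open>The divergence of a rapidly decaying vector field integrates to zero. The field is the
  weighted density times its current, plus the multiplier \<tau> \<open>wt'\<close> v^2 l. Its
  divergence is \<open>wt\<close> v \<open>ddens\<close> plus the expression that
  \<open>energy_pointwise\<close> bounds below by \<open>rate\<close> v^2 \<open>wt\<close>.\<close>

lemma dissipation:
  assumes t: "t \<ge> 0"
  shows "(\<integral>x. wt x * (dens t x * ddens t x + rate * (dens t x)\<^sup>2) \<partial>lborel) \<le> 0"
proof -
  \<comment> \<open>Two factors decaying at rate \<theta> against a weight growing at rate \<theta>
    - 1 leave the rate - \<theta> - 1 seen throughout.\<close>
  define \<theta> where "\<theta> = 2 * lam + 2 * \<delta> + 1"
  have th: "\<theta> > 0" using lam_gt \<delta>_pos by (simp add: \<theta>_def)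
  define v where "v = dens t"
  define v1 where "v1 i = mean (bump1 \<epsilon> i) t" for i
  define v2 where "v2 i = mean (bump2 \<epsilon> i) t" for i
  define c where "c i = mean (\<lambda>x y. bump \<epsilon> x y * b y $ i) t" for i
  define c1 where "c1 i = mean (\<lambda>x y. bump1 \<epsilon> i x y * b y $ i) t" for i
  have ev: "exp_bounded (- \<theta>) v" "exp_bounded (- \<theta>) (v1 i)" "exp_bounded (- \<theta>) (v2 i)"
    "exp_bounded (- \<theta>) (c i)" "exp_bounded (- \<theta>) (c1 i)" for i
    unfolding v_def v1_def v2_def c_def c1_def by (rule mean_exp_bounded[OF _ th t], rule kernels)+
  have dv: "((\<lambda>s. v (x + s *\<^sub>R axis i 1)) has_real_derivative v1 i x) (at 0)"
    and dv1: "((\<lambda>s. v1 i (x + s *\<^sub>R axis i 1)) has_real_derivative v2 i x) (at 0)"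
    and dc: "((\<lambda>s. c i (x + s *\<^sub>R axis i 1)) has_real_derivative c1 i x) (at 0)" for x i
    unfolding v_def v1_def v2_def c_def c1_def
    by (rule mean_directional[OF kernels(1) kernels(2) bump_directional],
        rule mean_directional[OF kernels(2) kernels(3) bump1_directional],
        rule mean_directional[OF kernels(4) kernels(5)], rule DERIV_cmult_right[OF bump_directional])
  define s where "s = lam - \<delta>"
  define \<tau> where "\<tau> = s * exp (- 2 * \<eta>) / 4"
  \<comment> \<open>\<open>W1\<close> and \<open>W2\<close> are the logarithmic derivatives of
    \<open>wt\<close> and \<open>wt'\<close> in direction i.\<close>
  define W1 where "W1 i x = 2 * slope x $ i - 2 * b x $ i" for i x
  define W2 where "W2 i x = 2 * slope x $ i - 4 * G x $ i - 2 * lam * l $ i" for i x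
  define Y where "Y i x = wt x * (v x * ((1/2) * v1 i x - c i x)) + (\<tau> * l $ i) * (wt' x * (v x * v x))" for i x
  define Y' where "Y' i x = wt x * (W1 i x * (v x * ((1/2) * v1 i x - c i x)) + (v1 i x * ((1/2) * v1 i x - c i x) + v x * ((1/2) * v2 i x - c1 i x)))
      + (\<tau> * l $ i) * (wt' x * (W2 i x * (v x * v x) + (v1 i x * v x + v x * v1 i x)))" for i x
  have eW: "exp_bounded 0 (W1 i)" "exp_bounded 0 (W2 i)" for i
    unfolding W1_def W2_def
    by (intro exp_bounded_diff exp_bounded_const exp_bounded_mult[where \<theta>=0 and \<theta>'=0] exp_bounded_drift add_0)+
  have prod: "exp_bounded (- 2 * \<theta>) (\<lambda>x. f x * g x)" if "exp_bounded (- \<theta>) f" "exp_bounded (- \<theta>) g" for f g :: "real^'n \<Rightarrow> real"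
    using that by (rule exp_bounded_mult) simp
  have scal: "exp_bounded a (\<lambda>x. f x * g x)" if "exp_bounded 0 f" "exp_bounded a g" for f g :: "real^'n \<Rightarrow> real" and a
    using that by (rule exp_bounded_mult) simp
  have wtm: "exp_bounded (- \<theta> - 1) (\<lambda>x. wt x * g x)" "exp_bounded (- \<theta> - 1) (\<lambda>x. wt' x * g x)" if "exp_bounded (- 2 * \<theta>) g" for g :: "real^'n \<Rightarrow> real"
    by (rule exp_bounded_mult[OF exp_bounded_wt that] exp_bounded_mult[OF exp_bounded_wt' that], simp add: \<theta>_def)+
  have eY: "exp_bounded (- \<theta> - 1) (Y i)" for i
    unfolding Y_def
    by (intro exp_bounded_add wtm scal[OF exp_bounded_const] prod exp_bounded_diff ev)
  have eY': "exp_bounded (- \<theta> - 1) (Y' i)" for i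
    unfolding Y'_def
    by (intro exp_bounded_add wtm scal[OF exp_bounded_const] scal[OF eW(1)] scal[OF eW(2)] prod exp_bounded_diff ev)
  have dY: "((\<lambda>s. Y i (x + s *\<^sub>R axis i 1)) has_real_derivative Y' i x) (at 0)" for i x
  proof -
    note dw = has_derivative_directional[OF wt_deriv, of x i] has_derivative_directional[OF wt'_deriv, of x i]
    let ?x = "x + 0 *\<^sub>R axis i 1"
    have "((\<lambda>s. Y i (x + s *\<^sub>R axis i 1)) has_real_derivative
      (((wt x *\<^sub>R (2 *\<^sub>R slope x - 2 *\<^sub>R b x)) $ i * (v ?x * ((1/2) * v1 i ?x - c i ?x))
       + (v1 i x * ((1/2) * v1 i ?x - c i ?x) + ((1/2) * v2 i x - c1 i x) * v ?x) * wt ?x)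
      + (\<tau> * l $ i) * ((wt' x *\<^sub>R (2 *\<^sub>R slope x - 4 *\<^sub>R G x - (2 * lam) *\<^sub>R l)) $ i * (v ?x * v ?x)
       + (v1 i x * v ?x + v1 i x * v ?x) * wt' ?x))) (at 0)"
      unfolding Y_def by (intro DERIV_add DERIV_mult DERIV_diff DERIV_cmult dw dv dv1 dc)
    then show ?thesis
      by (rule DERIV_cong) (simp add: Y'_def W1_def W2_def algebra_simps)
  qed
  have iY': "integrable lborel (Y' i)" for i by (rule exp_bounded_integrable[OF eY']) (use th in simp)
  have zero: "(\<integral>x. Y' i x \<partial>lborel) = 0" for i
    by (rule integral_directional_derivative_eq_0[OF _ iY' _ dY])
       (use exp_bounded_integrable[OF eY[of i]] eY'[of i] th in \<open>auto simp: exp_bounded_def\<close>)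
  have pw: "wt x * (v x * ddens t x + rate * (v x)\<^sup>2) \<le> (\<Sum>i\<in>UNIV. Y' i x)" for x
  proof -
    define Dv where "Dv = (\<chi> i. v1 i x)"
    \<comment> \<open>The second derivatives of v combine with the divergence of the flux into
      \<open>ddens\<close>; only first-order terms remain, in the shape of
      \<open>energy_pointwise\<close>.\<close>
    have "(\<Sum>i\<in>UNIV. Y' i x) = wt x * (v x * ddens t x) +
       (wt x * ((Dv - (2 * v x) *\<^sub>R b x + (2 * v x) *\<^sub>R slope x) \<bullet> ((1/2) *\<^sub>R Dv - flux t x))
       + \<tau> * wt' x * (2 * v x * (l \<bullet> Dv) + (v x)\<^sup>2 * (- 4 * (l \<bullet> G x) - 2 * lam * (l \<bullet> l) + 2 * (l \<bullet> slope x))))"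
      unfolding inner_vec_def ddens_def sum_distrib_left sum.distrib[symmetric] sum_subtractf[symmetric]
      by (rule sum.cong) (simp_all add: Y'_def W1_def W2_def Dv_def flux_def v2_def c1_def c_def power2_eq_square algebra_simps)
    moreover have "l \<bullet> l = 1" using l_unit by (simp add: dot_square_norm)
    moreover have "rate * (v x)\<^sup>2 * wt x \<le> wt x * ((Dv - (2 * v x) *\<^sub>R b x + (2 * v x) *\<^sub>R slope x) \<bullet> ((1/2) *\<^sub>R Dv - flux t x))
       + \<tau> * wt' x * (2 * v x * (l \<bullet> Dv) + (v x)\<^sup>2 * (- 4 * (l \<bullet> G x) - 2 * lam + 2 * (l \<bullet> slope x)))"
      unfolding rate_def \<tau>_def s_def[symmetric]
      by (rule energy_pointwise)
         (use flux_commutator[of t x] dens_nonneg[of t x] wt_pos wt'_bounds norm_slope l_unit b_eq lam_gt in \<open>auto simp: v_def s_def\<close>)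
    ultimately show ?thesis by (simp add: algebra_simps)
  qed
  have "(\<integral>x. wt x * (v x * ddens t x + rate * (v x)\<^sup>2) \<partial>lborel) \<le> (\<integral>x. (\<Sum>i\<in>UNIV. Y' i x) \<partial>lborel)"
  proof (rule integral_mono[OF _ _ pw])
    have "exp_bounded (- \<theta>) (ddens t)"
    proof -
      obtain M where "\<forall>s\<in>{0..t}. \<forall>x. \<bar>ddens s x\<bar> \<le> M * exp (- \<theta> * norm x)" using ddens_decay[OF th] by blast
      moreover have "continuous_on UNIV (ddens t)"
        using continuous_on_compose2[OF ddens_continuous continuous_on_Pair[OF continuous_on_const[of UNIV t] continuous_on_id]] by simp
      ultimately show ?thesis using t by (intro exp_boundedI[where M=M]) auto
    qed
    then have "exp_bounded (- \<theta> - 1) (\<lambda>x. wt x * (v x * ddens t x + rate * (v x * v x)))"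
      by (intro exp_bounded_add wtm scal[OF exp_bounded_const] prod ev)
    then show "integrable lborel (\<lambda>x. wt x * (v x * ddens t x + rate * (v x)\<^sup>2))"
      unfolding power2_eq_square by (rule exp_bounded_integrable) (use th in simp)
    show "integrable lborel (\<lambda>x. \<Sum>i\<in>UNIV. Y' i x)" using iY' by (rule Bochner_Integration.integrable_sum)
  qed
  also have "\<dots> = 0" using iY' zero by (simp add: Bochner_Integration.integral_sum)
  finally show ?thesis by (simp add: v_def)
qed

text \<open>Differentiation under the space integral is avoided: the fundamental theorem is applied
  in time to exp (2 rate s) v^2 wt at each fixed x, and Fubini then exposes the dissipation integral
  at each time.\<close>

lemma energy_decay:
  assumes T: "T \<ge> 0"
  shows "integrable lborel (\<lambda>x. (dens T x)\<^sup>2 * wt x)"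
    and "(\<integral>x. (dens T x)\<^sup>2 * wt x \<partial>lborel) \<le> exp (- 2 * rate * T) * (\<integral>x. (dens 0 x)\<^sup>2 * wt x \<partial>lborel)"
proof -
  let ?F = "(\<integral>x. (dens T x)\<^sup>2 * wt x \<partial>lborel)" and ?Finit = "(\<integral>x. (dens 0 x)\<^sup>2 * wt x \<partial>lborel)"
  define \<theta> where "\<theta> = 2 * lam + 2 * \<delta> + 1"
  have th: "\<theta> > 0" using lam_gt \<delta>_pos by (simp add: \<theta>_def)
  have int: "integrable lborel (\<lambda>x. (dens t x)\<^sup>2 * wt x)" if "t \<ge> 0" for t
  proof (rule exp_bounded_integrable)
    show "exp_bounded (- \<theta> - 1) (\<lambda>x. (dens t x)\<^sup>2 * wt x)"
      unfolding power2_eq_square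
      by (rule exp_bounded_mult[OF exp_bounded_mult[OF mean_exp_bounded mean_exp_bounded refl] exp_bounded_wt])
         (use kernels(1) th that in \<open>auto simp: \<theta>_def\<close>)
  qed (use th in simp)
  then show "integrable lborel (\<lambda>x. (dens T x)\<^sup>2 * wt x)" using T by simp
  let ?g = "\<lambda>s x. 2 * exp (2 * rate * s) * (wt x * (dens s x * ddens s x + rate * (dens s x)\<^sup>2))"
  let ?H = "\<lambda>(s, x). ?g s x * indicator {0..T} s"
  have gc: "continuous_on UNIV (\<lambda>p. ?g (fst p) (snd p))"
    using mean_continuous[OF kernels(1)] ddens_continuous unfolding case_prod_beta
    by (intro continuous_intros continuous_on_compose2[OF wt_continuous]) auto
  have ftc: "(\<integral>s. ?H (s, x) \<partial>lborel) = exp (2 * rate * T) * ((dens T x)\<^sup>2 * wt x) - (dens 0 x)\<^sup>2 * wt x" for x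
  proof -
    have "(\<integral>s. indicator {0..T} s *\<^sub>R ?g s x \<partial>lborel) = exp (2 * rate * T) * ((dens T x)\<^sup>2 * wt x) - exp (2 * rate * 0) * ((dens 0 x)\<^sup>2 * wt x)"
    proof (rule integral_FTC_atLeastAtMost[OF T])
      fix s assume "0 \<le> s" "s \<le> T"
      then have "((\<lambda>s. dens s x) has_real_derivative ddens s x) (at s within {0..T})" by (intro dens_deriv) auto
      then have "((\<lambda>s. exp (2 * rate * s) * ((dens s x)\<^sup>2 * wt x)) has_real_derivative ?g s x) (at s within {0..T})"
        by (auto intro!: derivative_eq_intros simp: power2_eq_square algebra_simps)
      then show "((\<lambda>s. exp (2 * rate * s) * ((dens s x)\<^sup>2 * wt x)) has_vector_derivative ?g s x) (at s within {0..T})"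
        by (simp add: has_real_derivative_iff_has_vector_derivative)
    next
      show "continuous_on {0..T} (\<lambda>s. ?g s x)"
        using continuous_on_compose2[OF gc continuous_on_Pair[OF continuous_on_id continuous_on_const[of UNIV x]]]
        by (auto intro: continuous_on_subset)
    qed
    then show ?thesis by (simp add: mult.commute)
  qed
  have Hi: "integrable (lborel \<Otimes>\<^sub>M lborel) ?H"
  proof -
    obtain M N where M: "\<And>s x. s \<in> {0..T} \<Longrightarrow> \<bar>dens s x\<bar> \<le> M * exp (- \<theta> * norm x)"
      and N: "\<And>s x. s \<in> {0..T} \<Longrightarrow> \<bar>ddens s x\<bar> \<le> N * exp (- \<theta> * norm x)"
      using mean_decay[OF kernels(1) th, of T] ddens_decay[OF th, of T] by blast
    \<comment> \<open>Collects the decay constants of \<open>dens\<close> and \<open>ddens\<close>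
      and the growth constant of \<open>wt\<close>. The absolute value of \<open>rate\<close>
      appears because its sign is open at this point.\<close>
    define C where "C = 2 * exp (2 * \<bar>rate\<bar> * T) * (exp (2 * \<eta> + 2 * \<delta>) * (M * N + \<bar>rate\<bar> * (M * M)))"
    have bound: "\<bar>?H (s, x)\<bar> \<le> indicator {0..T} s * (C * exp (- 1 * norm x))" for s x
    proof (cases "s \<in> {0..T}")
      case True
      let ?e = "exp (- \<theta> * norm x)"
      have M0: "0 \<le> M * ?e" "0 \<le> N * ?e" using M[OF True, of x] N[OF True, of x] abs_ge_zero order_trans by blast+
      have "\<bar>dens s x * ddens s x\<bar> \<le> (M * ?e) * (N * ?e)"
        unfolding abs_mult by (intro mult_mono M N True M0 abs_ge_zero)
      moreover have "\<bar>dens s x * dens s x\<bar> \<le> (M * ?e) * (M * ?e)"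
        unfolding abs_mult by (intro mult_mono M True M0 abs_ge_zero)
      then have "\<bar>rate\<bar> * \<bar>dens s x * dens s x\<bar> \<le> \<bar>rate\<bar> * ((M * ?e) * (M * ?e))" by (intro mult_left_mono) auto
      then have "\<bar>rate * (dens s x)\<^sup>2\<bar> \<le> \<bar>rate\<bar> * ((M * ?e) * (M * ?e))" by (simp add: abs_mult power2_eq_square)
      ultimately have A: "\<bar>dens s x * ddens s x + rate * (dens s x)\<^sup>2\<bar> \<le> (M * ?e) * (N * ?e) + \<bar>rate\<bar> * ((M * ?e) * (M * ?e))"
        by (meson abs_triangle_ineq add_mono order_trans)
      have E: "exp (2 * rate * s) \<le> exp (2 * \<bar>rate\<bar> * T)"
        using True by (auto intro!: mult_mono)
      have "\<bar>?H (s, x)\<bar> = (2 * exp (2 * rate * s)) * (wt x * \<bar>dens s x * ddens s x + rate * (dens s x)\<^sup>2\<bar>)"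
        using True wt_pos[of x] by (simp add: abs_mult)
      also have "\<dots> \<le> (2 * exp (2 * \<bar>rate\<bar> * T)) * ((exp (2 * \<eta> + 2 * \<delta>) * exp ((2 * lam + 2 * \<delta>) * norm x)) * ((M * ?e) * (N * ?e) + \<bar>rate\<bar> * ((M * ?e) * (M * ?e))))"
        using E A wt_le[of x] wt_pos[of x] less_imp_le by (intro mult_mono mult_nonneg_nonneg) auto
      also have "\<dots> = C * (exp ((2 * lam + 2 * \<delta>) * norm x) * ?e * ?e)"
        unfolding C_def by (simp add: algebra_simps)
      also have "exp ((2 * lam + 2 * \<delta>) * norm x) * ?e * ?e = exp ((- \<theta> - 1) * norm x)"
        unfolding exp_add[symmetric] by (simp add: \<theta>_def algebra_simps)
      also have "C * exp ((- \<theta> - 1) * norm x) \<le> C * exp (- 1 * norm x)"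
      proof (rule mult_left_mono)
        show "exp ((- \<theta> - 1) * norm x) \<le> exp (- 1 * norm x)" 
          using mult_right_mono[of "- \<theta> - 1" "- 1" "norm x"] th by simp
        have "0 \<le> M" "0 \<le> N" using M0 by (simp_all add: zero_le_mult_iff)
        then show "0 \<le> C" by (simp add: C_def)
      qed
      finally show ?thesis using True by simp
    qed simp
    have meas: "?H \<in> borel_measurable (lborel \<Otimes>\<^sub>M lborel)"
    proof -
      have "(\<lambda>p. ?g (fst p) (snd p)) \<in> borel_measurable borel" using gc by (rule borel_measurable_continuous_onI)
      then have [measurable]: "(\<lambda>p. ?g (fst p) (snd p)) \<in> borel_measurable (lborel \<Otimes>\<^sub>M lborel)"
        by (simp add: lborel_prod)
      show ?thesis unfolding case_prod_beta by measurable
    qed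
    have "integrable (lborel \<Otimes>\<^sub>M lborel) (\<lambda>p. indicator {0..T} (fst p) * (C * exp (- 1 * norm (snd p :: real^'n))))"
    proof (rule lborel_pair.Fubini_integrable)
      show "integrable lborel (\<lambda>s. \<integral>x. norm (indicator {0..T} (fst (s, x)) * (C * exp (- 1 * norm (snd (s, x) :: real^'n)))) \<partial>lborel)"
        using T by (auto simp: abs_mult intro!: integrable_real_indicator)
      show "AE s in lborel. integrable lborel (\<lambda>x. indicator {0..T} (fst (s, x)) * (C * exp (- 1 * norm (snd (s, x) :: real^'n))))"
        unfolding fst_conv snd_conv
        by (intro AE_I2 integrable_mult_right integrable_exp_norm zero_less_one)
    qed measurable
    then show ?thesis
      by (rule Bochner_Integration.integrable_bound[OF _ meas])
         (use bound in \<open>auto intro!: AE_I2 intro: order_trans[OF _ abs_ge_self]\<close>)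
  qed
  have "(\<integral>x. exp (2 * rate * T) * ((dens T x)\<^sup>2 * wt x) - (dens 0 x)\<^sup>2 * wt x \<partial>lborel) = (\<integral>x. (\<integral>s. ?H (s, x) \<partial>lborel) \<partial>lborel)"
    by (simp only: ftc)
  also have "\<dots> = (\<integral>s. (\<integral>x. ?H (s, x) \<partial>lborel) \<partial>lborel)"
    using lborel_pair.Fubini_integral[OF Hi] by simp
  also have "\<dots> \<le> 0"
  proof -
    have "(\<integral>x. ?H (s, x) \<partial>lborel) \<le> 0" for s
    proof (cases "s \<in> {0..T}")
      case True
      then have "(\<integral>x. ?H (s, x) \<partial>lborel) = 2 * exp (2 * rate * s) * (\<integral>x. wt x * (dens s x * ddens s x + rate * (dens s x)\<^sup>2) \<partial>lborel)"
        by simp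
      then show ?thesis using dissipation[of s] True by (simp add: mult_nonneg_nonpos)
    qed simp
    then have "0 \<le> (\<integral>s. - (\<integral>x. ?H (s, x) \<partial>lborel) \<partial>lborel)" by (intro Bochner_Integration.integral_nonneg) auto
    then show ?thesis by simp
  qed
  finally have "exp (2 * rate * T) * ?F \<le> ?Finit"
    using int[OF T] int[OF order_refl] by simp
  then have "exp (- (2 * rate * T)) * (exp (2 * rate * T) * ?F) \<le> exp (- (2 * rate * T)) * ?Finit"
    by (rule mult_left_mono) simp
  then show "?F \<le> exp (- 2 * rate * T) * ?Finit"
    by (simp add: exp_minus field_simps)
qed

end

section \<open>From energy decay to exponential moments\<close>

lemma bump_translate: "bump \<epsilon> x y = bump \<epsilon> (x - y) 0"
  by (simp add: bump_def)

lemma bump_measurable: "(\<lambda>p. bump \<epsilon> (fst p) (snd p)) \<in> borel_measurable (borel \<Otimes>\<^sub>M (borel :: (real^'n::finite) measure))"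
  unfolding borel_prod bump_def by (intro borel_measurable_continuous_onI continuous_intros)

definition bump_mass :: "'n::finite itself \<Rightarrow> real \<Rightarrow> real" where
  "bump_mass _ \<epsilon> = (\<integral>x. bump \<epsilon> x (0::real^'n) \<partial>lborel)"

lemma bump_power_integrable:
  assumes e: "\<epsilon> > 0" and n: "n > 0"
  shows "integrable lborel (\<lambda>x. (bump \<epsilon> x (0::real^'n::finite)) ^ n * exp (\<theta> * norm x))"
proof -
  have meas: "(\<lambda>x. (bump \<epsilon> x (0::real^'n)) ^ n * exp (\<theta> * norm x)) \<in> borel_measurable borel"
    unfolding bump_def by (intro borel_measurable_continuous_onI continuous_intros)
  obtain C where C: "\<And>x y::real^'n. \<bar>bump \<epsilon> x y\<bar> \<le> C" and z: "\<And>x y::real^'n. norm (x - y) > \<epsilon> \<Longrightarrow> bump \<epsilon> x y = 0"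
    using local_kernel_bump(1)[OF e] unfolding local_kernel_def by blast
  have "\<bar>(bump \<epsilon> x (0::real^'n)) ^ n * exp (\<theta> * norm x)\<bar> \<le> (C ^ n * exp ((\<bar>\<theta>\<bar> + 1) * \<epsilon>)) * exp (- 1 * norm x)" for x
  proof (cases "norm x > \<epsilon>")
    case True
    have "0 \<le> C" using C abs_ge_zero order_trans by blast
    then show ?thesis using z[of x 0] True n by (simp add: zero_power)
  next
    case False
    have "\<theta> * norm x + norm x \<le> (\<bar>\<theta>\<bar> + 1) * norm x" unfolding distrib_right by (simp add: mult_right_mono)
    also have "\<dots> \<le> (\<bar>\<theta>\<bar> + 1) * \<epsilon>" using False by (intro mult_left_mono) auto
    finally have "exp (\<theta> * norm x) \<le> exp ((\<bar>\<theta>\<bar> + 1) * \<epsilon> + - 1 * norm x)" by simp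
    moreover have "\<bar>bump \<epsilon> x 0\<bar> ^ n \<le> C ^ n" using C by (intro power_mono) auto
    ultimately have "\<bar>bump \<epsilon> x 0\<bar> ^ n * exp (\<theta> * norm x) \<le> C ^ n * exp ((\<bar>\<theta>\<bar> + 1) * \<epsilon> + - 1 * norm x)"
      by (intro mult_mono) (auto intro: order_trans[OF zero_le_power[OF abs_ge_zero]])
    then show ?thesis by (simp only: abs_mult power_abs exp_add abs_exp_cancel mult.assoc)
  qed
  from integrable_exp_norm_bound[OF meas zero_less_one this] show ?thesis .
qed

lemma bump_mass_pos:
  assumes e: "\<epsilon> > 0"
  shows "bump_mass TYPE('n::finite) \<epsilon> > 0"
proof -
  \<comment> \<open>The minimum of the bump on the ball of half the radius, since \<epsilon>^2 -
    (\<epsilon> / 2)^2 = 3 \<epsilon>^2 / 4.\<close>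
  let ?c = "(3 * \<epsilon>\<^sup>2 / 4) ^ 3"
  have i: "integrable lborel (\<lambda>x. bump \<epsilon> x (0::real^'n))" using bump_power_integrable[OF e zero_less_one, of 0] by simp
  have "0 < ?c * measure lborel (ball (0::real^'n) (\<epsilon> / 2))"
    using e content_ball_pos[of "\<epsilon> / 2" "0::real^'n"] by simp
  also have "\<dots> = (\<integral>x. ?c * indicator (ball (0::real^'n) (\<epsilon> / 2)) x \<partial>lborel)" by simp
  also have "\<dots> \<le> (\<integral>x. bump \<epsilon> x (0::real^'n) \<partial>lborel)"
  proof (rule integral_mono)
    show "integrable lborel (\<lambda>x. ?c * indicator (ball (0::real^'n) (\<epsilon> / 2)) x)"
      by (intro integrable_mult_right integrable_real_indicator) (auto simp: emeasure_bounded_finite[OF bounded_ball, unfolded infinity_ennreal_def])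
    show "?c * indicator (ball (0::real^'n) (\<epsilon> / 2)) x \<le> bump \<epsilon> x 0" for x
    proof (cases "norm x < \<epsilon> / 2")
      case True
      then have "(norm x)\<^sup>2 \<le> (\<epsilon> / 2)\<^sup>2" by (intro power_mono) auto
      then have "3 * \<epsilon>\<^sup>2 / 4 \<le> max 0 (\<epsilon>\<^sup>2 - (norm (x - 0))\<^sup>2)" 
        by (simp add: power_divide le_max_iff_disj)
      then have "?c \<le> bump \<epsilon> x 0" unfolding bump_def by (intro power_mono) auto
      then show ?thesis using True by (simp add: indicator_def)
    next
      case False
      then show ?thesis by (simp add: indicator_def bump_def)
    qed
  qed (rule i)
  finally show ?thesis by (simp add: bump_mass_def)
qed

text \<open>Kept outside the locale so that its dependence on numbers alone is visible. The bracket,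
  halved, comes from 2 x y \<le> x^2 + y^2: a bound for the initial energy plus the integral of the
  squared test exponential over the weight. The prefactor undoes the mollification.\<close>

definition decay_const :: "'n::finite itself \<Rightarrow> real \<Rightarrow> real \<Rightarrow> real \<Rightarrow> real \<Rightarrow> real" where
  "decay_const _ lam \<eta> \<epsilon> \<delta> = exp (lam * \<epsilon>) / bump_mass TYPE('n) \<epsilon> *
     (exp (2 * \<eta> + 2 * \<delta>) * (\<integral>x. (bump \<epsilon> x (0::real^'n))\<^sup>2 * exp ((2 * lam + 2 * \<delta>) * norm x) \<partial>lborel)
      + exp (2 * \<eta>) * (\<integral>x. exp (- \<delta> * norm (x::real^'n)) \<partial>lborel)) / 2"

context gradient_diffusion
begin

text \<open>The process starts at 0, so the mollified density at time 0 is the bump itself and has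
  finite energy.\<close>

lemma initial_energy:
  "(\<integral>x. (dens 0 x)\<^sup>2 * wt x \<partial>lborel) \<le>
     exp (2 * \<eta> + 2 * \<delta>) * (\<integral>x. (bump \<epsilon> x (0::real^'n))\<^sup>2 * exp ((2 * lam + 2 * \<delta>) * norm x) \<partial>lborel)"
proof -
  have d0: "dens 0 x = bump \<epsilon> x 0" for x
  proof -
    have "(\<integral>w. bump \<epsilon> x (w 0) \<partial>P) = (\<integral>w. bump \<epsilon> x 0 \<partial>P)"
      by (rule integral_cong_AE) (use local_kernel_measurable[OF kernels(1)] start_P in \<open>auto elim: eventually_mono\<close>)
    then show ?thesis by (simp add: mean_eq prob_space)
  qed
  let ?k = "\<lambda>x. (bump \<epsilon> x (0::real^'n))\<^sup>2 * exp ((2 * lam + 2 * \<delta>) * norm x)"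
  have "(\<integral>x. (dens 0 x)\<^sup>2 * wt x \<partial>lborel) \<le> (\<integral>x. exp (2 * \<eta> + 2 * \<delta>) * (?k x) \<partial>lborel)"
  proof (rule integral_mono)
    show "integrable lborel (\<lambda>x. (dens 0 x)\<^sup>2 * wt x)" by (rule energy_decay(1)) simp
    show "integrable lborel (\<lambda>x. exp (2 * \<eta> + 2 * \<delta>) * (?k x))"
      by (intro integrable_mult_right bump_power_integrable \<epsilon>_pos) simp
    show "(dens 0 x)\<^sup>2 * wt x \<le> exp (2 * \<eta> + 2 * \<delta>) * (?k x)" for x
      using mult_left_mono[OF wt_le[of x], of "(bump \<epsilon> x 0)\<^sup>2"] by (simp add: d0 mult_ac)
  qed
  then show ?thesis by simp
qed

text \<open>Averaging exp (- lam (l' . x)) over the bump around y loses at most a factor exp (- lam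
  \<epsilon>) times the mass, so the moment is controlled by the integral of this exponential
  against \<open>dens\<close>. Cauchy-Schwarz with the weight \<open>wt\<close> then brings in the
  energy.\<close>

lemma moment_decay:
  assumes l': "norm l' = 1" "2 * lam * norm (l - l') \<le> \<delta>" and t: "t \<ge> 0"
  shows "(\<integral>\<^sup>+w. ennreal (exp (- lam * (l' \<bullet> w t))) \<partial>P) \<le> ennreal (decay_const TYPE('n) lam \<eta> \<epsilon> \<delta> * exp (- rate * t))"
proof -
  have lam0: "lam > 0" using lam_gt \<delta>_pos by simp
  define u where "u x = exp (- lam * (l' \<bullet> x))" for x
  let ?h = "\<lambda>x. 1/2 * (exp (rate * t) * ((dens t x)\<^sup>2 * wt x) + exp (- rate * t) * (exp (2 * \<eta>) * exp (- \<delta> * norm x)))"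
  define I0 where "I0 = (\<integral>x. (bump \<epsilon> x (0::real^'n))\<^sup>2 * exp ((2 * lam + 2 * \<delta>) * norm x) \<partial>lborel)"
  define I1 where "I1 = (\<integral>x. exp (- \<delta> * norm (x::real^'n)) \<partial>lborel)"
  let ?r = "(exp (2 * \<eta> + 2 * \<delta>) * I0 + exp (2 * \<eta>) * I1) / 2 * exp (- rate * t)"
  define m where "m = bump_mass TYPE('n) \<epsilon>"
  have m: "m > 0" unfolding m_def by (rule bump_mass_pos[OF \<epsilon>_pos])
  have [measurable]: "u \<in> borel_measurable borel" unfolding u_def by measurable
  have bm [measurable]: "(\<lambda>p. bump \<epsilon> (snd p) (fst p t)) \<in> borel_measurable (P \<Otimes>\<^sub>M (lborel :: (real^'n) measure))"
    using measurable_compose[OF _ bump_measurable, of "\<lambda>p. (snd p, fst p t)" "P \<Otimes>\<^sub>M (lborel :: (real^'n) measure)"] by simp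
  have bmx [measurable]: "(\<lambda>x. bump \<epsilon> x y) \<in> borel_measurable borel" for y :: "real^'n"
    unfolding bump_def by (intro borel_measurable_continuous_onI continuous_intros)
  have dm [measurable]: "dens t \<in> borel_measurable borel"
    by (rule borel_measurable_continuous_onI[OF mean_continuous_space[OF kernels(1)]])
  interpret pair_sigma_finite P lborel ..
  have mass: "(\<integral>\<^sup>+x. ennreal (bump \<epsilon> x y) \<partial>lborel) = ennreal m" for y :: "real^'n"
  proof -
    have "(\<integral>\<^sup>+x. ennreal (bump \<epsilon> x y) \<partial>lborel) = (\<integral>\<^sup>+x. ennreal (bump \<epsilon> (x + (- y)) 0) \<partial>lborel)"
      by (subst bump_translate) simp
    also have "\<dots> = (\<integral>\<^sup>+x. ennreal (bump \<epsilon> x (0::real^'n)) \<partial>lborel)"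
      by (rule nn_integral_lborel_translate) measurable
    also have "\<dots> = ennreal m"
      unfolding m_def bump_mass_def
      using bump_power_integrable[OF \<epsilon>_pos zero_less_one, of 0] bump_nonneg by (intro nn_integral_eq_integral) auto
    finally show ?thesis .
  qed
  have low: "ennreal (exp (- lam * \<epsilon>) * u y) * ennreal m \<le> (\<integral>\<^sup>+x. ennreal (bump \<epsilon> x y) * ennreal (u x) \<partial>lborel)" for y
  proof -
    have "ennreal (exp (- lam * \<epsilon>) * u y) * ennreal m = (\<integral>\<^sup>+x. ennreal (exp (- lam * \<epsilon>) * u y) * ennreal (bump \<epsilon> x y) \<partial>lborel)"
      by (subst nn_integral_cmult) (auto simp: mass)
    also have "\<dots> \<le> (\<integral>\<^sup>+x. ennreal (bump \<epsilon> x y) * ennreal (u x) \<partial>lborel)"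
    proof (rule nn_integral_mono)
      fix x
      show "ennreal (exp (- lam * \<epsilon>) * u y) * ennreal (bump \<epsilon> x y) \<le> ennreal (bump \<epsilon> x y) * ennreal (u x)"
      proof (cases "norm (x - y) > \<epsilon>")
        case True
        then have "bump \<epsilon> x y = 0" using kernels(1) unfolding local_kernel_def by blast
        then show ?thesis by simp
      next
        case False
        have "l' \<bullet> x - l' \<bullet> y \<le> norm l' * norm (x - y)" unfolding inner_diff_right[symmetric] by (rule norm_cauchy_schwarz)
        then have "l' \<bullet> x - l' \<bullet> y \<le> \<epsilon>" using False l' by simp
        then have "lam * (l' \<bullet> x - l' \<bullet> y) \<le> lam * \<epsilon>" using lam0 by (intro mult_left_mono) auto
        then have "exp (- lam * \<epsilon>) * u y \<le> u x" unfolding u_def exp_add[symmetric] by (simp add: algebra_simps)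
        then show ?thesis by (subst mult.commute) (intro mult_left_mono ennreal_leI, auto)
      qed
    qed
    finally show ?thesis .
  qed
  let ?u = "(\<integral>\<^sup>+w. ennreal (u (w t)) \<partial>P)"
  have "?u * ennreal (exp (- lam * \<epsilon>) * m) = (\<integral>\<^sup>+w. ennreal (exp (- lam * \<epsilon>) * u (w t)) * ennreal m \<partial>P)"
    using m by (subst nn_integral_multc[symmetric]) (auto simp: ennreal_mult[symmetric] u_def mult_ac)
  also have "\<dots> \<le> (\<integral>\<^sup>+w. (\<integral>\<^sup>+x. ennreal (bump \<epsilon> x (w t)) * ennreal (u x) \<partial>lborel) \<partial>P)"
    by (intro nn_integral_mono low)
  also have "\<dots> = (\<integral>\<^sup>+x. (\<integral>\<^sup>+w. ennreal (bump \<epsilon> x (w t)) * ennreal (u x) \<partial>P) \<partial>lborel)"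
    using Fubini'[of "\<lambda>w x. ennreal (bump \<epsilon> x (w t)) * ennreal (u x)"] by (simp add: case_prod_beta)
  also have "\<dots> = (\<integral>\<^sup>+x. ennreal (dens t x * u x) \<partial>lborel)"
  proof (rule nn_integral_cong)
    fix x
    have "(\<integral>\<^sup>+w. ennreal (bump \<epsilon> x (w t)) * ennreal (u x) \<partial>P) = (\<integral>\<^sup>+w. ennreal (bump \<epsilon> x (w t)) \<partial>P) * ennreal (u x)"
      using local_kernel_measurable[OF kernels(1)] by (intro nn_integral_multc) auto
    also have "(\<integral>\<^sup>+w. ennreal (bump \<epsilon> x (w t)) \<partial>P) = ennreal (dens t x)"
      unfolding mean_eq using local_kernel_integrable[OF kernels(1)] bump_nonneg by (intro nn_integral_eq_integral AE_I2) auto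
    finally show "(\<integral>\<^sup>+w. ennreal (bump \<epsilon> x (w t)) * ennreal (u x) \<partial>P) = ennreal (dens t x * u x)"
      by (simp add: ennreal_mult dens_nonneg u_def)
  qed
  also have "\<dots> \<le> (\<integral>\<^sup>+x. ennreal (?h x) \<partial>lborel)"
  proof (rule nn_integral_mono, rule ennreal_leI)
    fix x
    \<comment> \<open>The factor exp (rate t) balances the two halves: the energy decays like exp
      (-2 rate t), so both terms end up of order exp (- rate t).\<close>
    define A where "A = exp (rate * t) * wt x"
    have A: "A > 0" using wt_pos[of x] by (simp add: A_def)
    have "0 \<le> (A * dens t x - u x)\<^sup>2 / A" using A by simp
    also have "(A * dens t x - u x)\<^sup>2 / A = A * (dens t x)\<^sup>2 - 2 * (dens t x * u x) + (u x)\<^sup>2 / A"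
      using A by (simp add: power2_eq_square field_simps)
    finally have 1: "2 * (dens t x * u x) \<le> A * (dens t x)\<^sup>2 + (u x)\<^sup>2 / A" by simp
    \<comment> \<open>The weight contributes decay at rate 2 \<delta>. Tilting l to l' costs at most
      rate \<delta>, which leaves the integrable factor exp (- \<delta> |x|).\<close>
    have "(u x)\<^sup>2 / wt x \<le> exp (2 * \<eta>) * exp (- \<delta> * norm x)"
    proof -
      have "(l - l') \<bullet> x \<le> norm (l - l') * norm x" by (rule norm_cauchy_schwarz)
      then have "2 * lam * ((l - l') \<bullet> x) \<le> 2 * lam * (norm (l - l') * norm x)" using lam0 by simp
      also have "\<dots> \<le> \<delta> * norm x" using mult_right_mono[OF l'(2) norm_ge_zero[of x]] by (simp add: mult.assoc)
      finally have "2 * lam * (l \<bullet> x) - 2 * lam * (l' \<bullet> x) \<le> \<delta> * norm x" by (simp add: inner_diff_left algebra_simps)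
      moreover have "norm x \<le> sqrt (1 + (norm x)\<^sup>2)" by (rule real_le_rsqrt) simp
      then have "\<delta> * norm x \<le> \<delta> * sqrt (1 + (norm x)\<^sup>2)" using \<delta>_pos by simp
      moreover have "\<phi> x \<le> \<eta>" using \<phi>_bound[of x] by simp
      ultimately have "- lam * (l' \<bullet> x) + - lam * (l' \<bullet> x) - (- 2 * \<phi> x - 2 * lam * (l \<bullet> x) + 2 * \<delta> * sqrt (1 + (norm x)\<^sup>2))
          \<le> 2 * \<eta> + - \<delta> * norm x" by linarith
      then show ?thesis unfolding u_def wt_def power2_eq_square exp_add[symmetric] exp_diff[symmetric] by simp
    qed
    then have "exp (- rate * t) * ((u x)\<^sup>2 / wt x) \<le> exp (- rate * t) * (exp (2 * \<eta>) * exp (- \<delta> * norm x))"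
      by (intro mult_left_mono) auto
    moreover have "exp (- rate * t) * ((u x)\<^sup>2 / wt x) = (u x)\<^sup>2 / A" by (simp add: A_def exp_minus field_simps)
    ultimately show "dens t x * u x \<le> ?h x"
      using 1 by (simp add: A_def mult_ac)
  qed
  also have "\<dots> = ennreal (\<integral>x. ?h x \<partial>lborel)"
    using energy_decay(1)[OF t] integrable_exp_norm[OF \<delta>_pos] wt_pos less_imp_le
    by (intro nn_integral_eq_integral) (auto intro!: AE_I2 add_nonneg_nonneg mult_nonneg_nonneg Bochner_Integration.integrable_add integrable_mult_right)
  also have "\<dots> \<le> ennreal (?r)"
  proof (rule ennreal_leI)
    have "(\<integral>x. ?h x \<partial>lborel)
       = 1/2 * (exp (rate * t) * (\<integral>x. (dens t x)\<^sup>2 * wt x \<partial>lborel) + exp (- rate * t) * (exp (2 * \<eta>) * I1))"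
      unfolding I1_def using energy_decay(1)[OF t] integrable_exp_norm[OF \<delta>_pos, where 'a="real^'n"] by simp
    also have "exp (rate * t) * (\<integral>x. (dens t x)\<^sup>2 * wt x \<partial>lborel) \<le> exp (rate * t) * (exp (- 2 * rate * t) * (exp (2 * \<eta> + 2 * \<delta>) * I0))"
      using order_trans[OF energy_decay(2)[OF t] mult_left_mono[OF initial_energy]] unfolding I0_def by (intro mult_left_mono) auto
    also have "\<dots> = exp (- rate * t) * (exp (2 * \<eta> + 2 * \<delta>) * I0)"
      by (simp add: mult.assoc[symmetric] exp_add[symmetric])
    finally show "(\<integral>x. ?h x \<partial>lborel)
       \<le> ?r"
      by (simp add: algebra_simps)
  qed
  finally have "?u * ennreal (exp (- lam * \<epsilon>) * m) \<le> ennreal (?r)" .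
  then have "?u * ennreal (exp (- lam * \<epsilon>) * m) * ennreal (exp (lam * \<epsilon>) / m)
     \<le> ennreal (?r) * ennreal (exp (lam * \<epsilon>) / m)"
    by (rule mult_right_mono) simp
  moreover have "ennreal (exp (- lam * \<epsilon>) * m) * ennreal (exp (lam * \<epsilon>) / m) = 1"
    using m by (simp add: ennreal_mult[symmetric] exp_minus field_simps)
  moreover have "0 \<le> I0" "0 \<le> I1" unfolding I0_def I1_def by (auto intro!: Bochner_Integration.integral_nonneg)
  then have "ennreal (?r) * ennreal (exp (lam * \<epsilon>) / m)
      = ennreal (decay_const TYPE('n) lam \<eta> \<epsilon> \<delta> * exp (- rate * t))"
    using m unfolding decay_const_def m_def[symmetric] I0_def[symmetric] I1_def[symmetric]
    by (subst ennreal_mult[symmetric]) (auto simp: mult_ac)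
  ultimately show ?thesis by (simp add: mult.assoc u_def)
qed

end

subsection \<open>The maximal inequality\<close>

context diffusion_law
begin

text \<open>The compactly supported cutoffs of \<open>exp (- lam (l \<bullet> x))\<close> are submartingales, after multiplication
  by \<open>exp (C t)\<close>, with \<open>C\<close> independent of the cutoff: close to the boundary of the support the
  second-order term dominates.\<close>

lemma grid_maximal_inequality:
  fixes l :: "real^'n" and \<tau> :: "nat \<Rightarrow> real"
  assumes l: "norm l = 1" and lam: "lam > 0" and \<tau>: "\<And>k. k \<le> m \<Longrightarrow> 0 \<le> \<tau> k \<and> \<tau> k \<le> T \<and> T - 1 \<le> \<tau> k"
    and mono: "\<And>j k. j \<le> k \<Longrightarrow> \<tau> j \<le> \<tau> k"
  defines "c \<equiv> 3 * lam + 3/2 + 3 * B"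
  defines "C \<equiv> c + c\<^sup>2 * real CARD('n) + B * lam"
  shows "emeasure P {w\<in>space P. \<exists>k\<le>m. w (\<tau> k) \<bullet> l < - a}
     \<le> ennreal (exp (C - lam * a)) * (\<integral>\<^sup>+w. ennreal (exp (- lam * (l \<bullet> w T))) \<partial>P)"
proof -
  \<comment> \<open>Decomposition by the first grid time below the level; the event for index k
    depends on the path up to \<tau> k only.\<close>
  define A where "A k = {w\<in>paths. w (\<tau> k) \<bullet> l < - a \<and> (\<forall>j<k. \<not> w (\<tau> j) \<bullet> l < - a)}" for k
  have C0: "0 \<le> C" using B_nonneg lam by (auto simp: C_def c_def intro!: add_nonneg_nonneg)
  have A: "A k \<in> sets (filt (\<tau> k))" if k: "k \<le> m" for k
  proof -
    have [measurable]: "(\<lambda>w :: real \<Rightarrow> real^'n. w (\<tau> j)) \<in> borel_measurable (filt (\<tau> k))" if "j \<le> k" for j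
      using \<tau>[of j] mono[OF that] that k by (intro coordinate_measurable_filt) auto
    have "A k = {w\<in>space (filt (\<tau> k)). w (\<tau> k) \<bullet> l < - a} - (\<Union>j\<in>{..<k}. {w\<in>space (filt (\<tau> k)). w (\<tau> j) \<bullet> l < - a})"
      by (auto simp: A_def)
    moreover have "{w\<in>space (filt (\<tau> k)). w (\<tau> j) \<bullet> l < - a} \<in> sets (filt (\<tau> k))" if "j \<le> k" for j
      using that by measurable
    ultimately show ?thesis by auto
  qed
  have AP: "A k \<in> sets P" if "k \<le> m" for k using A[OF that] by (rule filt_sets_P)
  let ?J = "\<lambda>k. (\<integral>\<^sup>+w. ennreal (exp (- lam * (l \<bullet> w T))) * indicator (A k) w \<partial>P)"
  have single: "ennreal (exp (lam * a)) * emeasure P (A k) \<le> ennreal (exp C) * (?J k)"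
    if k: "k \<le> m" for k
  proof -
    note [measurable] = AP[OF k]
    define p where "p N x = (max 0 (1 - cosh_sum 1 x / real N)) ^ 3" for N and x :: "real^'n"
    have p01: "0 \<le> p N x" "p N x \<le> 1" for N x
      using cosh_sum_nonneg[of 1 x] by (auto simp: p_def intro!: power_le_one)
    have [measurable]: "p N \<in> borel_measurable borel" for N unfolding p_def by measurable
    have intp: "integrable P (\<lambda>w. indicator (A k) w * p N (w (\<tau> k)))" for N
      by (rule integrable_const_bound[where B=1]) (use p01 in \<open>auto simp: indicator_def\<close>)
    let ?p = "\<lambda>N. (\<integral>w. indicator (A k) w * p N (w (\<tau> k)) \<partial>P)"
    have bound: "ennreal (exp (lam * a)) * ennreal (?p N)
        \<le> ennreal (exp C) * (?J k)"
      if N: "real N \<ge> 6 * real CARD('n)" for N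
    proof -
      \<comment> \<open>The third of lam undoes the cube in \<open>exp_cutoff\<close>; it also turns
        9 \<alpha> and 3 B \<alpha> into the 3 lam and B lam of the constants.\<close>
      define f where "f = exp_cutoff (- (lam / 3) *\<^sub>R l) 1 (real N)"
      let ?fT = "(\<integral>w. indicator (A k) w * f (w T) \<partial>P)"
      have N0: "real N > 0" using N by (metis less_le_trans mult_pos_pos of_nat_0_less_iff zero_less_card_finite zero_less_numeral)
      have f: "testfun f" unfolding f_def using N0 by (rule exp_cutoff_testfun) simp
      have fx: "f x = exp (- lam * (l \<bullet> x)) * p N x" for x
      proof -
        have "exp ((- (lam / 3) *\<^sub>R l) \<bullet> x) ^ 3 = exp (- lam * (l \<bullet> x))"
          unfolding exp_of_nat_mult[symmetric] by simp
        then show ?thesis by (simp add: f_def exp_cutoff_eq p_def)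
      qed
      have f0: "0 \<le> f x" for x unfolding fx using p01 by simp
      have na: "norm (- (lam / 3) *\<^sub>R l) \<le> lam / 3" using l lam by simp
      have "- gen b f x \<le> C * f x" for x
        using exp_cutoff_gen_submartingale[of b x B "real N" "- (lam / 3) *\<^sub>R l" "lam / 3", OF b_bounded N na]
        by (simp add: f_def C_def c_def)
      \<comment> \<open>Cast as a comparison with level 0 and constant - C, so that Gronwall bounds
        the expectation at T from below by the one at \<tau> k. Since T - \<tau> k \<le> 1, the loss
        is at most exp C.\<close>
      then have "- gen b f x \<le> - C * (0 - f x)" for x by simp
      from dynkin_compare[OF f _ _ A[OF k] this, of T]
      have "(\<integral>w. indicator (A k) w * (0 - f (w T)) \<partial>P) \<le> exp (- C * (T - \<tau> k)) * (\<integral>w. indicator (A k) w * (0 - f (w (\<tau> k))) \<partial>P)"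
        using \<tau>[OF k] by simp
      then have "exp (- C * (T - \<tau> k)) * (\<integral>w. indicator (A k) w * f (w (\<tau> k)) \<partial>P) \<le> ?fT" by simp
      then have "exp (C * (T - \<tau> k)) * (exp (- C * (T - \<tau> k)) * (\<integral>w. indicator (A k) w * f (w (\<tau> k)) \<partial>P)) \<le> exp (C * (T - \<tau> k)) * ?fT"
        by (rule mult_left_mono) simp
      then have "(\<integral>w. indicator (A k) w * f (w (\<tau> k)) \<partial>P) \<le> exp (C * (T - \<tau> k)) * ?fT"
        by (simp add: mult.assoc[symmetric] exp_add[symmetric])
      also have "\<dots> \<le> exp C * ?fT"
      proof (rule mult_right_mono)
        have "C * (T - \<tau> k) \<le> C * 1" using \<tau>[OF k] C0 by (intro mult_left_mono) auto
        then show "exp (C * (T - \<tau> k)) \<le> exp C" by simp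
        show "0 \<le> ?fT" using f0 by (intro Bochner_Integration.integral_nonneg) auto
      qed
      finally have 1: "(\<integral>w. indicator (A k) w * f (w (\<tau> k)) \<partial>P) \<le> exp C * ?fT" .
      have "exp (lam * a) * (?p N) = (\<integral>w. exp (lam * a) * (indicator (A k) w * p N (w (\<tau> k))) \<partial>P)" by simp
      also have "\<dots> \<le> (\<integral>w. indicator (A k) w * f (w (\<tau> k)) \<partial>P)"
      proof (rule integral_mono)
        show "integrable P (\<lambda>w. exp (lam * a) * (indicator (A k) w * p N (w (\<tau> k))))" using intp by simp
        show "integrable P (\<lambda>w. indicator (A k) w * f (w (\<tau> k)))" by (rule testfun_integrable(1)[OF f AP[OF k]])
        show "exp (lam * a) * (indicator (A k) w * p N (w (\<tau> k))) \<le> indicator (A k) w * f (w (\<tau> k))" for w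
        proof (cases "w \<in> A k")
          case True
          then have "l \<bullet> w (\<tau> k) \<le> - a" by (simp add: A_def inner_commute)
          then have "lam * (l \<bullet> w (\<tau> k)) \<le> lam * (- a)" using lam by (intro mult_left_mono) auto
          then show ?thesis using True p01 by (simp add: fx mult_right_mono)
        qed simp
      qed
      finally have "ennreal (exp (lam * a) * (?p N)) \<le> ennreal (exp C * ?fT)"
        using 1 by (intro ennreal_leI) linarith
      also have "\<dots> = ennreal (exp C) * ennreal ?fT"
        by (rule ennreal_mult) (use f0 in \<open>auto intro!: Bochner_Integration.integral_nonneg\<close>)
      also have "ennreal ?fT = (\<integral>\<^sup>+w. ennreal (indicator (A k) w * f (w T)) \<partial>P)"
        using testfun_integrable(1)[OF f AP[OF k]] f0 by (intro nn_integral_eq_integral[symmetric]) auto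
      also have "\<dots> \<le> (?J k)"
        using p01 by (intro nn_integral_mono) (auto simp: indicator_def fx intro!: ennreal_leI mult_left_le)
      finally show ?thesis
        using p01 by (simp add: ennreal_mult' mult_left_mono)
    qed
    \<comment> \<open>Only the left side needs the limit; on the right the cutoff was already
      bounded by 1.\<close>
    have "(\<lambda>N. \<integral>w. indicator (A k) w * p N (w (\<tau> k)) \<partial>P) \<longlonglongrightarrow> (\<integral>w. indicator (A k) w * 1 \<partial>P)"
    proof (rule integral_dominated_convergence[where w="\<lambda>_. 1"])
      show "AE w in P. (\<lambda>N. indicator (A k) w * p N (w (\<tau> k))) \<longlonglongrightarrow> indicator (A k) w * 1"
      proof (rule AE_I2)
        fix w :: "real \<Rightarrow> real^'n"
        have "(\<lambda>N. (max 0 (1 - cosh_sum 1 (w (\<tau> k)) / real N)) ^ 3) \<longlonglongrightarrow> (max 0 (1 - 0)) ^ 3"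
          by (intro tendsto_intros lim_const_over_n)
        then show "(\<lambda>N. indicator (A k) w * p N (w (\<tau> k))) \<longlonglongrightarrow> indicator (A k) w * 1"
          unfolding p_def by (intro tendsto_mult_left) simp
      qed
    qed (use p01 in \<open>auto simp: indicator_def\<close>)
    then have lim: "(\<lambda>N. ennreal (exp (lam * a)) * ennreal (?p N)) \<longlonglongrightarrow> ennreal (exp (lam * a)) * ennreal (prob (A k))"
      using AP[OF k] by (intro ennreal_tendsto_cmult tendsto_ennrealI) auto
    have "ennreal (exp (lam * a)) * ennreal (prob (A k)) \<le> ennreal (exp C) * (?J k)"
    proof (rule tendsto_upperbound[OF lim])
      obtain N0 where "6 * real CARD('n) \<le> real N0" using real_arch_simple by blast
      then show "\<forall>\<^sub>F N in sequentially. ennreal (exp (lam * a)) * ennreal (?p N)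
         \<le> ennreal (exp C) * (?J k)"
        by (intro eventually_sequentiallyI[of N0] bound) auto
    qed simp
    then show ?thesis by (simp add: emeasure_eq_measure)
  qed
  let ?U = "{w\<in>space P. \<exists>k\<le>m. w (\<tau> k) \<bullet> l < - a}"
  \<comment> \<open>Disjointness makes the restricted integrals add up to at most one full integral,
    so the bound does not grow with the number of grid points.\<close>
  have disj: "disjoint_family_on A {..m}"
    unfolding disjoint_family_on_def A_def by (auto, metis linorder_neqE_nat)
  have un: "?U = (\<Union>k\<in>{..m}. A k)"
  proof (intro set_eqI iffI)
    fix w assume w: "w \<in> ?U"
    define k where "k = (LEAST k. w (\<tau> k) \<bullet> l < - a)"
    obtain k0 where k0: "k0 \<le> m" "w (\<tau> k0) \<bullet> l < - a" using w by blast
    have "w (\<tau> k) \<bullet> l < - a" unfolding k_def using k0(2) by (rule LeastI)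
    moreover have "k \<le> k0" unfolding k_def using k0(2) by (rule Least_le)
    moreover have "\<forall>j<k. \<not> w (\<tau> j) \<bullet> l < - a" unfolding k_def using not_less_Least by blast
    ultimately show "w \<in> (\<Union>k\<in>{..m}. A k)" using w k0 by (auto simp: A_def space_P)
  qed (auto simp: A_def space_P)
  have "ennreal (exp (lam * a)) * emeasure P ?U = (\<Sum>k\<in>{..m}. ennreal (exp (lam * a)) * emeasure P (A k))"
    unfolding un using AP disj by (subst sum_emeasure[symmetric]) (auto simp: sum_distrib_left)
  also have "\<dots> \<le> (\<Sum>k\<in>{..m}. ennreal (exp C) * (?J k))"
    by (intro sum_mono single) auto
  also have "\<dots> = ennreal (exp C) * (\<integral>\<^sup>+w. (\<Sum>k\<in>{..m}. ennreal (exp (- lam * (l \<bullet> w T))) * indicator (A k) w) \<partial>P)"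
    using AP by (subst nn_integral_sum) (auto simp: sum_distrib_left)
  also have "\<dots> \<le> ennreal (exp C) * (\<integral>\<^sup>+w. ennreal (exp (- lam * (l \<bullet> w T))) \<partial>P)"
  proof (intro mult_left_mono nn_integral_mono)
    fix w :: "real \<Rightarrow> real^'n"
    have "(\<Sum>k\<in>{..m}. ennreal (exp (- lam * (l \<bullet> w T))) * indicator (A k) w) = ennreal (exp (- lam * (l \<bullet> w T))) * indicator (\<Union>k\<in>{..m}. A k) w"
      by (simp add: indicator_UN_disjoint[OF _ disj] sum_distrib_left)
    then show "(\<Sum>k\<in>{..m}. ennreal (exp (- lam * (l \<bullet> w T))) * indicator (A k) w) \<le> ennreal (exp (- lam * (l \<bullet> w T)))"
      by (simp add: indicator_def)
  qed auto
  finally have "ennreal (exp (- (lam * a))) * (ennreal (exp (lam * a)) * emeasure P ?U)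
     \<le> ennreal (exp (- (lam * a))) * (ennreal (exp C) * (\<integral>\<^sup>+w. ennreal (exp (- lam * (l \<bullet> w T))) \<partial>P))"
    by (rule mult_left_mono) simp
  then show ?thesis
    by (simp add: mult.assoc[symmetric] ennreal_mult[symmetric] exp_add[symmetric])
qed

end

subsection \<open>Exit from a slab\<close>

lemma continuous_gt_rat:
  fixes f :: "real \<Rightarrow> real"
  assumes f: "continuous_on UNIV f" and q: "0 < q" and s: "s \<in> {0..q}" and gt: "f s > c"
  shows "\<exists>r::rat. 0 \<le> real_of_rat r \<and> real_of_rat r \<le> q \<and> f (real_of_rat r) > c"
proof -
  have "open {x. c < f x}" by (rule open_Collect_less[OF continuous_on_const f])
  then obtain d where d: "d > 0" "\<And>x. dist x s < d \<Longrightarrow> c < f x"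
    unfolding open_dist using gt by blast
  have "max 0 (s - d) < min q (s + d)" using d(1) q s by auto
  then obtain r :: rat where r: "max 0 (s - d) < real_of_rat r" "real_of_rat r < min q (s + d)"
    using of_rat_dense by blast
  then have "dist (real_of_rat r) s < d" by (auto simp: dist_real_def abs_less_iff)
  then show ?thesis using d(2) r by (intro exI[of _ r]) auto
qed

text \<open>The maximum over a compact interval is attained, so staying strictly below c leaves a
  gap 1 / (k + 1). With the gap, rational times suffice; a strict bound at rational times alone
  could become an equality in the limit. This reduces an uncountable condition to countable
  operations.\<close>

lemma all_less_iff_rat:
  fixes f :: "real \<Rightarrow> real"
  assumes f: "continuous_on UNIV f" and q: "0 < q"
  shows "(\<forall>s\<in>{0..q}. f s < c) \<longleftrightarrow>
    (\<exists>k::nat. \<forall>r::rat. 0 \<le> real_of_rat r \<and> real_of_rat r \<le> q \<longrightarrow> f (real_of_rat r) \<le> c - inverse (real (Suc k)))" (is "_ \<longleftrightarrow> (\<exists>k. ?R k)")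
proof
  assume a: "\<forall>s\<in>{0..q}. f s < c"
  obtain s where s: "s \<in> {0..q}" "\<And>t. t \<in> {0..q} \<Longrightarrow> f t \<le> f s"
    using continuous_attains_sup[OF compact_Icc _ continuous_on_subset[OF f subset_UNIV], of 0 q] q by auto
  then obtain k where "inverse (real (Suc k)) < c - f s"
    using a reals_Archimedean[of "c - f s"] by auto
  then have "f t \<le> c - inverse (real (Suc k))" if "t \<in> {0..q}" for t using s(2)[OF that] by linarith
  then show "\<exists>k. ?R k"
    by (intro exI[of _ k]) auto
next
  assume "\<exists>k. ?R k"
  then obtain k where k: "\<And>r::rat. 0 \<le> real_of_rat r \<Longrightarrow> real_of_rat r \<le> q \<Longrightarrow> f (real_of_rat r) \<le> c - inverse (real (Suc k))" by blast
  show "\<forall>s\<in>{0..q}. f s < c"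
  proof
    fix s assume s: "s \<in> {0..q}"
    have "\<not> f s > c - inverse (real (Suc k))"
      using continuous_gt_rat[OF f q s, of "c - inverse (real (Suc k))"] k by (auto simp: not_less[symmetric])
    moreover have "inverse (real (Suc k)) > 0" by simp
    ultimately show "f s < c" by linarith
  qed
qed

lemma slab_empty: "b > 0 \<Longrightarrow> L \<le> 0 \<Longrightarrow> slab l b L = {}"
  using mult_nonneg_nonpos[of b L] by (auto simp: slab_def)

text \<open>The set of times outside the slab is closed, so the exit time is attained. There the
  path is at or beyond one of the two faces, and a negative coordinate singles out the back face.
  The infimum disappears from the description.\<close>

lemma exit_back_event_iff:
  assumes b: "b > 0" and L: "L > 0"
  shows "exit_back_event l b L = {w\<in>paths. \<exists>t\<ge>0. w t \<bullet> l \<le> - b * L \<and> (\<forall>s\<in>{0..t}. w s \<bullet> l < L)}"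
proof (intro set_eqI)
  fix w :: "real \<Rightarrow> real^'a"
  let ?E = "{w\<in>paths. \<exists>t\<ge>0. w t \<bullet> l \<le> - b * L \<and> (\<forall>s\<in>{0..t}. w s \<bullet> l < L)}"
  define S where "S = {t. 0 \<le> t \<and> w t \<notin> slab l b L}"
  define T where "T = Inf S"
  have T: "exit_time (slab l b L) w = T" by (simp add: exit_time_def T_def S_def)
  have bL: "- b * L < 0" using b L by simp
  have bdd: "bdd_below S" by (rule bdd_belowI[of _ 0]) (auto simp: S_def)
  have lower: "T \<le> t" if "t \<in> S" for t unfolding T_def using that bdd by (rule cInf_lower)
  have in_S: "T \<in> S" if w: "w \<in> paths" and "S \<noteq> {}"
  proof -
    have c: "continuous_on UNIV w" using w by (simp add: paths_def)
    have "S = {0..} \<inter> ({t. w t \<bullet> l \<le> - b * L} \<union> {t. L \<le> w t \<bullet> l})" by (auto simp: S_def slab_def not_less)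
    moreover have "closed ({0..} \<inter> ({t. w t \<bullet> l \<le> - b * L} \<union> {t. L \<le> w t \<bullet> l}))"
      by (intro closed_Int closed_Un closed_atLeast closed_Collect_le continuous_intros c)
    ultimately have "closed S" by simp
    then show ?thesis unfolding T_def using that bdd by (intro closed_contains_Inf)
  qed
  show "w \<in> exit_back_event l b L \<longleftrightarrow> w \<in> ?E"
  proof
    assume "w \<in> exit_back_event l b L"
    then have w: "w \<in> paths" and ne: "S \<noteq> {}" and neg: "w T \<bullet> l < 0"
      by (auto simp: exit_back_event_def T S_def)
    have TS: "T \<in> S" by (rule in_S[OF w ne])
    have "w T \<bullet> l \<le> - b * L" using TS neg L by (auto simp: S_def slab_def)
    moreover have "w s \<bullet> l < L" if "s \<in> {0..T}" for s
    proof (cases "s = T")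
      case False
      then have "s \<notin> S" using lower[of s] that by auto
      then show ?thesis using that by (auto simp: S_def slab_def)
    qed (use neg L in simp)
    ultimately show "w \<in> ?E"
      using w TS by (auto simp: S_def)
  next
    assume "w \<in> ?E"
    then obtain t where w: "w \<in> paths" and t: "t \<ge> 0" "w t \<bullet> l \<le> - b * L" "\<And>s. s \<in> {0..t} \<Longrightarrow> w s \<bullet> l < L" by blast
    have tS: "t \<in> S" using t by (auto simp: S_def slab_def)
    have TS: "T \<in> S" using in_S[OF w] tS by blast
    have "w T \<bullet> l < L" using t(3)[of T] lower[OF tS] TS by (auto simp: S_def)
    then have "w T \<bullet> l < 0" using TS bL by (auto simp: S_def slab_def)
    then show "w \<in> exit_back_event l b L" using w tS by (auto simp: exit_back_event_def T S_def)
  qed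
qed

lemma exit_back_event_measurable:
  assumes b: "b > 0"
  shows "exit_back_event l b L \<in> sets path_space"
proof (cases "L > 0")
  case False
  \<comment> \<open>For L \<le> 0 the slab is empty and the exit time is 0.\<close>
  then have "exit_back_event l b L = {w\<in>space path_space. w 0 \<bullet> l < 0}"
    using slab_empty[OF b, of L l] by (auto simp: exit_back_event_def exit_time_def cInf_atLeast simp flip: atLeast_def intro: exI[of _ 0])
  moreover note [measurable] = coordinate_measurable
  have "{w\<in>space path_space. w 0 \<bullet> l < 0} \<in> sets path_space" by measurable
  ultimately show ?thesis by simp
next
  case True
  have "exit_back_event l b L = {w\<in>space path_space. \<exists>q::rat. 0 < q \<and>
     (\<exists>k::nat. \<forall>r::rat. 0 \<le> real_of_rat r \<and> real_of_rat r \<le> real_of_rat q \<longrightarrow> w (real_of_rat r) \<bullet> l \<le> L - inverse (real (Suc k))) \<and>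
     \<not> (\<exists>k::nat. \<forall>r::rat. 0 \<le> real_of_rat r \<and> real_of_rat r \<le> real_of_rat q \<longrightarrow> - (w (real_of_rat r) \<bullet> l) \<le> b * L - inverse (real (Suc k)))}"
    (is "_ = ?E")
  proof (intro set_eqI)
    fix w
    show "w \<in> exit_back_event l b L \<longleftrightarrow> w \<in> ?E"
    proof (cases "w \<in> paths")
      case False
      then show ?thesis by (auto simp: exit_back_event_def)
    next
      case w: True
      then have c: "continuous_on UNIV w" by (simp add: paths_def)
      have c1: "continuous_on UNIV (\<lambda>t. w t \<bullet> l)" "continuous_on UNIV (\<lambda>t. - (w t \<bullet> l))"
        by (intro continuous_intros c)+
      \<comment> \<open>Staying below L is an open condition, so the hitting time of the back face
        can be enlarged to a rational horizon q.\<close>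
      let ?R = "\<lambda>q::rat. (\<forall>s\<in>{0..real_of_rat q}. w s \<bullet> l < L) \<and> \<not> (\<forall>s\<in>{0..real_of_rat q}. - (w s \<bullet> l) < b * L)"
      have "w \<in> exit_back_event l b L \<longleftrightarrow> (\<exists>q::rat. 0 < q \<and> ?R q)"
      proof
        assume "w \<in> exit_back_event l b L"
        then obtain t where t: "t \<ge> 0" "w t \<bullet> l \<le> - b * L" "\<And>s. s \<in> {0..t} \<Longrightarrow> w s \<bullet> l < L"
          unfolding exit_back_event_iff[OF b True] by blast
        have "open {x. w x \<bullet> l < L}" by (rule open_Collect_less[OF c1(1) continuous_on_const])
        moreover have "t \<in> {x. w x \<bullet> l < L}" using t(1) t(3)[of t] by simp
        ultimately obtain d where d: "d > 0" "\<And>x. dist x t < d \<Longrightarrow> w x \<bullet> l < L"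
          unfolding open_dist by blast
        obtain q :: rat where q: "t < real_of_rat q" "real_of_rat q < t + d" using of_rat_dense[of t "t + d"] d(1) by auto
        have "w s \<bullet> l < L" if "s \<in> {0..real_of_rat q}" for s
          using t(3)[of s] d(2)[of s] q that by (cases "s \<le> t") (auto simp: dist_real_def)
        moreover have "\<not> (\<forall>s\<in>{0..real_of_rat q}. - (w s \<bullet> l) < b * L)" using t(1,2) q by (auto intro!: bexI[of _ t])
        moreover have "0 < real_of_rat q" using t(1) q(1) by linarith
        then have "0 < q" by simp
        ultimately show "\<exists>q::rat. 0 < q \<and> ?R q" by blast
      next
        assume "\<exists>q::rat. 0 < q \<and> ?R q"
        then show "w \<in> exit_back_event l b L"
          unfolding exit_back_event_iff[OF b True] using w by (force simp: not_less)
      qed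
      also have "\<dots> \<longleftrightarrow> w \<in> ?E"
        using all_less_iff_rat[OF c1(1), of _ L] all_less_iff_rat[OF c1(2), of _ "b * L"] w
        by (auto simp: cong: conj_cong)
      finally show ?thesis .
    qed
  qed
  moreover note [measurable] = coordinate_measurable
  have "?E \<in> sets path_space" by measurable
  ultimately show ?thesis by (simp only:)
qed

context gradient_diffusion
begin

definition exit_const :: real where
  "exit_const = (let c = 3 * lam + 3/2 + 3 * B in
     exp (c + c\<^sup>2 * real CARD('n) + B * lam + lam) * decay_const TYPE('n) lam \<eta> \<epsilon> \<delta> * exp (- rate) / (1 - exp (- rate)))"

lemma decay_const_nonneg: "0 \<le> decay_const TYPE('n) lam \<eta> \<epsilon> \<delta>"
  unfolding decay_const_def using bump_mass_pos[OF \<epsilon>_pos, where 'n='n]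
  by (intro divide_nonneg_nonneg mult_nonneg_nonneg add_nonneg_nonneg Bochner_Integration.integral_nonneg) auto

text \<open>Any backward exit crosses the level in some unit time interval [n, n + 1]. The maximal
  inequality and the moment at time n + 1 bound each such probability, and the decay in n makes the
  union bound a geometric series.\<close>

lemma exit_back_bound:
  assumes l': "norm l' = 1" "2 * lam * norm (l - l') \<le> \<delta>" and rate: "rate > 0"
    and a: "a > 0" and L: "L > 0"
  shows "emeasure P (exit_back_event l' a L) \<le> ennreal (exit_const * exp (- lam * a * L))"
proof -
  have lam0: "lam > 0" using lam_gt \<delta>_pos by simp
  define c where "c = 3 * lam + 3/2 + 3 * B"
  define C where "C = c + c\<^sup>2 * real CARD('n) + B * lam"
  define dc where "dc = decay_const TYPE('n) lam \<eta> \<epsilon> \<delta>"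
  \<comment> \<open>The margin 1 turns reaching the level - a L into a strict inequality on an open
    set of times, which some dyadic time detects. It costs the extra summand lam in the exponent of
    \<open>exit_const\<close>.\<close>
  define h where "h = a * L - 1"
  define D where "D n m = {w\<in>space P. \<exists>k\<le>(2::nat) ^ m. w (real n + real k / 2 ^ m) \<bullet> l' < - h}" for n m :: nat
  have Dm [measurable]: "D n m \<in> sets P" for n m unfolding D_def by measurable
  let ?B = "\<lambda>n. ennreal (exp (C - lam * h) * (dc * exp (- rate * real (Suc n))))"
  have Dbound: "emeasure P (D n m) \<le> ?B n" for n m
  proof -
    have "emeasure P (D n m) \<le> ennreal (exp (C - lam * h)) * (\<integral>\<^sup>+w. ennreal (exp (- lam * (l' \<bullet> w (real (Suc n))))) \<partial>P)"
      unfolding D_def C_def c_def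
      by (rule grid_maximal_inequality[OF l'(1) lam0]) (auto simp: field_simps simp flip: of_nat_power intro: divide_right_mono)
    also have "\<dots> \<le> ennreal (exp (C - lam * h)) * ennreal (dc * exp (- rate * real (Suc n)))"
      unfolding dc_def by (intro mult_left_mono moment_decay l') auto
    also have "\<dots> = ?B n"
      by (rule ennreal_mult[symmetric]) (use decay_const_nonneg in \<open>auto simp: dc_def\<close>)
    finally show ?thesis .
  qed
  have inc: "incseq (D n)" for n
  proof (rule incseq_SucI, rule subsetI)
    fix m w assume "w \<in> D n m"
    then obtain k where k: "w \<in> space P" "k \<le> 2 ^ m" "w (real n + real k / 2 ^ m) \<bullet> l' < - h" by (auto simp: D_def)
    \<comment> \<open>Dyadic grids are nested, index k becoming 2 k, so the bound, uniform in m,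
      passes to the union.\<close>
    then have "w (real n + real (2 * k) / 2 ^ Suc m) \<bullet> l' < - h" "2 * k \<le> 2 ^ Suc m" by auto
    then show "w \<in> D n (Suc m)" using k(1) unfolding D_def by blast
  qed
  have Ebound: "emeasure P (\<Union>m. D n m) \<le> ?B n" for n
  proof -
    have "emeasure P (\<Union>m. D n m) = (SUP m. emeasure P (D n m))"
      by (rule SUP_emeasure_incseq[symmetric]) (use Dm inc in auto)
    then show ?thesis using Dbound[of n] by (simp only:) (rule SUP_least)
  qed
  have cover: "exit_back_event l' a L \<subseteq> (\<Union>n. \<Union>m. D n m)"
  proof
    fix w assume "w \<in> exit_back_event l' a L"
    then obtain t where w: "w \<in> paths" and t: "t \<ge> 0" "w t \<bullet> l' \<le> - a * L"
      unfolding exit_back_event_iff[OF a L] by blast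
    have c: "continuous_on UNIV (\<lambda>t. w t \<bullet> l')" using w by (intro continuous_intros) (simp add: paths_def)
    have "open {s. w s \<bullet> l' < - h}" by (rule open_Collect_less[OF c continuous_on_const])
    moreover have "t \<in> {s. w s \<bullet> l' < - h}" using t by (simp add: h_def)
    ultimately obtain d where d: "d > 0" "\<And>s. dist s t < d \<Longrightarrow> w s \<bullet> l' < - h" unfolding open_dist by blast
    obtain m where m: "inverse (2 ^ m) < d"
      using real_arch_pow_inv[OF d(1), of "1/2"] by (auto simp: power_one_over inverse_eq_divide)
    define n where "n = nat \<lfloor>t\<rfloor>"
    define k where "k = nat \<lfloor>(t - real n) * 2 ^ m\<rfloor>"
    have n: "real n \<le> t" "t < real n + 1" using t(1) unfolding n_def by linarith+
    have "0 \<le> (t - real n) * 2 ^ m" using n by simp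
    then have k: "real k \<le> (t - real n) * 2 ^ m" "(t - real n) * 2 ^ m < real k + 1" unfolding k_def by linarith+
    have "(t - real n) * 2 ^ m \<le> 1 * 2 ^ m" using n by (intro mult_right_mono) auto
    then have "real k \<le> 2 ^ m" using k(1) by linarith
    then have "real k \<le> real (2 ^ m)" by simp
    then have k2: "k \<le> 2 ^ m" by (simp only: of_nat_le_iff)
    have "real n + real k / 2 ^ m \<le> t" using k(1) by (simp add: field_simps)
    moreover have "t < real n + real k / 2 ^ m + inverse (2 ^ m)" using k(2) by (simp add: field_simps)
    ultimately have "dist (real n + real k / 2 ^ m) t < d" using m by (simp add: dist_real_def)
    then have "w (real n + real k / 2 ^ m) \<bullet> l' < - h" by (rule d(2))
    then have "w \<in> D n m" using k2 w unfolding D_def space_P by blast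
    then show "w \<in> (\<Union>n. \<Union>m. D n m)" by blast
  qed
  have r1: "0 < exp (- rate)" "exp (- rate) < 1" using rate by auto
  let ?c = "exp (C - lam * h) * dc * exp (- rate)"
  have "emeasure P (exit_back_event l' a L) \<le> emeasure P (\<Union>n. \<Union>m. D n m)"
    by (rule emeasure_mono[OF cover]) measurable
  also have "\<dots> \<le> (\<Sum>n. emeasure P (\<Union>m. D n m))"
    by (rule emeasure_subadditive_countably) (auto simp: image_subset_iff)
  also have "\<dots> \<le> (\<Sum>n. ennreal ((?c) * exp (- rate) ^ n))"
  proof (rule suminf_le)
    fix n
    have "exp (C - lam * h) * (dc * exp (- rate * real (Suc n))) = (?c) * exp (- rate) ^ n"
    proof -
      have "exp (- rate * real (Suc n)) = exp (- rate) ^ Suc n" by (metis exp_of_nat_mult mult.commute)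
      then show ?thesis by simp
    qed
    then show "emeasure P (\<Union>m. D n m) \<le> ennreal ((?c) * exp (- rate) ^ n)"
      using Ebound[of n] by (simp only:)
  qed auto
  also have "\<dots> = ennreal ((?c) * (1 / (1 - exp (- rate))))"
  proof (rule suminf_ennreal_eq)
    show "0 \<le> ?c * exp (- rate) ^ n" for n
      using decay_const_nonneg by (simp add: dc_def)
    show "(\<lambda>n. ?c * exp (- rate) ^ n) sums
       (?c * (1 / (1 - exp (- rate))))"
      using r1 by (intro sums_mult geometric_sums) simp
  qed
  also have "(?c) * (1 / (1 - exp (- rate))) = exit_const * exp (- lam * a * L)"
  proof -
    have "exp (C - lam * h) = exp (C + lam) * exp (- lam * a * L)"
      unfolding exp_add[symmetric] by (simp add: h_def algebra_simps)
    then show ?thesis by (simp add: exit_const_def Let_def c_def[symmetric] C_def[symmetric] dc_def[symmetric])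
  qed
  finally show ?thesis .
qed

end

section \<open>The logarithmic limit and the annealed statement\<close>

lemma Limsup_eln_exp_decay:
  assumes C: "C > 0" and c: "c > 0" and p: "\<And>L. L > 0 \<Longrightarrow> 0 \<le> p L \<and> p L \<le> C * exp (- c * L)"
  shows "Limsup at_top (\<lambda>L::real. eln (p L) / ereal L) < 0"
proof -
  have "Limsup at_top (\<lambda>L::real. eln (p L) / ereal L) \<le> ereal (- c / 2)"
  proof (rule Limsup_bounded)
    show "\<forall>\<^sub>F L in at_top. eln (p L) / ereal L \<le> ereal (- c / 2)"
      \<comment> \<open>Beyond this threshold half of the rate absorbs ln C. When p L = 0 the
        quotient is - \<infinity>, and the bound is immediate.\<close>
      using eventually_ge_at_top[of "max 1 (2 * \<bar>ln C\<bar> / c)"]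
    proof eventually_elim
      case (elim L)
      then have L: "L > 0" "2 * \<bar>ln C\<bar> / c \<le> L" by auto
      then have lnC: "ln C \<le> c * L / 2" using c by (simp add: divide_le_eq mult.commute)
      show ?case
      proof (cases "p L = 0")
        case True
        then show ?thesis using L by (simp add: eln_def)
      next
        case False
        then have pos: "0 < p L" using p[OF L(1)] by simp
        then have "ln (p L) \<le> ln (C * exp (- c * L))" using p[OF L(1)] by simp
        also have "\<dots> = ln C - c * L" using C by (simp add: ln_mult)
        finally have "ln (p L) \<le> (- c / 2) * L" using lnC by simp
        then have "ln (p L) / L \<le> - c / 2" using L by (simp add: divide_le_eq)
        then show ?thesis using False L(1) by (simp add: eln_def)
      qed
    qed
  qed
  also have "ereal (- c / 2) < 0" using c by simp
  finally show ?thesis .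
qed

theorem theorem4p1:
  fixes M :: "'w measure"
    and tr :: "real^'n::finite \<Rightarrow> 'w \<Rightarrow> 'w"
    and \<phi> :: "'w \<Rightarrow> real"
    and \<eta> \<beta> K lam :: real
    and l :: "real^'n"
    and P0 :: "'w \<Rightarrow> (real \<Rightarrow> real^'n) measure"
  assumes "prob_space M"
    and "tr 0 = id" and "\<And>x y. tr (x + y) = tr x \<circ> tr y"
    and "(\<lambda>(x, \<omega>). tr x \<omega>) \<in> (borel \<Otimes>\<^sub>M M) \<rightarrow>\<^sub>M M"
    and "\<And>x. distr M M (tr x) = M"
    and "\<phi> \<in> borel_measurable M"
    and "\<And>\<omega>. \<bar>\<phi> \<omega>\<bar> \<le> \<eta>"
    and "\<And>\<omega> y. (\<lambda>z. \<phi> (tr z \<omega>)) differentiable (at y)"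
    and "\<And>\<omega> y. norm (grad (\<lambda>z. \<phi> (tr z \<omega>)) y) \<le> \<beta>"
    and "\<And>\<omega> y z. norm (grad (\<lambda>z. \<phi> (tr z \<omega>)) y - grad (\<lambda>z. \<phi> (tr z \<omega>)) z) \<le> K * norm (y - z)"
    and "lam > 0" and "norm l = 1"
    and "\<And>\<omega>. solves_MP (\<lambda>x. grad (\<lambda>z. \<phi> (tr z \<omega>)) x + lam *\<^sub>R l) 0 (P0 \<omega>)"
    and "\<And>A. A \<in> sets path_space \<Longrightarrow> (\<lambda>\<omega>. emeasure (P0 \<omega>) A) \<in> borel_measurable M"
  shows "condT M P0 l"
proof -
  interpret M: prob_space M by fact
  note bound = assms(7) and diff = assms(8) and bnd = assms(9) and lip = assms(10)
    and lam = assms(11) and l = assms(12) and MP = assms(13)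
  \<comment> \<open>g^2 equals (lam / 2)^2 exp (-4 \<eta>) / 4, a lower bound for the gap term once
    \<delta> \<le> lam / 2. With \<delta> = g / 4 and K \<epsilon> \<le> \<delta> the two error
    terms are at most g^2 / 4 and g^2 / 8, so \<open>rate\<close> stays positive.\<close>
  define g where "g = lam * exp (- 2 * \<eta>) / 4"
  define \<delta> where "\<delta> = g / 4"
  define \<epsilon> where "\<epsilon> = \<delta> / (\<bar>K\<bar> + 1)"
  have \<eta>0: "0 \<le> \<eta>" using bound abs_ge_zero order_trans by blast
  have g: "0 < g" using lam by (simp add: g_def)
  have \<delta>: "0 < \<delta>" and \<epsilon>: "0 < \<epsilon>" using g by (auto simp: \<delta>_def \<epsilon>_def)
  have "g \<le> lam / 4" using lam \<eta>0 by (simp add: g_def)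
  then have \<delta>lam: "\<delta> \<le> lam / 2" and \<delta>lt: "\<delta> < lam" using lam by (auto simp: \<delta>_def)
  have K\<epsilon>: "\<bar>K\<bar> * \<epsilon> \<le> \<delta>"
  proof -
    have "\<bar>K\<bar> * \<epsilon> \<le> (\<bar>K\<bar> + 1) * \<epsilon>" using \<epsilon> by (simp add: distrib_right)
    moreover have "\<bar>K\<bar> + 1 \<noteq> 0" using abs_ge_zero[of K] by linarith
    then have "(\<bar>K\<bar> + 1) * \<epsilon> = \<delta>" by (simp add: \<epsilon>_def)
    ultimately show ?thesis by simp
  qed
  let ?G = "\<lambda>\<omega>. grad (\<lambda>z. \<phi> (tr z \<omega>))"
  \<comment> \<open>The locale asks for a nonnegative Lipschitz constant, hence the absolute value
    of K.\<close>
  have gd: "gradient_diffusion (\<lambda>x. ?G \<omega> x + lam *\<^sub>R l) (P0 \<omega>) (\<beta> + lam)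
      (\<lambda>z. \<phi> (tr z \<omega>)) (?G \<omega>) \<eta> \<bar>K\<bar> lam l \<epsilon> \<delta>" for \<omega>
  proof
    have lip': "norm ((?G \<omega> y + lam *\<^sub>R l) - (?G \<omega> z + lam *\<^sub>R l)) \<le> \<bar>K\<bar> * norm (y - z)" for y z
      using lip[of \<omega> y z] mult_right_mono[OF abs_ge_self[of K] norm_ge_zero[of "y - z"]] by simp
    then show "norm ((?G \<omega> y + lam *\<^sub>R l) - (?G \<omega> z + lam *\<^sub>R l)) \<le> \<bar>K\<bar> * norm (y - z)" for y z .
    have "\<bar>K\<bar>-lipschitz_on UNIV (\<lambda>x. ?G \<omega> x + lam *\<^sub>R l)"
      by (rule lipschitz_onI) (use lip' in \<open>auto simp: dist_norm\<close>)
    then show "continuous_on UNIV (\<lambda>x. ?G \<omega> x + lam *\<^sub>R l)"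
      by (rule lipschitz_on_continuous_on)
    show "norm (?G \<omega> x + lam *\<^sub>R l) \<le> \<beta> + lam" for x
      using norm_triangle_ineq[of "?G \<omega> x" "lam *\<^sub>R l"] bnd[of \<omega> x] lam l by simp
    show "((\<lambda>z. \<phi> (tr z \<omega>)) has_derivative (\<lambda>h. ?G \<omega> x \<bullet> h)) (at x)" for x
      by (rule has_derivative_grad[OF diff])
  qed (use MP bound l \<epsilon> \<delta> \<delta>lt in auto)
  define rt where "rt = (lam - \<delta>)\<^sup>2 * exp (- 4 * \<eta>) / 4 - (\<bar>K\<bar> * \<epsilon> + \<delta>)\<^sup>2 - 2 * \<delta> * (\<bar>K\<bar> * \<epsilon>)"
  have rt: "rt > 0"
  proof -
    have "(lam / 2)\<^sup>2 \<le> (lam - \<delta>)\<^sup>2" using \<delta>lam lam by (intro power_mono) auto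
    then have "(lam / 2)\<^sup>2 * exp (- 4 * \<eta>) / 4 \<le> (lam - \<delta>)\<^sup>2 * exp (- 4 * \<eta>) / 4" by simp
    moreover have "(lam / 2)\<^sup>2 * exp (- 4 * \<eta>) / 4 = g\<^sup>2"
    proof -
      have "(exp (- 2 * \<eta>))\<^sup>2 = exp (- 4 * \<eta>)" by (simp flip: exp_double)
      then show ?thesis by (simp add: g_def power_mult_distrib power_divide)
    qed
    moreover have "(\<bar>K\<bar> * \<epsilon> + \<delta>)\<^sup>2 \<le> (\<delta> + \<delta>)\<^sup>2" using K\<epsilon> \<epsilon> \<delta> by (intro power_mono) auto
    moreover have "2 * \<delta> * (\<bar>K\<bar> * \<epsilon>) \<le> 2 * \<delta> * \<delta>" using K\<epsilon> \<delta> by (intro mult_left_mono) auto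
    moreover have "(\<delta> + \<delta>)\<^sup>2 = g\<^sup>2 / 4" "2 * \<delta> * \<delta> = g\<^sup>2 / 8" by (auto simp: \<delta>_def power2_eq_square)
    moreover have "0 < g\<^sup>2" using g by simp
    ultimately show ?thesis unfolding rt_def by linarith
  qed
  define c where "c = 3 * lam + 3/2 + 3 * (\<beta> + lam)"
  \<comment> \<open>The value of \<open>exit_const\<close>, written without reference to an
    environment, so that the bound below is uniform in \<omega> and survives averaging.\<close>
  define C where "C = exp (c + c\<^sup>2 * real CARD('n) + (\<beta> + lam) * lam + lam) * decay_const TYPE('n) lam \<eta> \<epsilon> \<delta> * exp (- rt) / (1 - exp (- rt))"
  have quenched: "emeasure (P0 \<omega>) (exit_back_event l' a L) \<le> ennreal (C * exp (- lam * a * L))"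
    if l': "norm l' = 1" "dist l' l < \<delta> / (2 * lam)" and a: "a > 0" and L: "L > 0" for \<omega> l' a L
  proof -
    interpret gradient_diffusion "\<lambda>x. grad (\<lambda>z. \<phi> (tr z \<omega>)) x + lam *\<^sub>R l" "P0 \<omega>" "\<beta> + lam"
      "\<lambda>z. \<phi> (tr z \<omega>)" "grad (\<lambda>z. \<phi> (tr z \<omega>))" \<eta> "\<bar>K\<bar>" lam l \<epsilon> \<delta>
      by (rule gd)
    have r: "rate = rt" unfolding rate_def rt_def ..
    have "2 * lam * norm (l - l') \<le> \<delta>"
      using l'(2) lam by (simp add: dist_norm norm_minus_commute field_simps)
    from exit_back_bound[OF l'(1) this _ a L] rt show ?thesis
      by (simp add: r exit_const_def Let_def C_def c_def)
  qed
  show ?thesis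
    unfolding condT_def
  \<comment> \<open>The radius is the largest tilt that \<open>moment_decay\<close>
    tolerates.\<close>
  proof (intro exI[of _ "\<delta> / (2 * lam)"] conjI allI impI)
    show "0 < \<delta> / (2 * lam)" using \<delta> lam by simp
    fix l' and a :: real assume l': "norm l' = 1 \<and> dist l' l < \<delta> / (2 * lam)" and a: "0 < a"
    show "exit_back_event l' a L \<in> sets path_space" for L by (rule exit_back_event_measurable[OF a])
    show "Limsup at_top (\<lambda>L::real. eln (annealed M P0 (exit_back_event l' a L)) / ereal L) < 0"
    proof (rule Limsup_eln_exp_decay[where C="max C 1" and c="lam * a"])
      fix L :: real assume L: "L > 0"
      have "(\<integral>\<^sup>+\<omega>. emeasure (P0 \<omega>) (exit_back_event l' a L) \<partial>M) \<le> (\<integral>\<^sup>+\<omega>. ennreal (max C 1 * exp (- (lam * a) * L)) \<partial>M)"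
      proof (rule nn_integral_mono)
        fix \<omega>
        have "C * exp (- lam * a * L) \<le> max C 1 * exp (- (lam * a) * L)" by (simp add: mult_right_mono)
        then show "emeasure (P0 \<omega>) (exit_back_event l' a L) \<le> ennreal (max C 1 * exp (- (lam * a) * L))"
          using quenched[OF _ _ a L, of l' \<omega>] l' by (meson ennreal_leI order_trans)
      qed
      also have "\<dots> = ennreal (max C 1 * exp (- (lam * a) * L))" by (simp add: M.emeasure_space_1)
      finally show "0 \<le> annealed M P0 (exit_back_event l' a L) \<and> annealed M P0 (exit_back_event l' a L) \<le> max C 1 * exp (- (lam * a) * L)"
        unfolding annealed_def by (intro conjI enn2real_nonneg enn2real_leI) auto
    qed (use lam a in auto)
  qed
qed

end
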